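(* Let $(\Sigma_A,T)$ be a topologically mixing subshift of finite type, $\Psi\in\mathcal C_{aa}^-(\Sigma_A,T)$ and $\Phi\in\mathcal C_{aa}(\Sigma_A,T,d)$. The function $\Lambda=\Lambda_\Phi^\Psi:L_\Phi\to\mathbb R$ is bounded, nonnegative and weakly concave. It is continuous on any closed interval (segment) $I\subset L_\Phi$ and on $\mathrm{ri}(B)$, where $B\subset L_\Phi$ is any convex set. Consequently it is continuous on $\mathrm{ri}(L_\Phi)$. If moreover $L_\Phi$ is a convex polyhedron, then $\Lambda$ is continuous on $L_\Phi$. Assume $I=[\alpha_0,\alpha_1]\subset L_\Phi$ and $\alpha_{\max}\in I$ is such that $\Lambda(\alpha_{\max})=\max\{\Lambda(\alpha):\alpha\in I\}$; then $\Lambda$ is non-increasing along the segment from $\alpha_{\max}$ to $\alpha_j$, for $j=0,1$.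
   Context: Subshift. $A$ is an $m\times m$ matrix with entries in $\{0,1\}$ such that all entries of $A^{p_0}$ are positive for some $p_0\in\mathbb N$; $\Sigma_A=\{x=x_1x_2\cdots\in\{1,\dots,m\}^{\mathbb N}:A(x_i,x_{i+1})=1\ \forall i\}$ with the product topology, and $T$ is the shift. $\mathcal M(\Sigma_A,T)$ is the set of $T$-invariant Borel probability measures. $\Sigma_{A,n}$ is the set of admissible words of length $n$, $\Sigma_{A,*}=\bigcup_{n\ge0}\Sigma_{A,n}$, $|w|$ is the length of $w$, $[w]=\{x\in\Sigma_A:x|_{|w|}=w\}$ where $x|_n$ is the prefix of length $n$, and $w^*$ is $w$ with its last letter deleted. Almost additive potentials. $\mathcal C_{aa}(\Sigma_A,T)$ is the set of sequences $\Phi=(\phi_n)_{n\ge1}$ of continuous functions $\phi_n:\Sigma_A\to\mathbb R$ for which there is a constant $C(\Phi)$ (fixed along with $\Phi$) with $-C(\Phi)+\phi_n+\phi_p\circ T^n\le\phi_{n+p}\le C(\Phi)+\phi_n+\phi_p\circ T^n$ for all $n,p\in\mathbb N$. Put $\Phi_{\max}=\max\phi_1+C(\Phi)$; $\mathcal C_{aa}^-(\Sigma_A,T)=\{\Phi\in\mathcal C_{aa}(\Sigma_A,T):\Phi_{\max}<0\}$. $\mathcal C_{aa}(\Sigma_A,T,d)$ is the set of $\Phi=(\Phi^1,\dots,\Phi^d)$ with each $\Phi^i\in\mathcal C_{aa}(\Sigma_A,T)$, regarded as a sequence of maps $\phi_n:\Sigma_A\to\mathbb R^d$. $\Phi_*(\mu)=\lim_{n\to\infty}\int\frac{\phi_n}{n}\,d\mu$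 and $L_\Phi=\{\Phi_*(\mu):\mu\in\mathcal M(\Sigma_A,T)\}$, a compact convex subset of $\mathbb R^d$. For $\Psi=(\psi_n)\in\mathcal C_{aa}^-(\Sigma_A,T)$ and $w\in\Sigma_{A,n}$, $\Psi[w]=\sup\{\exp(\psi_n(x)):x\in[w]\}$, with $\Psi[w]=1$ for the empty word. $\mathcal B_n(\Psi)$ is the set of $w\in\Sigma_{A,*}$ with $\Psi[w]\le e^{-n}$ and ($w$ is empty or $\Psi[w^*]>e^{-n}$); these are the words whose cylinders are the closed balls of radius $e^{-n}$ for the ultrametric $d_\Psi(x,y)=\Psi[x\wedge y]$ ($x\ne y$, $x\wedge y$ the longest common prefix). For $\alpha\in L_\Phi$, $f(\alpha,n,\epsilon)$ is the number of $u\in\mathcal B_n(\Psi)$ for which there is $x\in[u]$ with $\left|\phi_{|u|}(x)/|u|-\alpha\right|<\epsilon$, and $\Lambda(\alpha)=\lim_{\epsilon\to0}\liminf_{n\to\infty}\frac{\log f(\alpha,n,\epsilon)}n=\lim_{\epsilon\to0}\limsup_{n\to\infty}\frac{\log f(\alpha,n,\epsilon)}n$ (the two are equal). For $B\subset\mathbb R^d$ convex, $\mathrm{ri}(B)$ is the relative interior of $B$ (interior in its affine hull), and $h:B\to\mathbb R$ is weakly concave if there is $c\ge1$ such that for all $\alpha,\beta\in B$ there are $\gamma_1,\gamma_2\in[c^{-1},c]$ (depending on $\alpha,\beta$) such that for all $\lambda\in[0,1]$, $\lambda h(\alpha)+(1-\lambda)h(\beta)\le h\left(\frac{\lambda\gamma_1\alpha+(1-\lambda)\gamma_2\beta}{\lambda\gamma_1+(1-\lambda)\gamma_2}\right)$.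 $[u,v]=\{tu+(1-t)v:0\le t\le1\}$. "Continuous on $S$" means that the restriction of $\Lambda$ to $S$ is continuous. *)

theory Defs
  imports "HOL-Probability.Probability"
begin

section \<open>Subshifts of finite type\<close>

text \<open>
  The alphabet is \<open>{1..m}\<close> and a matrix is a function of two indices that only matters on
  \<open>{1..m} \<times> {1..m}\<close>. A one-sided sequence $x_1 x_2 \ldots$ is a function on \<open>nat\<close> whose
  value at \<open>i\<close> is $x_{i+1}$. The topology of \<open>nat \<Rightarrow> nat\<close> is the product of discrete topologies,
  so the type-class notions of continuity and of the Borel sigma-algebra are the intended ones.
\<close>

primrec matrix_power :: "nat \<Rightarrow> (nat \<Rightarrow> nat \<Rightarrow> nat) \<Rightarrow> nat \<Rightarrow> nat \<Rightarrow> nat \<Rightarrow> nat" where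
  "matrix_power m A 0 = (\<lambda>i j. if i = j then 1 else 0)"
| "matrix_power m A (Suc p) = (\<lambda>i j. \<Sum>k = 1..m. matrix_power m A p i k * A k j)"

definition primitive_01_matrix :: "nat \<Rightarrow> (nat \<Rightarrow> nat \<Rightarrow> nat) \<Rightarrow> bool" where
  "primitive_01_matrix m A \<longleftrightarrow>
     m \<ge> 1 \<and>
     (\<forall>i\<in>{1..m}. \<forall>j\<in>{1..m}. A i j \<in> {0, 1}) \<and>
     (\<exists>p\<^sub>0\<ge>1. \<forall>i\<in>{1..m}. \<forall>j\<in>{1..m}. matrix_power m A p\<^sub>0 i j > 0)"

definition subshift :: "nat \<Rightarrow> (nat \<Rightarrow> nat \<Rightarrow> nat) \<Rightarrow> (nat \<Rightarrow> nat) set" where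
  "subshift m A = {x. (\<forall>i. x i \<in> {1..m}) \<and> (\<forall>i. A (x i) (x (Suc i)) = 1)}"

definition shift :: "(nat \<Rightarrow> nat) \<Rightarrow> nat \<Rightarrow> nat" where
  "shift x = (\<lambda>i. x (Suc i))"

definition invariant_measures ::
    "nat \<Rightarrow> (nat \<Rightarrow> nat \<Rightarrow> nat) \<Rightarrow> (nat \<Rightarrow> nat) measure set" where
  "invariant_measures m A =
     {\<mu>. prob_space \<mu> \<and> sets \<mu> = sets (restrict_space borel (subshift m A)) \<and>
         (\<forall>B\<in>sets \<mu>. emeasure \<mu> (shift -` B \<inter> space \<mu>) = emeasure \<mu> B)}"

definition admissible_words :: "nat \<Rightarrow> (nat \<Rightarrow> nat \<Rightarrow> nat) \<Rightarrow> nat list set" where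
  "admissible_words m A =
     {w. set w \<subseteq> {1..m} \<and> (\<forall>i. Suc i < length w \<longrightarrow> A (w ! i) (w ! Suc i) = 1)}"

definition cylinder :: "nat \<Rightarrow> (nat \<Rightarrow> nat \<Rightarrow> nat) \<Rightarrow> nat list \<Rightarrow> (nat \<Rightarrow> nat) set" where
  "cylinder m A w = {x \<in> subshift m A. map x [0..<length w] = w}"


section \<open>Almost additive potentials\<close>

text \<open>
  A potential is a sequence indexed by \<open>n \<ge> 1\<close>; its entry at index 0 and all values off the
  subshift are irrelevant. The constant is carried along explicitly, because the negativity
  condition refers to it.
\<close>

definition almost_additive ::
    "nat \<Rightarrow> (nat \<Rightarrow> nat \<Rightarrow> nat) \<Rightarrow> (nat \<Rightarrow> (nat \<Rightarrow> nat) \<Rightarrow> real) \<Rightarrow> real \<Rightarrow> bool" where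
  "almost_additive m A \<phi> C \<longleftrightarrow>
     (\<forall>n\<ge>1. continuous_on (subshift m A) (\<phi> n)) \<and>
     (\<forall>n\<ge>1. \<forall>p\<ge>1. \<forall>x\<in>subshift m A.
        - C + \<phi> n x + \<phi> p ((shift ^^ n) x) \<le> \<phi> (n + p) x \<and>
        \<phi> (n + p) x \<le> C + \<phi> n x + \<phi> p ((shift ^^ n) x))"

text \<open>The supremum is a maximum, the subshift being compact and nonempty.\<close>

definition negative_almost_additive ::
    "nat \<Rightarrow> (nat \<Rightarrow> nat \<Rightarrow> nat) \<Rightarrow> (nat \<Rightarrow> (nat \<Rightarrow> nat) \<Rightarrow> real) \<Rightarrow> real \<Rightarrow> bool" where
  "negative_almost_additive m A \<psi> C \<longleftrightarrow>
     almost_additive m A \<psi> C \<and> (SUP x\<in>subshift m A. \<psi> 1 x) + C < 0"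

definition vector_almost_additive ::
    "nat \<Rightarrow> (nat \<Rightarrow> nat \<Rightarrow> nat) \<Rightarrow> (nat \<Rightarrow> (nat \<Rightarrow> nat) \<Rightarrow> real ^ 'd) \<Rightarrow> bool" where
  "vector_almost_additive m A \<Phi> \<longleftrightarrow> (\<forall>i. \<exists>C. almost_additive m A (\<lambda>n x. \<Phi> n x $ i) C)"

definition limit_average ::
    "(nat \<Rightarrow> (nat \<Rightarrow> nat) \<Rightarrow> real ^ 'd) \<Rightarrow> (nat \<Rightarrow> nat) measure \<Rightarrow> real ^ 'd" where
  "limit_average \<Phi> \<mu> = lim (\<lambda>n. \<integral>x. \<Phi> n x /\<^sub>R real n \<partial>\<mu>)"

definition average_set ::
    "nat \<Rightarrow> (nat \<Rightarrow> nat \<Rightarrow> nat) \<Rightarrow> (nat \<Rightarrow> (nat \<Rightarrow> nat) \<Rightarrow> real ^ 'd) \<Rightarrow> (real ^ 'd) set" where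
  "average_set m A \<Phi> = limit_average \<Phi> ` invariant_measures m A"


section \<open>The counting function and its growth rate\<close>

definition word_weight ::
    "nat \<Rightarrow> (nat \<Rightarrow> nat \<Rightarrow> nat) \<Rightarrow> (nat \<Rightarrow> (nat \<Rightarrow> nat) \<Rightarrow> real) \<Rightarrow> nat list \<Rightarrow> real" where
  "word_weight m A \<psi> w =
     (if w = [] then 1 else (SUP x\<in>cylinder m A w. exp (\<psi> (length w) x)))"

definition ball_words ::
    "nat \<Rightarrow> (nat \<Rightarrow> nat \<Rightarrow> nat) \<Rightarrow> (nat \<Rightarrow> (nat \<Rightarrow> nat) \<Rightarrow> real) \<Rightarrow> nat \<Rightarrow> nat list set" where
  "ball_words m A \<psi> n =
     {w \<in> admissible_words m A. word_weight m A \<psi> w \<le> exp (- real n) \<and>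
        (w = [] \<or> word_weight m A \<psi> (butlast w) > exp (- real n))}"

definition ball_count ::
    "nat \<Rightarrow> (nat \<Rightarrow> nat \<Rightarrow> nat) \<Rightarrow> (nat \<Rightarrow> (nat \<Rightarrow> nat) \<Rightarrow> real) \<Rightarrow>
     (nat \<Rightarrow> (nat \<Rightarrow> nat) \<Rightarrow> real ^ 'd) \<Rightarrow> real ^ 'd \<Rightarrow> nat \<Rightarrow> real \<Rightarrow> nat" where
  "ball_count m A \<psi> \<Phi> \<alpha> n \<epsilon> =
     card {u \<in> ball_words m A \<psi> n.
             \<exists>x\<in>cylinder m A u. norm (\<Phi> (length u) x /\<^sub>R real (length u) - \<alpha>) < \<epsilon>}"

text \<open>The logarithm is extended-real valued so that an empty count has logarithm \<open>- \<infinity>\<close>.\<close>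

definition log_count :: "nat \<Rightarrow> ereal" where
  "log_count k = (if k = 0 then - \<infinity> else ereal (ln (real k)))"

definition growth_rate ::
    "nat \<Rightarrow> (nat \<Rightarrow> nat \<Rightarrow> nat) \<Rightarrow> (nat \<Rightarrow> (nat \<Rightarrow> nat) \<Rightarrow> real) \<Rightarrow>
     (nat \<Rightarrow> (nat \<Rightarrow> nat) \<Rightarrow> real ^ 'd) \<Rightarrow> real ^ 'd \<Rightarrow> real \<Rightarrow> nat \<Rightarrow> ereal" where
  "growth_rate m A \<psi> \<Phi> \<alpha> \<epsilon> n = log_count (ball_count m A \<psi> \<Phi> \<alpha> n \<epsilon>) / ereal (real n)"

text \<open>
  The lower growth rate is used as the defining formula; that both limits exist, are finite and
  coincide is part of the theorem.
\<close>

definition Lambda ::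
    "nat \<Rightarrow> (nat \<Rightarrow> nat \<Rightarrow> nat) \<Rightarrow> (nat \<Rightarrow> (nat \<Rightarrow> nat) \<Rightarrow> real) \<Rightarrow>
     (nat \<Rightarrow> (nat \<Rightarrow> nat) \<Rightarrow> real ^ 'd) \<Rightarrow> real ^ 'd \<Rightarrow> real" where
  "Lambda m A \<psi> \<Phi> \<alpha> =
     real_of_ereal (Lim (at_right 0) (\<lambda>\<epsilon>. liminf (growth_rate m A \<psi> \<Phi> \<alpha> \<epsilon>)))"


section \<open>Weak concavity\<close>

definition weakly_concave_on :: "'a::real_vector set \<Rightarrow> ('a \<Rightarrow> real) \<Rightarrow> bool" where
  "weakly_concave_on B h \<longleftrightarrow> convex B \<and>
     (\<exists>c\<ge>1. \<forall>\<alpha>\<in>B. \<forall>\<beta>\<in>B. \<exists>\<gamma>\<^sub>1\<in>{inverse c..c}. \<exists>\<gamma>\<^sub>2\<in>{inverse c..c}. \<forall>t\<in>{0..1}.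
        t * h \<alpha> + (1 - t) * h \<beta>
          \<le> h (((t * \<gamma>\<^sub>1) *\<^sub>R \<alpha> + ((1 - t) * \<gamma>\<^sub>2) *\<^sub>R \<beta>) /\<^sub>R (t * \<gamma>\<^sub>1 + (1 - t) * \<gamma>\<^sub>2)))"

end

theory Submission
  imports Defs
begin

text \<open>
  Cut an admissible sequence into blocks. Primitivity allows arbitrary blocks to be glued
  together with gaps of bounded length, and almost additivity makes length, cost \<open>- \<psi>\<close> and
  potential \<open>\<Phi>\<close> of the result the sums of the contributions of the blocks, up to errors that
  are negligible for long blocks. The number of blocks is multiplicative. Hence the asymptotic
  data that a family of blocks can realize, namely (length, cost, potential, logarithm of the
  number of blocks) up to a common scale, form a closed convex cone. These are the \<open>profiles\<close>
  below; \<open>profiles_add\<close>, \<open>profiles_scale\<close> and \<open>closed_profiles\<close> express the cone property. The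
  potentials are not assumed to have bounded distortion; continuity and almost additivity imply
  that the oscillation on cylinders is sublinear (\<open>sublinear_variation\<close>), which is enough.

  The counting function translates into profiles in both directions. If the upper growth rate
  at \<open>\<alpha>\<close> is at least \<open>h\<close>, then for some ratio \<open>\<rho>\<close> of length to cost, bounded away from zero and
  infinity, \<open>(\<rho>, 1, \<rho> \<alpha>, h)\<close> is a profile (\<open>profile_of_limsup\<close>). Conversely such a profile
  bounds the lower growth rate at \<open>\<alpha>\<close> from below by \<open>h\<close> (\<open>liminf_of_profile\<close>). So the lower and the
  upper rate agree. A convex combination of the profiles at two points is a profile at the point
  weighted by the two ratios, and this is weak concavity (\<open>weakly_concave_Lambda\<close>).
  Nonnegativity follows from the profiles with a single block: the averages of an invariant
  measure lie in the closed convex hull of averages along orbit pieces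
  (\<open>integral_averages_in_profiles\<close>).

  The continuity statements are general facts about bounded, upper semicontinuous, weakly concave
  functions. Weak concavity gives \<open>h ((1 - s) \<alpha> + s \<beta>) \<ge> h \<alpha> - M s\<close> with \<open>M\<close> independent of
  \<open>\<alpha>\<close>, \<open>\<beta>\<close> and \<open>s\<close>. This is lower semicontinuity wherever nearby points lie on segments of a fixed
  length starting at \<open>\<alpha>\<close>, as they do in polyhedra and in relative interiors
  (\<open>continuous_on_extendable\<close>). Upper semicontinuity is immediate from the definition by balls.
  Monotonicity along segments from a maximum is quasiconcavity.
\<close>

section \<open>The space of admissible sequences\<close>

definition agree :: "nat \<Rightarrow> (nat \<Rightarrow> nat) \<Rightarrow> (nat \<Rightarrow> nat) \<Rightarrow> bool" where
  "agree n x y \<longleftrightarrow> (\<forall>i<n. x i = y i)"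

lemma agree_refl: "agree n x x"
  by (simp add: agree_def)

lemma agree_mono: "agree n x y \<Longrightarrow> k \<le> n \<Longrightarrow> agree k x y"
  by (auto simp: agree_def)

lemma agree_iff_prefix: "agree n x y \<longleftrightarrow> map x [0..<n] = map y [0..<n]"
  by (auto simp: agree_def list_eq_iff_nth_eq)

lemma shift_funpow: "(shift ^^ n) x = (\<lambda>i. x (n + i))"
  by (induction n) (auto simp: shift_def)

lemma agree_shift: "agree (n + k) x y \<Longrightarrow> agree k ((shift ^^ n) x) ((shift ^^ n) y)"
  by (auto simp: agree_def shift_funpow)

lemma shift_in_subshift: "x \<in> subshift m A \<Longrightarrow> (shift ^^ n) x \<in> subshift m A"
  by (auto simp: subshift_def shift_funpow)

lemma compact_subshift: "compact (subshift m A)"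
proof -
  have "compactin (product_topology (\<lambda>i::nat. euclidean) UNIV) (PiE UNIV (\<lambda>i. {1..m}))"
    unfolding compactin_PiE by (auto intro: finite_imp_compact)
  then have c: "compact (PiE UNIV (\<lambda>i::nat. {1..m}))"
    by (simp add: euclidean_product_topology)
  have "closed {x :: nat \<Rightarrow> nat. A (x i) (x (Suc i)) = 1}" for i
  proof -
    have "- {x :: nat \<Rightarrow> nat. A (x i) (x (Suc i)) = 1} =
        (\<Union>j. ((\<lambda>x. x i) -` {j}) \<inter> ((\<lambda>x. x (Suc i)) -` {k. A j k \<noteq> 1}))"
      by auto
    moreover have "open (((\<lambda>x :: nat \<Rightarrow> nat. x i) -` {j}) \<inter> ((\<lambda>x. x (Suc i)) -` {k. A j k \<noteq> 1}))" for j
      by (intro open_Int open_vimage continuous_on_product_coordinates discrete_topology_class.open_discrete)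
    ultimately show ?thesis
      unfolding closed_def by (simp add: open_UN)
  qed
  then have "closed (\<Inter>i. {x :: nat \<Rightarrow> nat. A (x i) (x (Suc i)) = 1})"
    by (intro closed_INT) auto
  with c have "compact (PiE UNIV (\<lambda>i::nat. {1..m}) \<inter> (\<Inter>i. {x. A (x i) (x (Suc i)) = 1}))"
    by (rule compact_Int_closed)
  moreover have "subshift m A = PiE UNIV (\<lambda>i::nat. {1..m}) \<inter> (\<Inter>i. {x. A (x i) (x (Suc i)) = 1})"
    by (auto simp: subshift_def)
  ultimately show ?thesis by simp
qed

text \<open>
  On a compact subset of a product of discrete spaces, continuity means that the value is almost
  determined by a prefix of bounded length.
\<close>

lemma continuous_on_subshift_local:
  fixes f :: "(nat \<Rightarrow> nat) \<Rightarrow> 'b::metric_space"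
  assumes "continuous_on (subshift m A) f" "0 < e"
  obtains N where "\<And>x y. x \<in> subshift m A \<Longrightarrow> y \<in> subshift m A \<Longrightarrow> agree N x y \<Longrightarrow> dist (f x) (f y) < e"
proof -
  let ?X = "subshift m A"
  have "\<exists>N. \<forall>y\<in>?X. agree N x y \<longrightarrow> dist (f y) (f x) < e / 2" if x: "x \<in> ?X" for x
  proof -
    obtain U where U: "open U" "U \<inter> ?X = f -` ball (f x) (e / 2) \<inter> ?X"
      using assms(1) open_ball[of "f x" "e/2"] unfolding continuous_on_open_invariant by blast
    have "x \<in> U" using U(2) x assms(2) by auto
    then obtain Y where Y: "x \<in> PiE UNIV Y" "finite {i. Y i \<noteq> UNIV}" "PiE UNIV Y \<subseteq> U"
      using product_topology_open_contains_basis[of "\<lambda>_. euclidean" UNIV U x] U(1)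
      unfolding open_fun_def topspace_euclidean by blast
    obtain N where N: "\<And>i. Y i \<noteq> UNIV \<Longrightarrow> i < N"
      using Y(2) unfolding finite_nat_set_iff_bounded by auto
    have "dist (f y) (f x) < e / 2" if y: "y \<in> ?X" "agree N x y" for y
    proof -
      have "y i \<in> Y i" for i
        using N[of i] y(2) Y(1) unfolding agree_def PiE_iff by (metis UNIV_I)
      then have "y \<in> U" using Y(3) by (auto simp: PiE_iff)
      then show ?thesis using U(2) y(1) by (auto simp: dist_commute)
    qed
    then show ?thesis by blast
  qed
  then obtain n where n: "\<And>x y. x \<in> ?X \<Longrightarrow> y \<in> ?X \<Longrightarrow> agree (n x) x y \<Longrightarrow> dist (f y) (f x) < e / 2"
    by metis
  have op: "open {y. agree k x y}" for k x
  proof -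
    have "{y. agree k x y} = (\<Inter>i<k. (\<lambda>y. y i) -` {x i})"
      by (auto simp: agree_def)
    then show ?thesis
      by (auto intro!: open_INT open_vimage continuous_on_product_coordinates
          discrete_topology_class.open_discrete)
  qed
  obtain F where F: "F \<subseteq> ?X" "finite F" "?X \<subseteq> (\<Union>x\<in>F. {y. agree (n x) x y})"
    using compactE_image[OF compact_subshift, of ?X "\<lambda>x. {y. agree (n x) x y}" m A] op
    by (auto simp: agree_def)
  show ?thesis
  proof (rule that)
    fix x y assume xy: "x \<in> ?X" "y \<in> ?X" "agree (Max (n ` F)) x y"
    obtain z where z: "z \<in> F" "agree (n z) z x" using F(3) xy(1) by auto
    have "n z \<le> Max (n ` F)" using z(1) F(2) by auto
    then have "agree (n z) z y" using z(2) xy(3) by (auto simp: agree_def)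
    then have "dist (f y) (f z) < e / 2" "dist (f x) (f z) < e / 2"
      using n z F(1) xy by auto
    then show "dist (f x) (f y) < e" by (metis dist_triangle_half_l dist_commute)
  qed
qed

lemma continuous_on_subshift_bounded:
  fixes f :: "(nat \<Rightarrow> nat) \<Rightarrow> 'b::real_normed_vector"
  assumes "continuous_on (subshift m A) f"
  obtains B where "0 \<le> B" "\<And>x. x \<in> subshift m A \<Longrightarrow> norm (f x) \<le> B"
proof -
  have "bounded (f ` subshift m A)"
    by (intro compact_imp_bounded compact_continuous_image assms compact_subshift)
  then obtain B where "\<forall>x\<in>subshift m A. norm (f x) \<le> B"
    by (auto simp: bounded_iff)
  then show ?thesis
    by (intro that[of "max B 0"]) auto
qed

lemma path_of_matrix_power_pos:
  assumes "matrix_power m A p i j > 0" "\<forall>i\<in>{1..m}. \<forall>j\<in>{1..m}. A i j \<in> {0, 1}"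
    and "i \<in> {1..m}" "j \<in> {1..m}"
  shows "\<exists>c. c 0 = i \<and> c p = j \<and> (\<forall>q\<le>p. c q \<in> {1..m}) \<and> (\<forall>q<p. A (c q) (c (Suc q)) = 1)"
  using assms(1,4)
proof (induction p arbitrary: j)
  case 0
  then show ?case using assms(3) by (intro exI[of _ "\<lambda>_. i"]) (auto split: if_splits)
next
  case (Suc p)
  have "matrix_power m A (Suc p) i j \<noteq> 0"
    using Suc.prems(1) by (rule gr_implies_not0)
  then have "(\<Sum>k = 1..m. matrix_power m A p i k * A k j) \<noteq> 0"
    unfolding matrix_power.simps .
  then obtain k where "k \<in> {1..m}" "matrix_power m A p i k * A k j \<noteq> 0"
    by (rule sum.not_neutral_contains_not_neutral)
  then have k: "k \<in> {1..m}" "matrix_power m A p i k > 0" "A k j > 0"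
    by auto
  then obtain c where c: "c 0 = i" "c p = k" "\<forall>q\<le>p. c q \<in> {1..m}" "\<forall>q<p. A (c q) (c (Suc q)) = 1"
    using Suc.IH[OF k(2,1)] by auto
  have "A k j = 1"
    using k(1,3) assms(2) Suc.prems(2) by fastforce
  then show ?case
    using c Suc.prems(2)
    by (intro exI[of _ "c(Suc p := j)"]) (auto simp: less_Suc_eq le_Suc_eq)
qed

text \<open>
  Specification: primitivity of the matrix lets any finite prefix be continued by any admissible
  sequence after a gap whose length does not depend on the two pieces.
\<close>

lemma primitive_gluing:
  assumes "primitive_01_matrix m A"
  obtains g where
    "\<And>l x y. x \<in> subshift m A \<Longrightarrow> y \<in> subshift m A \<Longrightarrow>
       \<exists>z\<in>subshift m A. agree l z x \<and> (shift ^^ (l + g)) z = y"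
proof -
  obtain g where g: "g \<ge> 1" "\<And>i j. i \<in> {1..m} \<Longrightarrow> j \<in> {1..m} \<Longrightarrow> matrix_power m A g i j > 0"
    and A: "\<forall>i\<in>{1..m}. \<forall>j\<in>{1..m}. A i j \<in> {0, 1}"
    using assms unfolding primitive_01_matrix_def by blast
  show ?thesis
  proof (rule that)
    fix l x y assume x: "x \<in> subshift m A" and y: "y \<in> subshift m A"
    have xy: "x l \<in> {1..m}" "y 0 \<in> {1..m}"
      using x y unfolding subshift_def by auto
    obtain c where c: "c 0 = x l" "c g = y 0" "\<forall>q\<le>g. c q \<in> {1..m}"
      "\<forall>q<g. A (c q) (c (Suc q)) = 1"
      using path_of_matrix_power_pos[OF g(2)[OF xy] A xy] by auto
    define z where "z i = (if i < l then x i else if i \<le> l + g then c (i - l) else y (i - (l + g)))" for i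
    have "z \<in> subshift m A"
      unfolding subshift_def
    proof (intro CollectI conjI allI)
      fix i
      show "z i \<in> {1..m}"
        using x y c(3) unfolding z_def subshift_def by auto
      consider "Suc i < l" | "Suc i = l" | "l \<le> i" "i < l + g" | "l + g \<le> i" by linarith
      then show "A (z i) (z (Suc i)) = 1"
      proof cases
        case 1 then show ?thesis using x unfolding z_def subshift_def by auto
      next
        case 2
        then have "z (Suc i) = x (Suc i)" "z i = x i" using c(1) unfolding z_def by auto
        then show ?thesis using x unfolding subshift_def by auto
      next
        case 3
        then have "z i = c (i - l)" "z (Suc i) = c (Suc (i - l))"
          unfolding z_def by (auto simp: Suc_diff_le)
        then show ?thesis using c(4) 3 by auto
      next
        case 4
        then have "z i = y (i - (l + g))" "z (Suc i) = y (Suc (i - (l + g)))"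
          using c(2) unfolding z_def by (auto simp: Suc_diff_le le_antisym)
        then show ?thesis using y unfolding subshift_def by auto
      qed
    qed
    moreover have "agree l z x" unfolding agree_def z_def by auto
    moreover have "(shift ^^ (l + g)) z = y"
      using c(2) g(1) unfolding shift_funpow z_def by auto
    ultimately show "\<exists>z\<in>subshift m A. agree l z x \<and> (shift ^^ (l + g)) z = y" by blast
  qed
qed

section \<open>Vector-valued almost additive potentials\<close>

locale almost_additive_vector =
  fixes m :: nat and A :: "nat \<Rightarrow> nat \<Rightarrow> nat"
    and \<Theta> :: "nat \<Rightarrow> (nat \<Rightarrow> nat) \<Rightarrow> 'e::euclidean_space" and D :: real
  assumes primitive: "primitive_01_matrix m A"
    and D_nonneg: "0 \<le> D"
    and continuous: "continuous_on (subshift m A) (\<Theta> n)"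
    and zero: "\<Theta> 0 x = 0"
    and almost_additive:
      "x \<in> subshift m A \<Longrightarrow> norm (\<Theta> (n + p) x - (\<Theta> n x + \<Theta> p ((shift ^^ n) x))) \<le> D"
    and length_le_norm: "x \<in> subshift m A \<Longrightarrow> real n \<le> norm (\<Theta> n x)"
begin

abbreviation X :: "(nat \<Rightarrow> nat) set" where "X \<equiv> subshift m A"

lemma linear_bound_exists: "\<exists>B\<ge>0. \<forall>n. \<forall>x\<in>X. norm (\<Theta> n x) \<le> B * real n"
proof -
  obtain b where b: "0 \<le> b" "\<And>x. x \<in> X \<Longrightarrow> norm (\<Theta> 1 x) \<le> b"
    using continuous_on_subshift_bounded[OF continuous] by blast
  have "norm (\<Theta> n x) \<le> (b + D) * real n" if x: "x \<in> X" for n x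
  proof (induction n)
    case 0 then show ?case by (simp add: zero)
  next
    case (Suc n)
    have "norm (\<Theta> (n + 1) x) \<le> norm (\<Theta> (n + 1) x - (\<Theta> n x + \<Theta> 1 ((shift ^^ n) x)))
        + norm (\<Theta> n x) + norm (\<Theta> 1 ((shift ^^ n) x))"
      by norm
    also have "\<dots> \<le> D + (b + D) * real n + b"
      using almost_additive[OF x, of n 1] Suc b(2)[OF shift_in_subshift[OF x]]
      by (intro add_mono) auto
    finally show ?case by (simp add: algebra_simps)
  qed
  then show ?thesis using b(1) D_nonneg by (intro exI[of _ "b + D"]) auto
qed

text \<open>
  The next constants depend on the potential alone; choosing them once lets the gluing lemmas be
  stated with explicit errors.
\<close>

definition bound :: real where
  "bound = (SOME B. 0 \<le> B \<and> (\<forall>n. \<forall>x\<in>X. norm (\<Theta> n x) \<le> B * real n))"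

lemma bound_nonneg: "0 \<le> bound"
  and linear_bound: "x \<in> X \<Longrightarrow> norm (\<Theta> n x) \<le> bound * real n"
  using someI_ex[OF linear_bound_exists] unfolding bound_def by auto

definition gap :: nat where
  "gap = (SOME g. \<forall>l. \<forall>x\<in>X. \<forall>y\<in>X. \<exists>z\<in>X. agree l z x \<and> (shift ^^ (l + g)) z = y)"

definition glue :: "nat \<Rightarrow> (nat \<Rightarrow> nat) \<Rightarrow> (nat \<Rightarrow> nat) \<Rightarrow> (nat \<Rightarrow> nat)" where
  "glue l x y = (SOME z. z \<in> X \<and> agree l z x \<and> (shift ^^ (l + gap)) z = y)"

lemma glue:
  assumes "x \<in> X" "y \<in> X"
  shows "glue l x y \<in> X" "agree l (glue l x y) x" "(shift ^^ (l + gap)) (glue l x y) = y"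
proof -
  have "\<exists>g. \<forall>l. \<forall>x\<in>X. \<forall>y\<in>X. \<exists>z\<in>X. agree l z x \<and> (shift ^^ (l + g)) z = y"
    using primitive_gluing[OF primitive] by metis
  then have "\<forall>l. \<forall>x\<in>X. \<forall>y\<in>X. \<exists>z\<in>X. agree l z x \<and> (shift ^^ (l + gap)) z = y"
    unfolding gap_def by (rule someI_ex)
  then have "\<exists>z. z \<in> X \<and> agree l z x \<and> (shift ^^ (l + gap)) z = y"
    using assms by blast
  then have "glue l x y \<in> X \<and> agree l (glue l x y) x \<and> (shift ^^ (l + gap)) (glue l x y) = y"
    unfolding glue_def by (rule someI_ex)
  then show "glue l x y \<in> X" "agree l (glue l x y) x" "(shift ^^ (l + gap)) (glue l x y) = y"
    by auto
qed

text \<open>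
  The cost of one gap: additivity is used at its two ends, and the gap itself contributes the
  value of the potential on \<open>gap\<close> letters.
\<close>

definition gap_error :: real where
  "gap_error = 2 * D + bound * real gap"

lemma gap_error_nonneg: "0 \<le> gap_error"
  unfolding gap_error_def using bound_nonneg D_nonneg by simp

text \<open>An oscillation bound on cylinders whose length is the index of the potential.\<close>

definition variation_le :: "nat \<Rightarrow> real \<Rightarrow> bool" where
  "variation_le l v \<longleftrightarrow> (\<forall>x\<in>X. \<forall>y\<in>X. agree l x y \<longrightarrow> norm (\<Theta> l x - \<Theta> l y) \<le> v)"

text \<open>
  Splitting off blocks of a fixed length \<open>k\<close> costs a bounded error per block, and a continuous
  function oscillates little on long cylinders. Hence the oscillation of \<open>\<Theta> n\<close> on cylinders of
  length \<open>n\<close> grows by a constant for each block, that is, at most by \<open>const / k\<close> per letter.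
\<close>

lemma sublinear_variation:
  assumes "0 < e"
  obtains M where "0 \<le> M"
    "\<And>n. variation_le n (M + e * real n)"
proof -
  obtain k :: nat where k: "(2 * D + 1) / e < real k" using reals_Archimedean2 by blast
  then have ke: "2 * D + 1 \<le> e * real k" using assms by (simp add: field_simps)
  then have k0: "k > 0" using D_nonneg by (cases k) auto
  obtain N where N: "\<And>x y. x \<in> X \<Longrightarrow> y \<in> X \<Longrightarrow> agree N x y \<Longrightarrow> dist (\<Theta> k x) (\<Theta> k y) < 1"
    using continuous_on_subshift_local[OF continuous zero_less_one] by blast
  define M where "M = 2 * bound * real (N + k)"
  have M0: "0 \<le> M" unfolding M_def using bound_nonneg by simp
  have "norm (\<Theta> n x - \<Theta> n y) \<le> M + e * real n" if "x \<in> X" "y \<in> X" "agree n x y" for n x y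
    using that
  proof (induction n arbitrary: x y rule: less_induct)
    case (less n)
    show ?case
    proof (cases "n < N + k")
      case True
      have "norm (\<Theta> n x - \<Theta> n y) \<le> norm (\<Theta> n x) + norm (\<Theta> n y)"
        by norm
      also have "\<dots> \<le> bound * real n + bound * real n"
        using linear_bound less.prems by (intro add_mono) auto
      also have "\<dots> = 2 * bound * real n" by simp
      also have "\<dots> \<le> M" unfolding M_def using True bound_nonneg by (intro mult_left_mono) auto
      finally show ?thesis using assms by (smt (verit) mult_nonneg_nonneg of_nat_0_le_iff)
    next
      case False
      define r where "r = n - k"
      have n: "n = k + r" and r: "N \<le> r" "r < n" using False k0 unfolding r_def by auto
      let ?x = "(shift ^^ k) x" and ?y = "(shift ^^ k) y"
      have "norm (\<Theta> r ?x - \<Theta> r ?y) \<le> M + e * real r"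
        using less.IH[OF r(2) shift_in_subshift[OF less.prems(1)] shift_in_subshift[OF less.prems(2)]]
          agree_shift less.prems(3) n by metis
      moreover have "norm (\<Theta> k x - \<Theta> k y) < 1"
        using N[OF less.prems(1,2)] agree_mono[OF less.prems(3)] r by (auto simp: dist_norm)
      moreover have "norm (\<Theta> n x - \<Theta> n y) \<le> norm (\<Theta> n x - (\<Theta> k x + \<Theta> r ?x))
          + norm (\<Theta> n y - (\<Theta> k y + \<Theta> r ?y)) + norm (\<Theta> k x - \<Theta> k y) + norm (\<Theta> r ?x - \<Theta> r ?y)"
        by norm
      ultimately have "norm (\<Theta> n x - \<Theta> n y) \<le> D + D + 1 + (M + e * real r)"
        using almost_additive[OF less.prems(1), of k r] almost_additive[OF less.prems(2), of k r]
        unfolding n by linarith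
      then show ?thesis using ke unfolding n by (simp add: algebra_simps)
    qed
  qed
  then show ?thesis using that M0 unfolding variation_le_def by blast
qed

section \<open>Families of blocks\<close>

text \<open>
  A block of length \<open>l\<close> is represented by a sequence that starts with it, so that the potential can
  be evaluated. Since members that agree on \<open>l\<close> letters are equal, the cardinality counts blocks.
\<close>

definition block_family :: "'e \<Rightarrow> real \<Rightarrow> real \<Rightarrow> nat \<Rightarrow> (nat \<Rightarrow> nat) set \<Rightarrow> bool" where
  "block_family \<theta> e h l P \<longleftrightarrow> finite P \<and> P \<subseteq> X \<and> P \<noteq> {} \<and>
     (\<forall>x\<in>P. \<forall>y\<in>P. agree l x y \<longrightarrow> x = y) \<and>
     (\<forall>x\<in>P. norm (\<Theta> l x - \<theta>) \<le> e) \<and> h \<le> ln (real (card P))"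

lemma block_family_mono:
  assumes "block_family \<theta> e h l P" "norm (\<theta>' - \<theta>) + e \<le> e'" "h' \<le> h"
  shows "block_family \<theta>' e' h' l P"
proof -
  have "norm (\<Theta> l x - \<theta>') \<le> e'" if "norm (\<Theta> l x - \<theta>) \<le> e" for x
    using that assms(2) by norm
  then show ?thesis using assms(1,3) unfolding block_family_def by force
qed

text \<open>
  Gluing every sequence of one family to every sequence of another multiplies the cardinalities.
  Only the first component is distorted, because the second one reappears exactly as a shift.
\<close>

lemma block_family_concat:
  assumes P: "block_family \<theta> e h l P" and P': "block_family \<theta>' e' h' l' P'" and v: "variation_le l v"
  shows "\<exists>Q. block_family (\<theta> + \<theta>') (e + e' + v + gap_error) (h + h') (l + gap + l') Q"
proof -
  let ?L = "l + gap + l'"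
  define f where "f = (\<lambda>(x, y). glue l x y)"
  have eq: "x = x' \<and> y = y'"
    if "x \<in> P" "y \<in> P'" "x' \<in> P" "y' \<in> P'" "agree ?L (glue l x y) (glue l x' y')" for x y x' y'
  proof -
    have X: "x \<in> X" "y \<in> X" "x' \<in> X" "y' \<in> X" using that P P' unfolding block_family_def by auto
    have "agree l (glue l x y) (glue l x' y')"
      using that(5) by (rule agree_mono) simp
    then have "agree l x x'"
      using glue(2)[OF X(1,2), of l] glue(2)[OF X(3,4), of l] unfolding agree_def by auto
    moreover have "agree l' y y'"
      using agree_shift[OF that(5)] glue(3)[OF X(1,2)] glue(3)[OF X(3,4)] by simp
    ultimately show ?thesis using that P P' unfolding block_family_def by blast
  qed
  then have inj: "inj_on f (P \<times> P')"
    unfolding inj_on_def f_def by (auto simp: agree_def)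
  have "norm (\<Theta> ?L (glue l x y) - (\<theta> + \<theta>')) \<le> e + e' + v + gap_error" if "x \<in> P" "y \<in> P'" for x y
  proof -
    have X: "x \<in> X" "y \<in> X" using that P P' unfolding block_family_def by auto
    let ?z = "glue l x y"
    have z: "?z \<in> X" using glue(1) X by blast
    have 1: "norm (\<Theta> ?L ?z - (\<Theta> (l + gap) ?z + \<Theta> l' y)) \<le> D"
      using almost_additive[OF z, of "l + gap" l'] glue(3)[OF X] by simp
    have 2: "norm (\<Theta> (l + gap) ?z - (\<Theta> l ?z + \<Theta> gap ((shift ^^ l) ?z))) \<le> D"
      by (rule almost_additive[OF z])
    have 3: "norm (\<Theta> gap ((shift ^^ l) ?z)) \<le> bound * real gap"
      by (rule linear_bound[OF shift_in_subshift[OF z]])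
    have 4: "norm (\<Theta> l ?z - \<Theta> l x) \<le> v"
      using v z X(1) glue(2)[OF X] unfolding variation_le_def by blast
    have 5: "norm (\<Theta> l x - \<theta>) \<le> e" "norm (\<Theta> l' y - \<theta>') \<le> e'"
      using that P P' unfolding block_family_def by auto
    have "norm (\<Theta> ?L ?z - (\<theta> + \<theta>')) \<le> norm (\<Theta> ?L ?z - (\<Theta> (l + gap) ?z + \<Theta> l' y))
      + norm (\<Theta> (l + gap) ?z - (\<Theta> l ?z + \<Theta> gap ((shift ^^ l) ?z)))
      + norm (\<Theta> gap ((shift ^^ l) ?z)) + norm (\<Theta> l ?z - \<Theta> l x) + norm (\<Theta> l x - \<theta>)
      + norm (\<Theta> l' y - \<theta>')"
      by norm
    then show ?thesis using 1 2 3 4 5 unfolding gap_error_def by linarith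
  qed
  then have err: "\<forall>z\<in>f ` (P \<times> P'). norm (\<Theta> ?L z - (\<theta> + \<theta>')) \<le> e + e' + v + gap_error"
    unfolding f_def by auto
  have fin: "finite P" "finite P'" "P \<noteq> {}" "P' \<noteq> {}" "P \<subseteq> X" "P' \<subseteq> X"
    using P P' unfolding block_family_def by auto
  have "real (card (f ` (P \<times> P'))) = real (card P) * real (card P')"
    using inj by (simp add: card_image card_cartesian_product)
  moreover have "0 < card P" "0 < card P'"
    using fin by (auto simp: card_gt_0_iff)
  ultimately have "ln (real (card (f ` (P \<times> P')))) = ln (real (card P)) + ln (real (card P'))"
    by (simp add: ln_mult)
  then have "h + h' \<le> ln (real (card (f ` (P \<times> P'))))"
    using P P' unfolding block_family_def by auto
  moreover have "f ` (P \<times> P') \<subseteq> X"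
    unfolding f_def using fin(5,6) glue(1) by (auto simp: subset_iff)
  moreover have "\<forall>z\<in>f ` (P \<times> P'). \<forall>z'\<in>f ` (P \<times> P'). agree ?L z z' \<longrightarrow> z = z'"
    using eq unfolding f_def by fastforce
  ultimately have "block_family (\<theta> + \<theta>') (e + e' + v + gap_error) (h + h') ?L (f ` (P \<times> P'))"
    unfolding block_family_def using fin err by simp
  then show ?thesis by blast
qed

lemma block_family_variation_nonneg:
  assumes "block_family \<theta> e h l P" "variation_le l v"
  shows "0 \<le> e" "0 \<le> v"
proof -
  obtain x where "x \<in> P" "x \<in> X" using assms(1) unfolding block_family_def by auto
  then have "norm (\<Theta> l x - \<theta>) \<le> e" "norm (\<Theta> l x - \<Theta> l x) \<le> v"
    using assms unfolding block_family_def variation_le_def by (auto simp only: agree_refl)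
  then show "0 \<le> e" "0 \<le> v" by (auto intro: order_trans[OF norm_ge_zero])
qed

text \<open>
  Because \<open>block_family_concat\<close> distorts the left factor only, adding one more copy of \<open>P\<close> on the
  left costs the same error each time, and the errors of a \<open>k\<close>-fold concatenation grow linearly in \<open>k\<close>.
\<close>

lemma block_family_iterate:
  assumes P: "block_family \<theta> e h l P" and v: "variation_le l v"
  shows "\<exists>L Q. block_family (real (Suc k) *\<^sub>R \<theta>) (real (Suc k) * (e + v + gap_error)) (real (Suc k) * h) L Q"
proof (induction k)
  case 0
  have "block_family \<theta> (e + v + gap_error) h l P"
    using P by (rule block_family_mono)
      (use gap_error_nonneg block_family_variation_nonneg[OF assms] in auto)
  then show ?case by auto
next
  case (Suc k)
  then obtain L Q where "block_family (real (Suc k) *\<^sub>R \<theta>) (real (Suc k) * (e + v + gap_error)) (real (Suc k) * h) L Q"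
    by blast
  from block_family_concat[OF P this v] obtain R where
    R: "block_family (\<theta> + real (Suc k) *\<^sub>R \<theta>) (e + real (Suc k) * (e + v + gap_error) + v + gap_error)
         (h + real (Suc k) * h) (l + gap + L) R"
    by blast
  have "block_family (real (Suc (Suc k)) *\<^sub>R \<theta>) (real (Suc (Suc k)) * (e + v + gap_error)) (real (Suc (Suc k)) * h) (l + gap + L) R"
    using R by (rule block_family_mono) (auto simp: algebra_simps simp flip: scaleR_2)
  then show ?case by blast
qed

section \<open>Profiles\<close>

text \<open>
  \<open>(\<theta>, h)\<close> is a profile if at every large scale \<open>K\<close> at least about \<open>exp (K h)\<close> blocks have potential close
  to \<open>K \<theta>\<close>. The parameter \<open>e\<close> is a tolerance relative to \<open>K\<close>; the set of exact profiles is
  \<open>profiles 0\<close>. Requiring all large real scales, and not only arbitrarily large ones, is what allows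
  two profiles to be realized at a common scale and added, and a profile to be rescaled.
\<close>

definition profiles :: "real \<Rightarrow> ('e \<times> real) set" where
  "profiles e = {(\<theta>, h). \<forall>e'>e. \<forall>\<^sub>F K in at_top.
     \<exists>l P. block_family (K *\<^sub>R \<theta>) (e' * K) (K * (h - e')) l P}"

text \<open>
  One family is enough to realize a profile at all large scales: \<open>k\<close> copies serve the scales
  between \<open>k\<close> and \<open>k + 1\<close>, and the rounding is absorbed by the slack \<open>e' - e\<close>.
\<close>

lemma profiles_of_block_family:
  assumes P: "block_family \<theta> e h l P" and v: "variation_le l v"
  shows "(\<theta>, h) \<in> profiles (e + v + gap_error)"
proof -
  define E where "E = e + v + gap_error"
  have E: "0 \<le> E" unfolding E_def using block_family_variation_nonneg[OF assms] gap_error_nonneg by simp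
  have "\<forall>\<^sub>F K in at_top. \<exists>l P. block_family (K *\<^sub>R \<theta>) (e' * K) (K * (h - e')) l P" if e': "e' > E" for e'
  proof (rule eventually_at_top_linorderI)
    fix K assume K: "max 1 (max (\<bar>h\<bar> / e') (norm \<theta> / (e' - E))) \<le> K"
    define k where "k = nat \<lfloor>K\<rfloor> - 1"
    have "1 \<le> \<lfloor>K\<rfloor>" using K by simp
    then have "real (Suc k) = of_int \<lfloor>K\<rfloor>" unfolding k_def by simp
    then have k: "real (Suc k) \<le> K" "K \<le> real (Suc k) + 1" by linarith+
    obtain L Q where Q: "block_family (real (Suc k) *\<^sub>R \<theta>) (real (Suc k) * E) (real (Suc k) * h) L Q"
      using block_family_iterate[OF P v] unfolding E_def by blast
    have h: "\<bar>h\<bar> \<le> K * e'" and t: "norm \<theta> \<le> K * (e' - E)"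
      using K e' E by (auto simp: pos_divide_le_eq)
    have "(K - real (Suc k)) * h \<le> (K - real (Suc k)) * \<bar>h\<bar>"
      using k(1) by (intro mult_left_mono) auto
    also have "\<dots> \<le> 1 * \<bar>h\<bar>"
      using k(2) by (intro mult_right_mono) auto
    finally have "(K - real (Suc k)) * h \<le> \<bar>h\<bar>" by simp
    then have 1: "K * (h - e') \<le> real (Suc k) * h"
      using h by (simp add: algebra_simps)
    have "K *\<^sub>R \<theta> - real (Suc k) *\<^sub>R \<theta> = (K - real (Suc k)) *\<^sub>R \<theta>"
      by (simp add: algebra_simps)
    then have "norm (K *\<^sub>R \<theta> - real (Suc k) *\<^sub>R \<theta>) = (K - real (Suc k)) * norm \<theta>"
      using k(1) by simp
    also have "\<dots> \<le> 1 * norm \<theta>"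
      using k(2) by (intro mult_right_mono) auto
    finally have "norm (K *\<^sub>R \<theta> - real (Suc k) *\<^sub>R \<theta>) \<le> norm \<theta>" by simp
    moreover have "real (Suc k) * E \<le> K * E" using k(1) E by (rule mult_right_mono)
    ultimately have 2: "norm (K *\<^sub>R \<theta> - real (Suc k) *\<^sub>R \<theta>) + real (Suc k) * E \<le> e' * K"
      using t by (simp add: algebra_simps)
    show "\<exists>l P. block_family (K *\<^sub>R \<theta>) (e' * K) (K * (h - e')) l P"
      using block_family_mono[OF Q 2 1] by blast
  qed
  then show ?thesis
    unfolding profiles_def E_def by simp
qed

lemma profiles_perturb:
  assumes "(\<theta>, h) \<in> profiles e" "norm (\<theta>' - \<theta>) \<le> d" "h' \<le> h + d"
  shows "(\<theta>', h') \<in> profiles (e + d)"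
proof -
  have "\<forall>\<^sub>F K in at_top. \<exists>l P. block_family (K *\<^sub>R \<theta>') (e' * K) (K * (h' - e')) l P" if "e' > e + d" for e'
  proof -
    have "\<forall>\<^sub>F K in at_top. \<exists>l P. block_family (K *\<^sub>R \<theta>) ((e' - d) * K) (K * (h - (e' - d))) l P"
      using assms(1) that unfolding profiles_def by auto
    moreover have "\<forall>\<^sub>F K in at_top. (0::real) \<le> K" by (rule eventually_ge_at_top)
    ultimately show ?thesis
    proof eventually_elim
      case (elim K)
      then obtain l P where P: "block_family (K *\<^sub>R \<theta>) ((e' - d) * K) (K * (h - (e' - d))) l P" by blast
      have "K *\<^sub>R \<theta>' - K *\<^sub>R \<theta> = K *\<^sub>R (\<theta>' - \<theta>)" by (simp add: algebra_simps)
      then have "norm (K *\<^sub>R \<theta>' - K *\<^sub>R \<theta>) \<le> K * d"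
        using assms(2) elim(2) by (simp add: mult_left_mono)
      then have 1: "norm (K *\<^sub>R \<theta>' - K *\<^sub>R \<theta>) + (e' - d) * K \<le> e' * K"
        by (simp add: algebra_simps)
      have 2: "K * (h' - e') \<le> K * (h - (e' - d))"
        using assms(3) elim(2) by (intro mult_left_mono) auto
      show ?case using block_family_mono[OF P 1 2] by blast
    qed
  qed
  then show ?thesis unfolding profiles_def by simp
qed

lemma profiles_limit:
  assumes "\<And>d. 0 < d \<Longrightarrow> p \<in> profiles (e + d)"
  shows "p \<in> profiles e"
proof -
  have "\<forall>\<^sub>F K in at_top. \<exists>l P. block_family (K *\<^sub>R fst p) (e' * K) (K * (snd p - e')) l P" if "e < e'" for e'
  proof -
    have "e + (e' - e) / 2 < e'" using that by (simp add: field_simps)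
    then show ?thesis
      using assms[of "(e' - e) / 2"] that unfolding profiles_def case_prod_beta by fastforce
  qed
  then show ?thesis unfolding profiles_def by (simp add: case_prod_beta)
qed

lemma profiles_scale:
  assumes "(\<theta>, h) \<in> profiles e" "0 < c"
  shows "(c *\<^sub>R \<theta>, c * h) \<in> profiles (c * e)"
proof -
  have "\<forall>\<^sub>F K in at_top. \<exists>l P. block_family (K *\<^sub>R c *\<^sub>R \<theta>) (e' * K) (K * (c * h - e')) l P"
    if "e' > c * e" for e'
  proof -
    have "e < e' / c" using that assms(2) by (simp add: field_simps)
    then have "\<forall>\<^sub>F K in at_top. \<exists>l P. block_family (K *\<^sub>R \<theta>) (e' / c * K) (K * (h - e' / c)) l P"
      using assms(1) unfolding profiles_def by auto
    moreover have "filterlim (\<lambda>K. c * K) at_top at_top"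
      using assms(2) by (intro filterlim_tendsto_pos_mult_at_top[OF tendsto_const] filterlim_ident)
    ultimately have "\<forall>\<^sub>F K in at_top. \<exists>l P. block_family ((c * K) *\<^sub>R \<theta>) (e' / c * (c * K)) (c * K * (h - e' / c)) l P"
      by (rule eventually_compose_filterlim)
    then show ?thesis
      by (rule eventually_mono) (use assms(2) in \<open>simp add: algebra_simps\<close>)
  qed
  then show ?thesis unfolding profiles_def by simp
qed

text \<open>
  Profiles add up by concatenating families of both kinds. The oscillation on the first block
  is harmless: its length is at most a multiple of the scale \<open>K\<close>, because the norm of the
  potential dominates the length.
\<close>

lemma profiles_add:
  assumes "(\<theta>, h) \<in> profiles e" "(\<theta>', h') \<in> profiles e'"
  shows "(\<theta> + \<theta>', h + h') \<in> profiles (e + e')"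
proof -
  have "\<forall>\<^sub>F K in at_top. \<exists>l P. block_family (K *\<^sub>R (\<theta> + \<theta>')) (b * K) (K * (h + h' - b)) l P"
    if b: "b > e + e'" for b
  proof -
    define d where "d = (b - e - e') / 4"
    have d: "0 < d" using b unfolding d_def by simp
    define c where "c = norm \<theta> + \<bar>e\<bar> + d"
    have c: "0 < c" unfolding c_def using d by (smt (verit) norm_ge_zero)
    obtain M where M: "0 \<le> M"
      "\<And>n. variation_le n (M + d / c * real n)"
      using sublinear_variation[of "d / c"] d c by (metis divide_pos_pos)
    have "\<forall>\<^sub>F K in at_top. \<exists>l P. block_family (K *\<^sub>R \<theta>) ((e + d) * K) (K * (h - (e + d))) l P"
      using assms(1) d unfolding profiles_def by simp
    moreover have "\<forall>\<^sub>F K in at_top. \<exists>l P. block_family (K *\<^sub>R \<theta>') ((e' + d) * K) (K * (h' - (e' + d))) l P"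
      using assms(2) d unfolding profiles_def by simp
    moreover have "\<forall>\<^sub>F K in at_top. max 0 ((M + gap_error) / d) \<le> K" by (rule eventually_ge_at_top)
    ultimately show ?thesis
    proof eventually_elim
      case (elim K)
      then obtain l P l' P' where
        P: "block_family (K *\<^sub>R \<theta>) ((e + d) * K) (K * (h - (e + d))) l P" and
        P': "block_family (K *\<^sub>R \<theta>') ((e' + d) * K) (K * (h' - (e' + d))) l' P'" by blast
      have K: "0 \<le> K" "M + gap_error \<le> d * K" using elim(3) d by (auto simp: field_simps)
      obtain x where x: "x \<in> P" "x \<in> X" using P unfolding block_family_def by auto
      have "real l \<le> norm (\<Theta> l x)" by (rule length_le_norm[OF x(2)])
      also have "\<dots> \<le> norm (K *\<^sub>R \<theta>) + norm (\<Theta> l x - K *\<^sub>R \<theta>)" by (rule norm_triangle_sub)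
      also have "\<dots> \<le> K * norm \<theta> + (e + d) * K"
        using P x(1) K(1) unfolding block_family_def by auto
      also have "\<dots> \<le> c * K"
        unfolding c_def using K(1) mult_right_mono[of e "\<bar>e\<bar>" K] by (simp add: algebra_simps)
      finally have "d / c * real l \<le> d * K"
        using d c by (simp add: field_simps)
      then have v: "variation_le l (M + d * K)"
        using M(2)[of l] unfolding variation_le_def by fastforce
      obtain Q where Q: "block_family (K *\<^sub>R \<theta> + K *\<^sub>R \<theta>') ((e + d) * K + (e' + d) * K + (M + d * K) + gap_error)
          (K * (h - (e + d)) + K * (h' - (e' + d))) (l + gap + l') Q"
        using block_family_concat[OF P P' v] by blast
      have bK: "b = e + e' + 4 * d" unfolding d_def by (simp add: field_simps)
      have "block_family (K *\<^sub>R (\<theta> + \<theta>')) (b * K) (K * (h + h' - b)) (l + gap + l') Q"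
        using Q
      proof (rule block_family_mono)
        show "norm (K *\<^sub>R (\<theta> + \<theta>') - (K *\<^sub>R \<theta> + K *\<^sub>R \<theta>')) + ((e + d) * K + (e' + d) * K + (M + d * K) + gap_error) \<le> b * K"
          using K(2) by (simp add: bK algebra_simps)
        show "K * (h + h' - b) \<le> K * (h - (e + d)) + K * (h' - (e' + d))"
          using K(1) d by (simp add: bK algebra_simps)
      qed
      then show ?case by blast
    qed
  qed
  then show ?thesis unfolding profiles_def by simp
qed

lemma convex_profiles: "convex (profiles e)"
proof (rule convexI)
  fix p q :: "'e \<times> real" and u v :: real
  assume pq: "p \<in> profiles e" "q \<in> profiles e" and uv: "0 \<le> u" "0 \<le> v" "u + v = 1"
  show "u *\<^sub>R p + v *\<^sub>R q \<in> profiles e"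
  proof (cases "u = 0 \<or> v = 0")
    case True then show ?thesis using pq uv by auto
  next
    case False
    then have "u > 0" "v > 0" using uv by auto
    then have "(u *\<^sub>R fst p + v *\<^sub>R fst q, u * snd p + v * snd q) \<in> profiles (u * e + v * e)"
      using pq by (intro profiles_add profiles_scale) auto
    moreover have "u * e + v * e = e" using uv(3) by (metis distrib_right mult_1)
    ultimately show ?thesis by (simp add: plus_prod_def scaleR_prod_def)
  qed
qed

lemma closed_profiles: "closed (profiles e)"
proof -
  have "p \<in> profiles e" if p: "p \<in> closure (profiles e)" for p
  proof (rule profiles_limit)
    fix d :: real assume "0 < d"
    then obtain q where q: "q \<in> profiles e" "dist q p < d"
      using p closure_approachable by blast
    have "norm (fst p - fst q) \<le> d" "snd p \<le> snd q + d"
      using dist_fst_le[of q p] dist_snd_le[of q p] q(2) by (auto simp: dist_norm norm_minus_commute)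
    then show "p \<in> profiles (e + d)"
      using profiles_perturb[of "fst q" "snd q" e "fst p" d "snd p"] q(1) by simp
  qed
  then show ?thesis by (metis closure_subset closed_closure subsetI subset_antisym)
qed

text \<open>
  Repeating a single block of length \<open>n\<close> realizes its own average. The error per copy is sublinear
  in \<open>n\<close>, so after division by \<open>n\<close> it vanishes uniformly in the block.
\<close>

lemma orbit_averages_in_profiles:
  assumes "0 < e"
  obtains N where "\<And>n x. N \<le> n \<Longrightarrow> x \<in> X \<Longrightarrow> (\<Theta> n x /\<^sub>R real n, 0) \<in> profiles e"
proof -
  obtain M where M: "0 \<le> M"
      "\<And>n. variation_le n (M + e / 2 * real n)"
    using sublinear_variation[of "e / 2"] assms by (metis half_gt_zero)
  obtain N where N: "2 * (M + gap_error) / e < real N" using reals_Archimedean2 by blast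
  show ?thesis
  proof (rule that)
    fix n x assume n: "Suc N \<le> n" and x: "x \<in> X"
    have n0: "0 < real n" using n by simp
    have "block_family (\<Theta> n x) 0 0 n {x}"
      unfolding block_family_def using x by simp
    from profiles_of_block_family[OF this M(2)] have "(\<Theta> n x, 0) \<in> profiles (0 + (M + e / 2 * real n) + gap_error)" .
    from profiles_scale[OF this, of "inverse (real n)"] n0
    have 1: "(\<Theta> n x /\<^sub>R real n, 0) \<in> profiles (inverse (real n) * (M + e / 2 * real n + gap_error))" by simp
    have "2 * (M + gap_error) \<le> e * real n" using N n assms by (simp add: field_simps)
       (smt (verit) mult_left_mono of_nat_mono of_nat_Suc)
    then have "inverse (real n) * (M + e / 2 * real n + gap_error) \<le> e"
      using n0 by (simp add: field_simps)
    then show "(\<Theta> n x /\<^sub>R real n, 0) \<in> profiles e"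
      using profiles_perturb[OF 1, of "\<Theta> n x /\<^sub>R real n" "e - inverse (real n) * (M + e / 2 * real n + gap_error)" 0] by simp
  qed
qed

end

section \<open>Invariant measures\<close>

lemma space_invariant:
  assumes "\<mu> \<in> invariant_measures m A"
  shows "space \<mu> = subshift m A"
proof -
  have "space \<mu> = space (restrict_space borel (subshift m A))"
    using assms unfolding invariant_measures_def by (intro sets_eq_imp_space_eq) auto
  then show ?thesis by (simp add: space_restrict_space)
qed

lemma measurable_invariant:
  fixes f :: "(nat \<Rightarrow> nat) \<Rightarrow> 'b::topological_space"
  assumes "\<mu> \<in> invariant_measures m A" "continuous_on (subshift m A) f"
  shows "f \<in> borel_measurable \<mu>"
proof -
  have "sets \<mu> = sets (restrict_space borel (subshift m A))"
    using assms(1) unfolding invariant_measures_def by auto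
  then show ?thesis
    using borel_measurable_continuous_on_restrict[OF assms(2)]
    by (simp cong: measurable_cong_sets)
qed

lemma integrable_invariant:
  fixes f :: "(nat \<Rightarrow> nat) \<Rightarrow> 'b::euclidean_space"
  assumes "\<mu> \<in> invariant_measures m A" "continuous_on (subshift m A) f"
  shows "integrable \<mu> f"
proof -
  interpret prob_space \<mu> using assms(1) unfolding invariant_measures_def by auto
  obtain B where "\<And>x. x \<in> subshift m A \<Longrightarrow> norm (f x) \<le> B"
    using continuous_on_subshift_bounded[OF assms(2)] by metis
  then have "AE x in \<mu>. norm (f x) \<le> B"
    using space_invariant[OF assms(1)] by (intro AE_I2) auto
  then show ?thesis
    by (rule integrable_const_bound[OF _ measurable_invariant[OF assms]])
qed

lemma continuous_on_shift: "continuous_on S (shift ^^ n)"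
proof -
  have "continuous_on S (\<lambda>x i. x (n + i) :: nat)"
    by (intro continuous_on_coordinatewise_then_product continuous_on_product_coordinates)
       (auto intro: continuous_on_subset[OF continuous_on_product_coordinates])
  then show ?thesis by (simp add: shift_funpow[abs_def])
qed

lemma shift_image: "shift ` subshift m A \<subseteq> subshift m A"
  using shift_in_subshift[of _ m A 1] by auto

lemma integral_shift_invariant:
  fixes f :: "(nat \<Rightarrow> nat) \<Rightarrow> 'b::euclidean_space"
  assumes \<mu>: "\<mu> \<in> invariant_measures m A" and f: "continuous_on (subshift m A) f"
  shows "(\<integral>x. f ((shift ^^ n) x) \<partial>\<mu>) = (\<integral>x. f x \<partial>\<mu>)"
  using f
proof (induction n arbitrary: f)
  case 0 then show ?case by simp
next
  case (Suc n)
  have sets: "sets \<mu> = sets (restrict_space borel (subshift m A))"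
    using \<mu> unfolding invariant_measures_def by auto
  have "shift \<in> measurable \<mu> (restrict_space borel (subshift m A))"
    using measurable_invariant[OF \<mu> continuous_on_shift[of _ 1]] shift_image[of m A]
      space_invariant[OF \<mu>]
    by (intro measurable_restrict_space2) auto
  then have shift: "shift \<in> measurable \<mu> \<mu>"
    using sets by (simp cong: measurable_cong_sets)
  have distr: "distr \<mu> \<mu> shift = \<mu>"
    using \<mu> shift by (intro measure_eqI) (auto simp: emeasure_distr invariant_measures_def)
  have "(\<integral>x. f x \<partial>\<mu>) = (\<integral>x. f x \<partial>(distr \<mu> \<mu> shift))" by (simp add: distr)
  also have "\<dots> = (\<integral>x. f (shift x) \<partial>\<mu>)"
    by (rule integral_distr[OF shift measurable_invariant[OF \<mu> Suc.prems]])
  also have "\<dots> = (\<integral>x. f (shift ((shift ^^ n) x)) \<partial>\<mu>)"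
  proof (rule Suc.IH[symmetric])
    show "continuous_on (subshift m A) (\<lambda>x. f (shift x))"
      by (rule continuous_on_compose2[OF Suc.prems]) (use continuous_on_shift[of _ 1] shift_image in auto)
  qed
  finally show ?case by simp
qed

text \<open>
  The mixture draws one of the two measures by a biased coin and then a sequence from it.
\<close>

lemma invariant_mixture:
  assumes \<mu>: "\<mu> \<in> invariant_measures m A" and \<nu>: "\<nu> \<in> invariant_measures m A"
    and t: "0 \<le> t" "t \<le> 1"
  obtains \<rho> where "\<rho> \<in> invariant_measures m A"
    "\<And>f :: (nat \<Rightarrow> nat) \<Rightarrow> 'b::euclidean_space. continuous_on (subshift m A) f \<Longrightarrow>
       (\<integral>x. f x \<partial>\<rho>) = t *\<^sub>R (\<integral>x. f x \<partial>\<mu>) + (1 - t) *\<^sub>R (\<integral>x. f x \<partial>\<nu>)"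
proof -
  let ?S = "restrict_space borel (subshift m A)"
  define N where "N b = (if b then \<mu> else \<nu>)" for b
  define \<rho> where "\<rho> = measure_pmf (bernoulli_pmf t) \<bind> N"
  have prob: "prob_space (N b)" and setsN: "sets (N b) = sets ?S" for b
    using \<mu> \<nu> unfolding N_def invariant_measures_def by auto
  have spaceN: "space (N b) = subshift m A" for b
    using space_invariant \<mu> \<nu> unfolding N_def by auto
  have N: "N \<in> measurable (measure_pmf (bernoulli_pmf t)) (subprob_algebra ?S)"
    using prob setsN by (auto simp: space_subprob_algebra prob_space_imp_subprob_space)
  have setsR: "sets \<rho> = sets ?S"
    unfolding \<rho>_def by (rule sets_bind) (auto simp: setsN)
  have spaceR: "space \<rho> = subshift m A"
    using sets_eq_imp_space_eq[OF setsR] by (simp add: space_restrict_space)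
  have em: "emeasure \<rho> B = emeasure \<mu> B * ennreal t + emeasure \<nu> B * ennreal (1 - t)" if "B \<in> sets ?S" for B
    unfolding \<rho>_def using emeasure_bind[OF _ N that] t
    by (simp add: nn_integral_bernoulli_pmf N_def)
  have "prob_space \<rho>"
    unfolding \<rho>_def using prob by (intro prob_space.prob_space_bind[OF _ _ N]) (auto intro: prob_space_measure_pmf)
  moreover have "emeasure \<rho> (shift -` B \<inter> space \<rho>) = emeasure \<rho> B" if B: "B \<in> sets \<rho>" for B
  proof -
    have "shift -` B \<inter> subshift m A \<in> sets ?S"
    proof -
      have "shift \<in> measurable ?S ?S"
        using borel_measurable_continuous_on_restrict[OF continuous_on_shift[of "subshift m A" 1]]
          shift_image[of m A]
        by (intro measurable_restrict_space2) (auto simp: space_restrict_space)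
      from measurable_sets[OF this, of B] show ?thesis
        using B setsR by (simp add: space_restrict_space)
    qed
    moreover have "emeasure (N b) (shift -` B \<inter> subshift m A) = emeasure (N b) B" for b
    proof -
      have "N b \<in> invariant_measures m A" using \<mu> \<nu> unfolding N_def by auto
      then show ?thesis
        using B setsR spaceN[of b] unfolding invariant_measures_def by fastforce
    qed
    from this[of True] this[of False]
    have "emeasure \<mu> (shift -` B \<inter> subshift m A) = emeasure \<mu> B"
      "emeasure \<nu> (shift -` B \<inter> subshift m A) = emeasure \<nu> B"
      unfolding N_def by simp_all
    ultimately show ?thesis using B setsR em spaceR by simp
  qed
  ultimately have \<rho>: "\<rho> \<in> invariant_measures m A"
    unfolding invariant_measures_def using setsR by auto
  have real: "(\<integral>x. f x \<partial>\<rho>) = t * (\<integral>x. f x \<partial>\<mu>) + (1 - t) * (\<integral>x. f x \<partial>\<nu>)"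
    if f: "continuous_on (subshift m A) f" for f :: "(nat \<Rightarrow> nat) \<Rightarrow> real"
  proof -
    obtain B where B: "\<And>x. x \<in> subshift m A \<Longrightarrow> norm (f x) \<le> B"
      using continuous_on_subshift_bounded[OF f] by metis
    have "(\<integral>x. f x \<partial>\<rho>) = (\<integral>b. (\<integral>x. f x \<partial>N b) \<partial>measure_pmf (bernoulli_pmf t))"
      unfolding \<rho>_def
    proof (rule integral_bind[OF borel_measurable_continuous_on_restrict[OF f] _ N])
      show "\<bar>f x\<bar> \<le> B" if "x \<in> space ?S" for x
        using B[of x] that by (simp add: space_restrict_space)
      show "finite_measure (measure_pmf (bernoulli_pmf t))"
        by (rule measure_pmf.finite_measure_axioms)
      show "AE b in measure_pmf (bernoulli_pmf t). emeasure (N b) (space (N b)) \<le> ennreal 1"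
        using prob by (intro AE_I2) (simp add: prob_space.emeasure_space_1)
    qed
    then show ?thesis using t by (simp add: N_def mult.commute)
  qed
  show ?thesis
  proof (rule that[OF \<rho>])
    fix f :: "(nat \<Rightarrow> nat) \<Rightarrow> 'b" assume f: "continuous_on (subshift m A) f"
    show "(\<integral>x. f x \<partial>\<rho>) = t *\<^sub>R (\<integral>x. f x \<partial>\<mu>) + (1 - t) *\<^sub>R (\<integral>x. f x \<partial>\<nu>)"
    proof (rule euclidean_eqI)
      fix b :: 'b
      have "(\<integral>x. f x \<bullet> b \<partial>\<rho>) = t * (\<integral>x. f x \<bullet> b \<partial>\<mu>) + (1 - t) * (\<integral>x. f x \<bullet> b \<partial>\<nu>)"
        by (intro real continuous_intros f)
      then show "(\<integral>x. f x \<partial>\<rho>) \<bullet> b = (t *\<^sub>R (\<integral>x. f x \<partial>\<mu>) + (1 - t) *\<^sub>R (\<integral>x. f x \<partial>\<nu>)) \<bullet> b"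
        using integrable_invariant[OF \<mu> f] integrable_invariant[OF \<nu> f] integrable_invariant[OF \<rho> f]
        by (simp add: inner_left_distrib)
    qed
  qed
qed

lemma (in prob_space) integral_in_closed_convex:
  fixes f :: "'a \<Rightarrow> 'b::euclidean_space"
  assumes "integrable M f" "closed S" "convex S" "\<And>x. x \<in> space M \<Longrightarrow> f x \<in> S"
  shows "(\<integral>x. f x \<partial>M) \<in> S"
proof (rule ccontr)
  assume "(\<integral>x. f x \<partial>M) \<notin> S"
  then obtain a b where ab: "a \<bullet> (\<integral>x. f x \<partial>M) < b" "\<And>x. x \<in> S \<Longrightarrow> a \<bullet> x > b"
    using separating_hyperplane_closed_point[OF assms(3,2)] by blast
  have "b = (\<integral>x. b \<partial>M)" by (simp add: prob_space)
  also have "\<dots> \<le> (\<integral>x. a \<bullet> f x \<partial>M)"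
    using assms(1,4) ab(2) by (intro integral_mono) (auto intro: less_imp_le)
  also have "\<dots> = a \<bullet> (\<integral>x. f x \<partial>M)" using assms(1) by simp
  finally show False using ab(1) by simp
qed

text \<open>
  A two-sided form of Fekete's lemma: both \<open>b n / n\<close> and \<open>b p / p\<close> are close to
  \<open>b (p n) / (p n)\<close>, which gives a Cauchy sequence without any order on the values.
\<close>

lemma almost_additive_sequence_converges:
  fixes b :: "nat \<Rightarrow> 'b::banach"
  assumes "\<And>n p. norm (b (n + p) - (b n + b p)) \<le> D"
  shows "convergent (\<lambda>n. b n /\<^sub>R real n)"
proof -
  have D: "0 \<le> D" using assms[of 0 0] by (rule order_trans[OF norm_ge_zero])
  have mult: "norm (b (Suc k * n) - real (Suc k) *\<^sub>R b n) \<le> real k * D" for k n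
  proof (induction k)
    case 0 then show ?case by simp
  next
    case (Suc k)
    have "b (Suc (Suc k) * n) - real (Suc (Suc k)) *\<^sub>R b n =
        (b (n + Suc k * n) - (b n + b (Suc k * n))) + (b (Suc k * n) - real (Suc k) *\<^sub>R b n)"
      by (simp add: algebra_simps scaleR_2)
    also have "norm \<dots> \<le> D + real k * D"
      by (intro norm_triangle_mono assms Suc)
    finally show ?case by (simp add: algebra_simps)
  qed
  have close: "norm (b (p * n) /\<^sub>R real (p * n) - b n /\<^sub>R real n) \<le> D / real n" if "1 \<le> n" "1 \<le> p" for n p
  proof -
    have "norm (b (p * n) - real p *\<^sub>R b n) \<le> real (p - 1) * D"
      using mult[of "p - 1" n] that by simp
    also have "\<dots> \<le> real p * D" using D by (intro mult_right_mono) auto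
    finally have 1: "norm (b (p * n) - real p *\<^sub>R b n) \<le> real p * D" .
    have "b (p * n) /\<^sub>R real (p * n) - b n /\<^sub>R real n = (b (p * n) - real p *\<^sub>R b n) /\<^sub>R real (p * n)"
      using that by (simp add: algebra_simps)
    then have "norm (b (p * n) /\<^sub>R real (p * n) - b n /\<^sub>R real n) = norm (b (p * n) - real p *\<^sub>R b n) / real (p * n)"
      by (simp add: divide_inverse_commute)
    also have "\<dots> \<le> real p * D / real (p * n)" using 1 by (intro divide_right_mono) auto
    also have "\<dots> = D / real n" using that by simp
    finally show ?thesis .
  qed
  have "Cauchy (\<lambda>n. b n /\<^sub>R real n)"
  proof (rule metric_CauchyI)
    fix e :: real assume e: "0 < e"
    obtain N :: nat where N: "2 * D / e < real N" using reals_Archimedean2 by blast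
    have "dist (b n /\<^sub>R real n) (b p /\<^sub>R real p) < e" if "Suc N \<le> n" "Suc N \<le> p" for n p
    proof -
      have small: "D / real k < e / 2" if "Suc N \<le> k" for k
      proof -
        have "2 * D < e * real N" using N e by (simp add: field_simps)
        also have "\<dots> \<le> e * real k" using that e by (intro mult_left_mono) auto
        finally show ?thesis using that by (simp add: field_simps)
      qed
      have "dist (b (p * n) /\<^sub>R real (p * n)) (b n /\<^sub>R real n) < e / 2"
        using close[of n p] small[OF that(1)] that unfolding dist_norm by linarith
      moreover have "dist (b (p * n) /\<^sub>R real (p * n)) (b p /\<^sub>R real p) < e / 2"
        using close[of p n] small[OF that(2)] that unfolding dist_norm mult.commute[of p n] by linarith
      ultimately show ?thesis by (metis dist_triangle_half_r)
    qed
    then show "\<exists>M. \<forall>n\<ge>M. \<forall>p\<ge>M. dist (b n /\<^sub>R real n) (b p /\<^sub>R real p) < e" by blast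
  qed
  then show ?thesis by (rule Cauchy_convergent)
qed

lemma (in almost_additive_vector) integral_almost_additive:
  assumes \<mu>: "\<mu> \<in> invariant_measures m A"
  shows "norm ((\<integral>x. \<Theta> (n + p) x \<partial>\<mu>) - ((\<integral>x. \<Theta> n x \<partial>\<mu>) + (\<integral>x. \<Theta> p x \<partial>\<mu>))) \<le> D"
proof -
  interpret prob_space \<mu> using \<mu> unfolding invariant_measures_def by auto
  have comp: "continuous_on X (\<lambda>x. \<Theta> p ((shift ^^ n) x))"
    by (rule continuous_on_compose2[OF continuous continuous_on_shift]) (auto simp: shift_in_subshift)
  note int = integrable_invariant[OF \<mu> continuous] integrable_invariant[OF \<mu> comp]
  let ?f = "\<lambda>x. \<Theta> (n + p) x - (\<Theta> n x + \<Theta> p ((shift ^^ n) x))"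
  have "(\<integral>x. \<Theta> (n + p) x \<partial>\<mu>) - ((\<integral>x. \<Theta> n x \<partial>\<mu>) + (\<integral>x. \<Theta> p x \<partial>\<mu>)) = (\<integral>x. ?f x \<partial>\<mu>)"
    using int by (simp add: integral_shift_invariant[OF \<mu> continuous])
  also have "\<dots> \<in> cball 0 D"
    using int space_invariant[OF \<mu>] almost_additive
    by (intro integral_in_closed_convex) auto
  finally show ?thesis by simp
qed

text \<open>
  For each \<open>n\<close> the mean of \<open>\<Theta> n / n\<close> lies in the closed convex hull of its
  values, each of which is nearly realized by repeating a single block.
\<close>

lemma (in almost_additive_vector) integral_averages_in_profiles:
  assumes \<mu>: "\<mu> \<in> invariant_measures m A"
  obtains \<theta> where "(\<lambda>n. (\<integral>x. \<Theta> n x \<partial>\<mu>) /\<^sub>R real n) \<longlonglongrightarrow> \<theta>" "(\<theta>, 0) \<in> profiles 0"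
proof -
  interpret prob_space \<mu> using \<mu> unfolding invariant_measures_def by auto
  let ?b = "\<lambda>n. (\<integral>x. \<Theta> n x \<partial>\<mu>) /\<^sub>R real n"
  have "convergent ?b"
    by (rule almost_additive_sequence_converges[OF integral_almost_additive[OF \<mu>]])
  then obtain \<theta> where \<theta>: "?b \<longlonglongrightarrow> \<theta>" unfolding convergent_def by blast
  have "(\<theta>, 0) \<in> profiles 0"
  proof (rule profiles_limit)
    fix d :: real assume d: "0 < d"
    then have d2: "0 < d / 2" by simp
    obtain N where N: "\<And>n x. N \<le> n \<Longrightarrow> x \<in> X \<Longrightarrow> (\<Theta> n x /\<^sub>R real n, 0) \<in> profiles (d / 2)"
      using orbit_averages_in_profiles[OF d2] by blast
    have "\<forall>\<^sub>F n in sequentially. dist (?b n) \<theta> < d / 2"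
      using \<theta> d2 by (rule tendstoD)
    then obtain n where n: "N \<le> n" "dist (?b n) \<theta> < d / 2"
      using eventually_happens[OF eventually_conj[OF eventually_ge_at_top[of N]]] by fastforce
    let ?S = "(\<lambda>\<theta>. (\<theta>, 0)) -` profiles (d / 2)"
    have "linear (\<lambda>\<theta> :: 'e. (\<theta>, 0 :: real))"
      by (rule linearI) auto
    then have "convex ?S" using convex_profiles by (rule convex_linear_vimage)
    moreover have "closed ?S" by (intro closed_vimage closed_profiles continuous_intros)
    moreover have "integrable \<mu> (\<lambda>x. \<Theta> n x /\<^sub>R real n)"
      by (intro integrable_scaleR_right integrable_invariant[OF \<mu> continuous])
    ultimately have "(\<integral>x. \<Theta> n x /\<^sub>R real n \<partial>\<mu>) \<in> ?S"
      using N[OF n(1)] space_invariant[OF \<mu>] by (intro integral_in_closed_convex) auto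
    then have "(?b n, 0) \<in> profiles (d / 2)"
      using integrable_invariant[OF \<mu> continuous] by simp
    moreover have "norm (\<theta> - ?b n) \<le> d / 2"
      using n(2) by (simp add: dist_norm norm_minus_commute)
    ultimately have "(\<theta>, 0) \<in> profiles (d / 2 + d / 2)"
      by (rule profiles_perturb) (use d in simp)
    then show "(\<theta>, 0) \<in> profiles (0 + d)" by simp
  qed
  with \<theta> show ?thesis by (rule that)
qed

section \<open>Counting ball words\<close>

definition prefix :: "(nat \<Rightarrow> nat) \<Rightarrow> nat \<Rightarrow> nat list" where
  "prefix x n = map x [0..<n]"

lemma length_prefix [simp]: "length (prefix x n) = n"
  by (simp add: prefix_def)

lemma prefix_eq_iff_agree: "prefix x n = prefix y n \<longleftrightarrow> agree n x y"
  by (simp add: prefix_def agree_iff_prefix)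

lemma butlast_prefix: "butlast (prefix x (Suc n)) = prefix x n"
  by (simp add: prefix_def)

lemma cylinder_eq: "cylinder m A w = {x \<in> subshift m A. prefix x (length w) = w}"
  by (simp add: cylinder_def prefix_def)

lemma cylinder_prefix: "y \<in> cylinder m A (prefix x n) \<longleftrightarrow> y \<in> subshift m A \<and> agree n y x"
  by (simp add: cylinder_eq prefix_eq_iff_agree)

lemma prefix_admissible: "x \<in> subshift m A \<Longrightarrow> prefix x n \<in> admissible_words m A"
  by (auto simp: admissible_words_def prefix_def subshift_def)

lemma sum_powers_le: "(\<Sum>i\<le>L. m ^ i) \<le> (m + 1 :: nat) ^ L"
proof (induction L)
  case 0 then show ?case by simp
next
  case (Suc L)
  have "(\<Sum>i\<le>Suc L. m ^ i) = (\<Sum>i\<le>L. m ^ i) + m * m ^ L" by simp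
  also have "\<dots> \<le> (m + 1) ^ L + m * (m + 1) ^ L"
    by (intro add_mono Suc mult_left_mono power_mono) auto
  also have "\<dots> = (m + 1) ^ Suc L" by simp
  finally show ?case .
qed

lemma almost_additiveD:
  assumes "almost_additive m A \<phi> c" "1 \<le> n" "1 \<le> p" "x \<in> subshift m A"
  shows "- c + \<phi> n x + \<phi> p ((shift ^^ n) x) \<le> \<phi> (n + p) x"
    "\<phi> (n + p) x \<le> c + \<phi> n x + \<phi> p ((shift ^^ n) x)"
  using assms unfolding almost_additive_def by auto

locale almost_additive_pair =
  fixes m :: nat and A :: "nat \<Rightarrow> nat \<Rightarrow> nat"
    and \<psi> :: "nat \<Rightarrow> (nat \<Rightarrow> nat) \<Rightarrow> real" and C :: real
    and \<Phi> :: "nat \<Rightarrow> (nat \<Rightarrow> nat) \<Rightarrow> real ^ 'd"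
  assumes prim: "primitive_01_matrix m A"
    and psi: "negative_almost_additive m A \<psi> C"
    and phi: "vector_almost_additive m A \<Phi>"
begin

text \<open>The cost \<open>- \<psi>\<close> increases by at least this positive amount with each letter.\<close>

definition decay :: real where
  "decay = - ((SUP x\<in>subshift m A. \<psi> 1 x) + C)"

text \<open>
  Vanishing at index 0 makes additivity hold also for empty pieces, and makes the weight 1 of the
  empty word an instance of the general formula for weights.
\<close>

definition \<psi>\<^sub>0 :: "nat \<Rightarrow> (nat \<Rightarrow> nat) \<Rightarrow> real" where
  "\<psi>\<^sub>0 n x = (if n = 0 then 0 else \<psi> n x)"

definition \<Phi>\<^sub>0 :: "nat \<Rightarrow> (nat \<Rightarrow> nat) \<Rightarrow> real ^ 'd" where
  "\<Phi>\<^sub>0 n x = (if n = 0 then 0 else \<Phi> n x)"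

text \<open>
  Length, cost and the potential are handled together. The first component makes the norm
  dominate the length; the second one, the cost, is up to a sublinear error minus the logarithm of
  the diameter of a cylinder.
\<close>

definition joint :: "nat \<Rightarrow> (nat \<Rightarrow> nat) \<Rightarrow> real \<times> real \<times> (real ^ 'd)" where
  "joint n x = (real n, - \<psi>\<^sub>0 n x, \<Phi>\<^sub>0 n x)"

definition phi_const :: "'d \<Rightarrow> real" where
  "phi_const i = (SOME c. almost_additive m A (\<lambda>n x. \<Phi> n x $ i) c)"

lemma phi_almost_additive: "almost_additive m A (\<lambda>n x. \<Phi> n x $ i) (phi_const i)"
proof -
  have "\<exists>c. almost_additive m A (\<lambda>n x. \<Phi> n x $ i) c"
    using phi unfolding vector_almost_additive_def by simp
  then show ?thesis unfolding phi_const_def by (rule someI_ex)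
qed

definition error :: real where
  "error = \<bar>C\<bar> + (\<Sum>i\<in>UNIV. \<bar>phi_const i\<bar>)"

lemma decay_pos: "0 < decay"
  using psi unfolding decay_def negative_almost_additive_def by simp

lemma psi_almost_additive: "almost_additive m A \<psi> C"
  using psi unfolding negative_almost_additive_def by simp

lemma C_nonneg: "x \<in> subshift m A \<Longrightarrow> 0 \<le> C"
proof -
  assume "x \<in> subshift m A"
  from almost_additiveD[OF psi_almost_additive order.refl order.refl this] show ?thesis by simp
qed

lemma error_psi:
  assumes "x \<in> subshift m A"
  shows "\<bar>\<psi>\<^sub>0 (n + p) x - (\<psi>\<^sub>0 n x + \<psi>\<^sub>0 p ((shift ^^ n) x))\<bar> \<le> \<bar>C\<bar>"
proof (cases "n = 0 \<or> p = 0")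
  case True then show ?thesis by (auto simp: \<psi>\<^sub>0_def)
next
  case False
  then have "1 \<le> n" "1 \<le> p" by auto
  from almost_additiveD[OF psi_almost_additive this assms] show ?thesis
    using False by (simp add: \<psi>\<^sub>0_def)
qed

lemma error_phi:
  assumes "x \<in> subshift m A"
  shows "norm (\<Phi>\<^sub>0 (n + p) x - (\<Phi>\<^sub>0 n x + \<Phi>\<^sub>0 p ((shift ^^ n) x)))
    \<le> (\<Sum>i\<in>UNIV. \<bar>phi_const i\<bar>)"
proof (cases "n = 0 \<or> p = 0")
  case True then show ?thesis by (auto simp: \<Phi>\<^sub>0_def intro!: sum_nonneg)
next
  case False
  then have np: "1 \<le> n" "1 \<le> p" by auto
  have "\<bar>(\<Phi> (n + p) x - (\<Phi> n x + \<Phi> p ((shift ^^ n) x))) $ i\<bar>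
      \<le> \<bar>phi_const i\<bar>" for i
    using almost_additiveD[OF phi_almost_additive[of i] np assms] by simp
  then have "norm (\<Phi> (n + p) x - (\<Phi> n x + \<Phi> p ((shift ^^ n) x)))
    \<le> (\<Sum>i\<in>UNIV. \<bar>phi_const i\<bar>)"
    by (intro order_trans[OF norm_le_l1_cart] sum_mono)
  then show ?thesis using False by (simp add: \<Phi>\<^sub>0_def)
qed

lemma continuous_psi: "continuous_on (subshift m A) (\<psi>\<^sub>0 n)"
  using psi_almost_additive unfolding almost_additive_def \<psi>\<^sub>0_def by (cases "n = 0") auto

lemma continuous_phi: "continuous_on (subshift m A) (\<Phi>\<^sub>0 n)"
proof (cases "n = 0")
  case True then show ?thesis unfolding \<Phi>\<^sub>0_def by simp
next
  case False
  then have "continuous_on (subshift m A) (\<lambda>x. \<Phi> n x $ i)" for i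
    using phi_almost_additive[of i] unfolding almost_additive_def by simp
  then have "continuous_on (subshift m A) (\<lambda>x. \<chi> i. \<Phi> n x $ i)"
    by (rule continuous_on_vec_lambda)
  then show ?thesis using False unfolding \<Phi>\<^sub>0_def by simp
qed

end

sublocale almost_additive_pair \<subseteq> almost_additive_vector m A joint error
proof
  show "primitive_01_matrix m A" by (rule prim)
  show "0 \<le> error" unfolding error_def by (auto intro!: add_nonneg_nonneg sum_nonneg)
  fix n show "continuous_on (subshift m A) (joint n)"
    unfolding joint_def[abs_def]
    by (intro continuous_intros continuous_psi[unfolded eta_contract_eq] continuous_phi)
next
  fix x show "joint 0 x = 0"
    by (simp add: joint_def \<psi>\<^sub>0_def \<Phi>\<^sub>0_def zero_prod_def)
next
  fix x n p assume x: "x \<in> subshift m A"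
  let ?a = "\<psi>\<^sub>0 (n + p) x - (\<psi>\<^sub>0 n x + \<psi>\<^sub>0 p ((shift ^^ n) x))"
  let ?b = "\<Phi>\<^sub>0 (n + p) x - (\<Phi>\<^sub>0 n x + \<Phi>\<^sub>0 p ((shift ^^ n) x))"
  have eq: "joint (n + p) x - (joint n x + joint p ((shift ^^ n) x)) = (0, - ?a, ?b)"
    by (simp add: joint_def)
  have "norm (0 :: real, - ?a, ?b) \<le> norm (0 :: real) + norm (- ?a, ?b)" by (rule norm_Pair_le)
  moreover have "norm (- ?a, ?b) \<le> norm (- ?a) + norm ?b" by (rule norm_Pair_le)
  ultimately have "norm (0 :: real, - ?a, ?b) \<le> error"
    using error_psi[OF x, of n p] error_phi[OF x, of n p] unfolding error_def by simp
  then show "norm (joint (n + p) x - (joint n x + joint p ((shift ^^ n) x))) \<le> error"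
    unfolding eq .
next
  fix x n show "real n \<le> norm (joint n x)"
    unfolding joint_def using norm_fst_le[of "real n"] by (metis abs_of_nat real_norm_def)
qed

context almost_additive_pair
begin

lemma psi_bound: "x \<in> X \<Longrightarrow> \<bar>\<psi>\<^sub>0 n x\<bar> \<le> bound * real n"
  and phi_bound: "x \<in> X \<Longrightarrow> norm (\<Phi>\<^sub>0 n x) \<le> bound * real n"
proof -
  assume "x \<in> X"
  then have "norm (joint n x) \<le> bound * real n" by (rule linear_bound)
  moreover have "\<bar>\<psi>\<^sub>0 n x\<bar> \<le> norm (joint n x)" "norm (\<Phi>\<^sub>0 n x) \<le> norm (joint n x)"
    unfolding joint_def
    using norm_fst_le[of "- \<psi>\<^sub>0 n x" "\<Phi>\<^sub>0 n x"] norm_snd_le[of "\<Phi>\<^sub>0 n x" "- \<psi>\<^sub>0 n x"]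
      norm_snd_le[of "(- \<psi>\<^sub>0 n x, \<Phi>\<^sub>0 n x)" "real n"] by (auto intro: order_trans)
  ultimately show "\<bar>\<psi>\<^sub>0 n x\<bar> \<le> bound * real n" "norm (\<Phi>\<^sub>0 n x) \<le> bound * real n" by auto
qed

lemma psi_variation:
  assumes "variation_le n v" "x \<in> X" "y \<in> X" "agree n x y"
  shows "\<bar>\<psi>\<^sub>0 n x - \<psi>\<^sub>0 n y\<bar> \<le> v"
proof -
  have "norm (joint n x - joint n y) \<le> v" using assms unfolding variation_le_def by blast
  moreover have "joint n x - joint n y = (0, - (\<psi>\<^sub>0 n x - \<psi>\<^sub>0 n y), \<Phi>\<^sub>0 n x - \<Phi>\<^sub>0 n y)"
    by (simp add: joint_def)
  moreover have "\<bar>\<psi>\<^sub>0 n x - \<psi>\<^sub>0 n y\<bar> \<le> norm (0 :: real, - (\<psi>\<^sub>0 n x - \<psi>\<^sub>0 n y), \<Phi>\<^sub>0 n x - \<Phi>\<^sub>0 n y)"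
    using norm_fst_le[of "- (\<psi>\<^sub>0 n x - \<psi>\<^sub>0 n y)" "\<Phi>\<^sub>0 n x - \<Phi>\<^sub>0 n y"]
      norm_snd_le[of "(- (\<psi>\<^sub>0 n x - \<psi>\<^sub>0 n y), \<Phi>\<^sub>0 n x - \<Phi>\<^sub>0 n y)" "0 :: real"] 
    by (simp add: norm_minus_commute)
  ultimately show ?thesis by simp
qed

lemma psi_decay: "x \<in> X \<Longrightarrow> \<psi>\<^sub>0 (n + p) x \<le> \<psi>\<^sub>0 n x - decay * real p"
proof (induction p)
  case 0 then show ?case by simp
next
  case (Suc p)
  have "bdd_above (\<psi> 1 ` X)"
    using compact_continuous_image[OF _ compact_subshift] psi_almost_additive
    unfolding almost_additive_def by (meson bounded_imp_bdd_above compact_imp_bounded order.refl)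
  then have sup: "\<psi> 1 y \<le> - C - decay" if "y \<in> X" for y
    using cSUP_upper[OF that, of "\<psi> 1"] unfolding decay_def by simp
  have "\<psi>\<^sub>0 (Suc k) x \<le> \<psi>\<^sub>0 k x - decay" for k
  proof (cases "k = 0")
    case True
    then show ?thesis using sup[OF Suc.prems] C_nonneg[OF Suc.prems] by (simp add: \<psi>\<^sub>0_def)
  next
    case False
    then have "\<psi> (k + 1) x \<le> C + \<psi> k x + \<psi> 1 ((shift ^^ k) x)"
      using almost_additiveD(2)[OF psi_almost_additive _ order.refl Suc.prems, of k] by simp
    then show ?thesis using sup[OF shift_in_subshift[OF Suc.prems, of k]] False
      by (simp add: \<psi>\<^sub>0_def)
  qed
  from this[of "n + p"] Suc show ?case by (simp add: algebra_simps)
qed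

lemma psi_le: "x \<in> X \<Longrightarrow> \<psi>\<^sub>0 n x \<le> - decay * real n"
  using psi_decay[of x 0 n] by (simp add: \<psi>\<^sub>0_def)

lemma word_weight_eq_SUP:
  assumes "cylinder m A w \<noteq> {}"
  shows "word_weight m A \<psi> w = (SUP x\<in>cylinder m A w. exp (\<psi>\<^sub>0 (length w) x))"
proof (cases "w = []")
  case True
  then have "(SUP x\<in>cylinder m A w. exp (\<psi>\<^sub>0 (length w) x)) = 1"
    using assms by (simp add: \<psi>\<^sub>0_def)
  then show ?thesis using True by (simp add: word_weight_def)
next
  case False then show ?thesis by (simp add: word_weight_def \<psi>\<^sub>0_def)
qed

lemma bdd_above_weight: "bdd_above ((\<lambda>x. exp (\<psi>\<^sub>0 n x)) ` cylinder m A w)"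
proof (rule bdd_aboveI2)
  fix x assume "x \<in> cylinder m A w"
  then have "\<bar>\<psi>\<^sub>0 n x\<bar> \<le> bound * real n" by (intro psi_bound) (simp add: cylinder_def)
  then show "exp (\<psi>\<^sub>0 n x) \<le> exp (bound * real n)" by simp
qed

lemma word_weight_ge: "x \<in> cylinder m A w \<Longrightarrow> exp (\<psi>\<^sub>0 (length w) x) \<le> word_weight m A \<psi> w"
  by (subst word_weight_eq_SUP) (auto intro!: cSUP_upper bdd_above_weight)

lemma word_weight_gtE:
  assumes "r < word_weight m A \<psi> w" "cylinder m A w \<noteq> {}"
  obtains y where "y \<in> cylinder m A w" "r < exp (\<psi>\<^sub>0 (length w) y)"
  using assms less_cSUP_iff[OF assms(2) bdd_above_weight] by (auto simp: word_weight_eq_SUP)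

text \<open>
  The weight of a ball word is at most \<open>exp (- n)\<close>, that of the word without its last letter is
  larger. Since the cost grows at least like \<open>decay\<close> and at most like \<open>bound\<close> per letter, this pins
  the length between two multiples of \<open>n\<close>.
\<close>

lemma ball_word_bounds:
  assumes u: "u \<in> ball_words m A \<psi> n" and x: "x \<in> cylinder m A u" and n: "1 \<le> n"
  shows "\<psi>\<^sub>0 (length u) x \<le> - real n" "real n \<le> bound * real (length u)"
    "real (length u) \<le> real n / decay + 1" "u \<noteq> []"
    "\<exists>y\<in>X. agree (length u - 1) y x \<and> - real n < \<psi>\<^sub>0 (length u - 1) y"
proof -
  have xX: "x \<in> X" using x by (simp add: cylinder_def)
  have w: "word_weight m A \<psi> u \<le> exp (- real n)" "u = [] \<or> word_weight m A \<psi> (butlast u) > exp (- real n)"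
    using u unfolding ball_words_def by auto
  show u0: "u \<noteq> []" using w(1) n by (auto simp: word_weight_def)
  have "exp (\<psi>\<^sub>0 (length u) x) \<le> exp (- real n)" 
    by (rule order_trans[OF word_weight_ge[OF x] w(1)])
  then show le: "\<psi>\<^sub>0 (length u) x \<le> - real n" by simp
  show "real n \<le> bound * real (length u)" using le psi_bound[OF xX, of "length u"] by linarith
  have px: "u = prefix x (length u)" using x by (simp add: cylinder_eq)
  then have bl: "butlast u = prefix x (length u - 1)"
    by (metis u0 Suc_pred' butlast_prefix length_greater_0_conv)
  have "x \<in> cylinder m A (butlast u)" unfolding bl using xX by (simp add: cylinder_prefix agree_refl)
  then obtain y where y: "y \<in> cylinder m A (butlast u)" "exp (- real n) < exp (\<psi>\<^sub>0 (length (butlast u)) y)"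
    using word_weight_gtE[of "exp (- real n)" "butlast u"] w(2) u0 by blast
  then have y': "y \<in> X" "agree (length u - 1) y x" "- real n < \<psi>\<^sub>0 (length u - 1) y"
    unfolding bl by (auto simp: cylinder_prefix)
  then show "\<exists>y\<in>X. agree (length u - 1) y x \<and> - real n < \<psi>\<^sub>0 (length u - 1) y" by blast
  have "decay * (real (length u - 1)) < real n" using psi_le[OF y'(1), of "length u - 1"] y'(3) by simp
  then show "real (length u) \<le> real n / decay + 1" using decay_pos u0 by (simp add: field_simps of_nat_diff Suc_le_eq)
qed

text \<open>
  The first \<open>j > l\<close> at which the weight falls to \<open>exp (- n)\<close> gives a ball word: at \<open>j - 1\<close> the weight
  is still larger, by minimality if \<open>j - 1 > l\<close> and by the assumption on \<open>x\<close> if \<open>j - 1 = l\<close>.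
\<close>

lemma ball_word_extending:
  assumes x: "x \<in> X" and l: "- real n < \<psi>\<^sub>0 l x"
  obtains j where "l < j" "prefix x j \<in> ball_words m A \<psi> n"
proof -
  let ?Q = "\<lambda>j. l < j \<and> word_weight m A \<psi> (prefix x j) \<le> exp (- real n)"
  have "\<exists>j. ?Q j"
  proof -
    obtain k :: nat where k: "real n / decay < real k" using reals_Archimedean2 by blast
    define j where "j = Suc (max l k)"
    have "real n / decay \<le> real j" using k unfolding j_def by simp
    then have "real n \<le> decay * real j" using decay_pos by (simp add: field_simps)
    then have "exp (\<psi>\<^sub>0 j y) \<le> exp (- real n)" if "y \<in> X" for y
      using psi_le[OF that, of j] by simp
    moreover have ne: "x \<in> cylinder m A (prefix x j)" using x by (simp add: cylinder_prefix agree_refl)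
    ultimately have "word_weight m A \<psi> (prefix x j) \<le> exp (- real n)"
      by (subst word_weight_eq_SUP) (auto intro!: cSUP_least simp: cylinder_prefix)
    then show ?thesis unfolding j_def by (intro exI[of _ j]) (simp add: j_def)
  qed
  define j where "j = (LEAST j. ?Q j)"
  have j: "?Q j" unfolding j_def using \<open>\<exists>j. ?Q j\<close> by (rule LeastI_ex)
  obtain i where i: "j = Suc i" using j by (cases j) auto
  have "word_weight m A \<psi> (prefix x i) > exp (- real n)"
  proof (cases "i = l")
    case True
    have "x \<in> cylinder m A (prefix x l)" using x by (simp add: cylinder_prefix agree_refl)
    from word_weight_ge[OF this] l True show ?thesis
      by (simp add: less_le_trans[OF iffD2[OF exp_less_cancel_iff]])
  next
    case False
    then show ?thesis using not_less_Least[of i ?Q] i j unfolding j_def by fastforce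
  qed
  then have "prefix x j \<in> ball_words m A \<psi> n"
    using j prefix_admissible[OF x] unfolding ball_words_def i by (simp add: butlast_prefix)
  then show ?thesis using that j by blast
qed

definition counted :: "real ^ 'd \<Rightarrow> nat \<Rightarrow> real \<Rightarrow> nat list set" where
  "counted \<alpha> n \<epsilon> = {u \<in> ball_words m A \<psi> n.
     \<exists>x\<in>cylinder m A u. norm (\<Phi> (length u) x /\<^sub>R real (length u) - \<alpha>) < \<epsilon>}"

lemma ball_count_eq: "ball_count m A \<psi> \<Phi> \<alpha> n \<epsilon> = card (counted \<alpha> n \<epsilon>)"
  by (simp add: ball_count_def counted_def)

definition max_length :: "nat \<Rightarrow> nat" where
  "max_length n = nat \<lfloor>real n / decay\<rfloor> + 1"

lemma max_length_le: "real (max_length n) \<le> real n / decay + 1"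
  unfolding max_length_def using decay_pos by simp

lemma counted_words:
  assumes "1 \<le> n"
  shows "counted \<alpha> n \<epsilon> \<subseteq> {w. set w \<subseteq> {1..m} \<and> length w \<le> max_length n}"
proof
  fix u assume u: "u \<in> counted \<alpha> n \<epsilon>"
  then obtain x where x: "u \<in> ball_words m A \<psi> n" "x \<in> cylinder m A u" unfolding counted_def by blast
  have "real (length u) \<le> real n / decay + 1" by (rule ball_word_bounds(3)[OF x assms])
  then have "length u \<le> max_length n" unfolding max_length_def by linarith
  then show "u \<in> {w. set w \<subseteq> {1..m} \<and> length w \<le> max_length n}"
    using x(1) unfolding ball_words_def admissible_words_def by auto
qed

lemma finite_counted: "1 \<le> n \<Longrightarrow> finite (counted \<alpha> n \<epsilon>)"
  by (rule finite_subset[OF counted_words finite_lists_length_le]) auto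

lemma card_counted_le:
  assumes "1 \<le> n"
  shows "card (counted \<alpha> n \<epsilon>) \<le> (m + 1) ^ max_length n"
proof -
  have "card (counted \<alpha> n \<epsilon>) \<le> card {w. set w \<subseteq> {1..m} \<and> length w \<le> max_length n}"
    by (intro card_mono counted_words assms finite_lists_length_le) auto
  also have "\<dots> = (\<Sum>i\<le>max_length n. m ^ i)"
    using card_lists_length_le[of "{1..m}"] by simp
  also have "\<dots> \<le> (m + 1) ^ max_length n"
    by (rule sum_powers_le)
  finally show ?thesis .
qed

lemma growth_rate_eq:
  assumes "1 \<le> n" "counted \<alpha> n \<epsilon> \<noteq> {}"
  shows "growth_rate m A \<psi> \<Phi> \<alpha> \<epsilon> n = ereal (ln (real (card (counted \<alpha> n \<epsilon>))) / real n)"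
  using assms finite_counted[OF assms(1), of \<alpha> \<epsilon>]
  by (auto simp: growth_rate_def ball_count_eq log_count_def)

lemma growth_rate_empty:
  assumes "1 \<le> n" "counted \<alpha> n \<epsilon> = {}"
  shows "growth_rate m A \<psi> \<Phi> \<alpha> \<epsilon> n = - \<infinity>"
  using assms by (auto simp: growth_rate_def ball_count_eq log_count_def)

lemma growth_rate_le:
  assumes "1 \<le> n"
  shows "growth_rate m A \<psi> \<Phi> \<alpha> \<epsilon> n \<le> ereal ((1 / decay + 1) * ln (real m + 1))"
proof (cases "counted \<alpha> n \<epsilon> = {}")
  case True then show ?thesis using growth_rate_empty assms by simp
next
  case False
  have c: "0 < card (counted \<alpha> n \<epsilon>)" using False finite_counted[OF assms] by (simp add: card_gt_0_iff)
  have "ln (real (card (counted \<alpha> n \<epsilon>))) \<le> ln (real ((m + 1) ^ max_length n))"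
    using c card_counted_le[OF assms, of \<alpha> \<epsilon>] by (simp del: of_nat_power of_nat_add)
  also have "\<dots> = real (max_length n) * ln (real m + 1)"
    by (simp add: ln_realpow add.commute)
  also have "\<dots> \<le> (real n / decay + real n) * ln (real m + 1)"
    using max_length_le[of n] assms by (intro mult_right_mono) auto
  also have "\<dots> = real n * ((1 / decay + 1) * ln (real m + 1))" by (simp add: algebra_simps)
  finally have "ln (real (card (counted \<alpha> n \<epsilon>))) / real n \<le> (1 / decay + 1) * ln (real m + 1)"
    using assms by (simp add: field_simps)
  then show ?thesis by (simp only: growth_rate_eq[OF assms False] ereal_less_eq)
qed

end

lemma ln_affine_over_linear_tendsto:
  fixes c :: real
  assumes "0 < c"
  shows "(\<lambda>n. ln (real n / c + 2) / real n) \<longlonglongrightarrow> 0"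
  using assms by real_asymp

context almost_additive_pair
begin

section \<open>From growth rates to profiles\<close>

text \<open>
  The lengths of the ball words of level \<open>n\<close> lie between \<open>n / ratio_bound\<close> and \<open>n * ratio_bound\<close>.
  This becomes the constant of weak concavity.
\<close>

definition ratio_bound :: real where
  "ratio_bound = max bound (1 / decay + 1)"

lemma ratio_bound_ge_1: "1 \<le> ratio_bound"
  unfolding ratio_bound_def using decay_pos by (simp add: le_max_iff_disj)

lemma ball_word_ratio:
  assumes u: "u \<in> ball_words m A \<psi> n" and x: "x \<in> cylinder m A u" and n: "1 \<le> n"
  shows "inverse ratio_bound \<le> real (length u) / real n" "real (length u) / real n \<le> ratio_bound"
proof -
  have c: "0 < ratio_bound" using ratio_bound_ge_1 by simp
  have "real n \<le> bound * real (length u)" by (rule ball_word_bounds(2)[OF assms])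
  also have "\<dots> \<le> ratio_bound * real (length u)" unfolding ratio_bound_def by (intro mult_right_mono) auto
  finally show "inverse ratio_bound \<le> real (length u) / real n" using n c by (simp add: field_simps)
  have "real (length u) \<le> real n / decay + 1" by (rule ball_word_bounds(3)[OF assms])
  also have "\<dots> \<le> (1 / decay + 1) * real n" using n by (simp add: algebra_simps)
  also have "\<dots> \<le> ratio_bound * real n" unfolding ratio_bound_def by (intro mult_right_mono) auto
  finally show "real (length u) / real n \<le> ratio_bound" using n by (simp add: field_simps)
qed

text \<open>
  A ball word of level \<open>n\<close> has cost about \<open>n\<close>: the point \<open>y\<close> that witnesses the weight of the word
  without its last letter need not lie in the cylinder of the word itself, so the lower
  estimate loses the oscillation of \<open>\<psi>\<close> and the value on one letter.
\<close>

lemma ball_word_joint: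
  assumes u: "u \<in> ball_words m A \<psi> n" and x: "x \<in> cylinder m A u" and n: "1 \<le> n"
    and M: "\<And>l. variation_le l (M + e * real l)" "0 \<le> e"
    and av: "norm (\<Phi> (length u) x /\<^sub>R real (length u) - \<alpha>) < \<epsilon>"
  shows "norm (joint (length u) x - real n *\<^sub>R (real (length u) / real n, 1, (real (length u) / real n) *\<^sub>R \<alpha>))
    \<le> (M + bound + \<bar>C\<bar>) + (e + \<epsilon>) * ratio_bound * real n"
proof -
  let ?l = "length u"
  note B = ball_word_bounds[OF u x n]
  have xX: "x \<in> X" using x by (simp add: cylinder_def)
  have l: "?l = (?l - 1) + 1" using B(4) by simp
  obtain y where y: "y \<in> X" "agree (?l - 1) y x" "- real n < \<psi>\<^sub>0 (?l - 1) y" using B(5) by blast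
  have l_le: "real ?l \<le> ratio_bound * real n" using ball_word_ratio(2)[OF u x n] n by (simp add: field_simps)
  have "\<bar>\<psi>\<^sub>0 (?l - 1) y - \<psi>\<^sub>0 (?l - 1) x\<bar> \<le> M + e * real (?l - 1)"
    by (rule psi_variation[OF M(1) y(1) xX y(2)])
  moreover have "e * real (?l - 1) \<le> e * (ratio_bound * real n)"
    using l_le M(2) by (intro mult_left_mono) auto
  moreover have "\<bar>\<psi>\<^sub>0 ?l x - (\<psi>\<^sub>0 (?l - 1) x + \<psi>\<^sub>0 1 ((shift ^^ (?l - 1)) x))\<bar> \<le> \<bar>C\<bar>"
    using error_psi[OF xX, of "?l - 1" 1] l by simp
  moreover have "\<bar>\<psi>\<^sub>0 1 ((shift ^^ (?l - 1)) x)\<bar> \<le> bound"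
    using psi_bound[OF shift_in_subshift[OF xX], of 1] by simp
  ultimately have psi: "\<bar>- \<psi>\<^sub>0 ?l x - real n\<bar> \<le> M + bound + \<bar>C\<bar> + e * (ratio_bound * real n)"
    using y(3) B(1) by linarith
  have l0: "0 < real ?l" using B(4) by simp
  have "\<Phi>\<^sub>0 ?l x - real ?l *\<^sub>R \<alpha> = real ?l *\<^sub>R (\<Phi> ?l x /\<^sub>R real ?l - \<alpha>)"
    using B(4) by (simp add: \<Phi>\<^sub>0_def algebra_simps)
  then have "norm (\<Phi>\<^sub>0 ?l x - real ?l *\<^sub>R \<alpha>) = real ?l * norm (\<Phi> ?l x /\<^sub>R real ?l - \<alpha>)" by simp
  also have "\<dots> \<le> (ratio_bound * real n) * \<epsilon>"
    using l_le av l0 by (intro mult_mono) auto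
  finally have phi: "norm (\<Phi>\<^sub>0 ?l x - real ?l *\<^sub>R \<alpha>) \<le> \<epsilon> * (ratio_bound * real n)" by (simp add: mult.commute)
  have eq: "joint ?l x - real n *\<^sub>R (real ?l / real n, 1, (real ?l / real n) *\<^sub>R \<alpha>)
      = (0, - \<psi>\<^sub>0 ?l x - real n, \<Phi>\<^sub>0 ?l x - real ?l *\<^sub>R \<alpha>)"
    using n by (simp add: joint_def)
  have "norm (0 :: real, - \<psi>\<^sub>0 ?l x - real n, \<Phi>\<^sub>0 ?l x - real ?l *\<^sub>R \<alpha>)
      \<le> norm (0 :: real) + norm (- \<psi>\<^sub>0 ?l x - real n, \<Phi>\<^sub>0 ?l x - real ?l *\<^sub>R \<alpha>)" by (rule norm_Pair_le)
  moreover have "norm (- \<psi>\<^sub>0 ?l x - real n, \<Phi>\<^sub>0 ?l x - real ?l *\<^sub>R \<alpha>)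
      \<le> norm (- \<psi>\<^sub>0 ?l x - real n) + norm (\<Phi>\<^sub>0 ?l x - real ?l *\<^sub>R \<alpha>)" by (rule norm_Pair_le)
  ultimately show ?thesis
    using psi phi unfolding eq by (simp add: algebra_simps)
qed

text \<open>
  Concatenation needs blocks of a common length. There are only linearly many lengths, so
  keeping the most frequent one loses a logarithmic term.
\<close>

lemma pigeonhole_length:
  assumes n: "1 \<le> n" and ne: "counted \<alpha> n \<epsilon> \<noteq> {}"
  obtains l where "{u \<in> counted \<alpha> n \<epsilon>. length u = l} \<noteq> {}"
    "ln (real (card (counted \<alpha> n \<epsilon>))) - ln (real n / decay + 2)
       \<le> ln (real (card {u \<in> counted \<alpha> n \<epsilon>. length u = l}))"
proof -
  let ?S = "counted \<alpha> n \<epsilon>"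
  have fin: "finite ?S" by (rule finite_counted[OF n])
  have un: "?S = (\<Union>l\<le>max_length n. {u \<in> ?S. length u = l})"
    using counted_words[OF n, of \<alpha> \<epsilon>] by fastforce
  let ?f = "\<lambda>l. card {u \<in> ?S. length u = l}"
  have "card ?S = card (\<Union>l\<le>max_length n. {u \<in> ?S. length u = l})"
    by (rule arg_cong[OF un])
  also have "\<dots> \<le> sum ?f {..max_length n}"
    by (rule card_UN_le) simp
  finally have sum: "card ?S \<le> sum ?f {..max_length n}" .
  have "Max (?f ` {..max_length n}) \<in> ?f ` {..max_length n}" by (rule Max_in) auto
  then obtain l where "Max (?f ` {..max_length n}) = ?f l" by blast
  then have l: "?f k \<le> ?f l" if "k \<in> {..max_length n}" for k
    using Max_ge[of "?f ` {..max_length n}" "?f k"] that by simp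
  have "card ?S \<le> (\<Sum>k\<le>max_length n. card {u \<in> ?S. length u = l})"
    using sum by (rule order_trans) (intro sum_mono l)
  then have le: "card ?S \<le> (max_length n + 1) * card {u \<in> ?S. length u = l}" by simp
  have S0: "0 < card ?S" using ne fin by (simp add: card_gt_0_iff)
  then have l0: "0 < card {u \<in> ?S. length u = l}" using le by (cases "card {u \<in> ?S. length u = l}") auto
  have "ln (real (card ?S)) \<le> ln (real (max_length n + 1) * real (card {u \<in> ?S. length u = l}))"
    using le S0 l0 by (subst ln_le_cancel_iff) (auto simp flip: of_nat_mult simp del: of_nat_add of_nat_Suc)
  also have "\<dots> = ln (real (max_length n + 1)) + ln (real (card {u \<in> ?S. length u = l}))"
    by (subst ln_mult) (use l0 in auto)
  also have "ln (real (max_length n + 1)) \<le> ln (real n / decay + 2)"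
    using max_length_le[of n] decay_pos by (subst ln_le_cancel_iff) (auto intro: add_nonneg_pos)
  finally show ?thesis using that[of l] l0 by fastforce
qed

lemma block_family_of_counted:
  assumes n: "1 \<le> n" and ne: "counted \<alpha> n \<epsilon> \<noteq> {}"
    and M: "\<And>l. variation_le l (M + e * real l)" "0 \<le> e"
  obtains l P where "inverse ratio_bound \<le> real l / real n" "real l / real n \<le> ratio_bound"
    "block_family (real n *\<^sub>R (real l / real n, 1, (real l / real n) *\<^sub>R \<alpha>))
       ((M + bound + \<bar>C\<bar>) + (e + \<epsilon>) * ratio_bound * real n)
       (ln (real (card (counted \<alpha> n \<epsilon>))) - ln (real n / decay + 2)) l P"
proof -
  obtain l where l: "{u \<in> counted \<alpha> n \<epsilon>. length u = l} \<noteq> {}"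
    "ln (real (card (counted \<alpha> n \<epsilon>))) - ln (real n / decay + 2)
       \<le> ln (real (card {u \<in> counted \<alpha> n \<epsilon>. length u = l}))"
    by (rule pigeonhole_length[OF n ne])
  let ?S = "{u \<in> counted \<alpha> n \<epsilon>. length u = l}"
  have "\<forall>u\<in>?S. \<exists>x. x \<in> cylinder m A u \<and> norm (\<Phi> (length u) x /\<^sub>R real (length u) - \<alpha>) < \<epsilon>"
    unfolding counted_def by auto
  from bchoice[OF this] obtain x where x: "\<And>u. u \<in> ?S \<Longrightarrow> x u \<in> cylinder m A u"
    "\<And>u. u \<in> ?S \<Longrightarrow> norm (\<Phi> (length u) (x u) /\<^sub>R real (length u) - \<alpha>) < \<epsilon>"
    by (auto simp only: Ball_def)
  have ball: "u \<in> ball_words m A \<psi> n" if "u \<in> ?S" for u using that unfolding counted_def by auto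
  have pre: "prefix (x u) l = u" if "u \<in> ?S" for u using x(1)[OF that] that by (auto simp: cylinder_eq)
  then have inj: "inj_on x ?S" by (metis (no_types, lifting) inj_onI)
  have "block_family (real n *\<^sub>R (real l / real n, 1, (real l / real n) *\<^sub>R \<alpha>))
       ((M + bound + \<bar>C\<bar>) + (e + \<epsilon>) * ratio_bound * real n)
       (ln (real (card (counted \<alpha> n \<epsilon>))) - ln (real n / decay + 2)) l (x ` ?S)"
    unfolding block_family_def
  proof (intro conjI)
    show "finite (x ` ?S)" using finite_counted[OF n] by simp
    show "x ` ?S \<subseteq> X" using x(1) by (auto simp: cylinder_def)
    show "x ` ?S \<noteq> {}" using l(1) by simp
    show "\<forall>y\<in>x ` ?S. \<forall>z\<in>x ` ?S. agree l y z \<longrightarrow> y = z"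
    proof (intro ballI impI)
      fix y z assume "y \<in> x ` ?S" "z \<in> x ` ?S" and yz: "agree l y z"
      then obtain u v where uv: "u \<in> ?S" "v \<in> ?S" "y = x u" "z = x v" by blast
      have "prefix (x u) l = prefix (x v) l" using yz uv by (simp add: prefix_eq_iff_agree)
      then show "y = z" using pre[OF uv(1)] pre[OF uv(2)] uv by simp
    qed
    show "\<forall>y\<in>x ` ?S. norm (joint l y - real n *\<^sub>R (real l / real n, 1, (real l / real n) *\<^sub>R \<alpha>))
        \<le> (M + bound + \<bar>C\<bar>) + (e + \<epsilon>) * ratio_bound * real n"
    proof
      fix y assume "y \<in> x ` ?S"
      then obtain u where u: "u \<in> ?S" "y = x u" by blast
      have "length u = l" using u(1) by simp
      then show "norm (joint l y - real n *\<^sub>R (real l / real n, 1, (real l / real n) *\<^sub>R \<alpha>))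
          \<le> (M + bound + \<bar>C\<bar>) + (e + \<epsilon>) * ratio_bound * real n"
        using ball_word_joint[OF ball[OF u(1)] x(1)[OF u(1)] n M x(2)[OF u(1)]] u(2) by simp
    qed
    show "ln (real (card (counted \<alpha> n \<epsilon>))) - ln (real n / decay + 2) \<le> ln (real (card (x ` ?S)))"
      using l(2) by (simp add: card_image[OF inj])
  qed
  moreover obtain u where u: "u \<in> ?S" using l(1) by blast
  ultimately show ?thesis
    using that[of l] ball_word_ratio[OF ball[OF u] x(1)[OF u] n] by simp
qed

text \<open>
  One sufficiently large level \<open>n\<close> at which the count almost attains its upper growth rate suffices:
  dividing the family obtained there by \<open>n\<close> makes all bounded and sublinear errors small. The number
  \<open>\<rho>\<close> is the length of the chosen ball words divided by their level \<open>n\<close>, which is nearly their cost.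
\<close>

lemma profile_of_limsup_approx:
  assumes h: "\<And>\<epsilon>. 0 < \<epsilon> \<Longrightarrow> ereal h \<le> limsup (growth_rate m A \<psi> \<Phi> \<alpha> \<epsilon>)" and d: "0 < d"
  obtains \<rho> where "inverse ratio_bound \<le> \<rho>" "\<rho> \<le> ratio_bound" "((\<rho>, 1, \<rho> *\<^sub>R \<alpha>), h) \<in> profiles d"
proof -
  define e where "e = d / (6 * ratio_bound)"
  have e: "0 < e" "e * ratio_bound = d / 6" and ed: "e \<le> d / 6"
    using d ratio_bound_ge_1 unfolding e_def by (auto simp: field_simps)
  obtain M where M: "0 \<le> M" "\<And>n. variation_le n (M + e * real n)"
    by (rule sublinear_variation[OF e(1)]) blast
  define K where "K = 2 * M + bound + \<bar>C\<bar> + gap_error"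
  have "\<forall>\<^sub>F n in sequentially. K / real n < d / 6"
    using d by (intro order_tendstoD(2)[OF lim_const_over_n]) auto
  moreover have "\<forall>\<^sub>F n in sequentially. ln (real n / decay + 2) / real n < d / 6"
  proof (rule order_tendstoD(2))
    show "(\<lambda>n. ln (real n / decay + 2) / real n) \<longlonglongrightarrow> 0"
      by (rule ln_affine_over_linear_tendsto[OF decay_pos])
  qed (use d in simp)
  moreover have "\<forall>\<^sub>F n in sequentially. 1 \<le> n" by (rule eventually_ge_at_top)
  ultimately have ev: "\<forall>\<^sub>F n in sequentially. K / real n < d / 6 \<and> ln (real n / decay + 2) / real n < d / 6 \<and> 1 \<le> n"
    by eventually_elim auto
  have "\<exists>\<^sub>F n in sequentially. ereal (h - d / 6) < growth_rate m A \<psi> \<Phi> \<alpha> e n"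
  proof (rule ccontr)
    assume "\<not> ?thesis"
    then have "\<forall>\<^sub>F n in sequentially. growth_rate m A \<psi> \<Phi> \<alpha> e n \<le> ereal (h - d / 6)"
      by (simp add: not_frequently not_less)
    then have "limsup (growth_rate m A \<psi> \<Phi> \<alpha> e) \<le> ereal (h - d / 6)" by (rule Limsup_bounded)
    with h[OF e(1)] have "ereal h \<le> ereal (h - d / 6)" by (rule order_trans)
    then show False using d by simp
  qed
  from frequently_eventually_frequently[OF this ev] obtain n where
    n: "1 \<le> n" "K / real n < d / 6" "ln (real n / decay + 2) / real n < d / 6"
    and gr: "ereal (h - d / 6) < growth_rate m A \<psi> \<Phi> \<alpha> e n"
    using frequently_ex by blast
  have ne: "counted \<alpha> n e \<noteq> {}" using gr growth_rate_empty[OF n(1)] by fastforce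
  have gr': "h - d / 6 < ln (real (card (counted \<alpha> n e))) / real n"
    using gr growth_rate_eq[OF n(1) ne] by simp
  obtain l P where l: "inverse ratio_bound \<le> real l / real n" "real l / real n \<le> ratio_bound"
    and P: "block_family (real n *\<^sub>R (real l / real n, 1, (real l / real n) *\<^sub>R \<alpha>))
       ((M + bound + \<bar>C\<bar>) + (e + e) * ratio_bound * real n)
       (ln (real (card (counted \<alpha> n e))) - ln (real n / decay + 2)) l P"
    using block_family_of_counted[OF n(1) ne M(2) less_imp_le[OF e(1)]] by blast
  have n0: "0 < real n" using n(1) by simp
  let ?t = "(real l / real n, 1 :: real, (real l / real n) *\<^sub>R \<alpha>)"
  let ?h = "inverse (real n) * (ln (real (card (counted \<alpha> n e))) - ln (real n / decay + 2))"
  let ?e = "inverse (real n) * ((M + bound + \<bar>C\<bar>) + (e + e) * ratio_bound * real n + (M + e * real l) + gap_error)"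
  have "(inverse (real n) *\<^sub>R (real n *\<^sub>R ?t), ?h) \<in> profiles ?e"
    using profiles_of_block_family[OF P M(2)] by (rule profiles_scale) (use n0 in simp)
  moreover have "inverse (real n) *\<^sub>R (real n *\<^sub>R ?t) = ?t"
    by (subst scaleR_scaleR) (use n0 in simp)
  ultimately have "(?t, ?h) \<in> profiles ?e"
    by (simp only:)
  moreover have "h - d / 3 \<le> ?h"
    using gr' n(3) n0 by (simp add: field_simps)
  ultimately have "(?t, h) \<in> profiles (?e + d / 3)"
    using d by (intro profiles_perturb) auto
  moreover have "?e + d / 3 \<le> d"
  proof -
    have "real l \<le> ratio_bound * real n" using l(2) n0 by (simp add: field_simps)
    then have "e * real l \<le> e * (ratio_bound * real n)" using e(1) by (intro mult_left_mono) auto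
    then have "?e \<le> inverse (real n) * (K + 3 * (e * ratio_bound) * real n)"
      using n0 unfolding K_def by (intro mult_left_mono) (auto simp: algebra_simps)
    also have "\<dots> = K / real n + d / 2" using n0 e(2) by (simp add: field_simps)
    finally show ?thesis using n(2) by linarith
  qed
  ultimately have "(?t, h) \<in> profiles d"
    using profiles_perturb[of ?t h "?e + d / 3" ?t "d - (?e + d / 3)" h] by simp
  then show ?thesis using that l by blast
qed

text \<open>The ratio \<open>\<rho>\<close> ranges over a compact interval, so the approximate profiles accumulate at an exact one.\<close>

lemma profile_of_limsup:
  assumes h: "\<And>\<epsilon>. 0 < \<epsilon> \<Longrightarrow> ereal h \<le> limsup (growth_rate m A \<psi> \<Phi> \<alpha> \<epsilon>)"
  obtains \<rho> where "inverse ratio_bound \<le> \<rho>" "\<rho> \<le> ratio_bound" "((\<rho>, 1, \<rho> *\<^sub>R \<alpha>), h) \<in> profiles 0"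
proof -
  have "\<exists>\<rho>\<in>{inverse ratio_bound..ratio_bound}. ((\<rho>, 1, \<rho> *\<^sub>R \<alpha>), h) \<in> profiles (inverse (real (Suc k)))" for k
    using profile_of_limsup_approx[OF h, of "inverse (real (Suc k))"] by (metis atLeastAtMost_iff inverse_positive_iff_positive of_nat_0_less_iff zero_less_Suc)
  then obtain r where r: "\<And>k. r k \<in> {inverse ratio_bound..ratio_bound}"
    "\<And>k. ((r k, 1, r k *\<^sub>R \<alpha>), h) \<in> profiles (inverse (real (Suc k)))" by metis
  have "\<forall>k. r k \<in> {inverse ratio_bound..ratio_bound}" using r(1) by blast
  then obtain \<rho> s where \<rho>: "\<rho> \<in> {inverse ratio_bound..ratio_bound}" "strict_mono s" "(r \<circ> s) \<longlonglongrightarrow> \<rho>"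
    by (rule seq_compactE[OF compact_imp_seq_compact[OF compact_Icc]])
  have "((\<rho>, 1, \<rho> *\<^sub>R \<alpha>), h) \<in> profiles 0"
  proof (rule profiles_limit)
    fix d :: real assume d: "0 < d"
    have "(\<lambda>k. (r (s k), 1 :: real, r (s k) *\<^sub>R \<alpha>)) \<longlonglongrightarrow> (\<rho>, 1, \<rho> *\<^sub>R \<alpha>)"
      using \<rho>(3) by (intro tendsto_intros) (simp_all add: o_def)
    then have "\<forall>\<^sub>F k in sequentially. dist (r (s k), 1 :: real, r (s k) *\<^sub>R \<alpha>) (\<rho>, 1, \<rho> *\<^sub>R \<alpha>) < d / 2"
      using d by (intro tendstoD) auto
    moreover have "\<forall>\<^sub>F k in sequentially. inverse (real (Suc k)) < d / 2"
      using d by (intro order_tendstoD(2)[OF LIMSEQ_inverse_real_of_nat]) auto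
    ultimately have "\<forall>\<^sub>F k in sequentially. dist (r (s k), 1 :: real, r (s k) *\<^sub>R \<alpha>) (\<rho>, 1, \<rho> *\<^sub>R \<alpha>) < d / 2 \<and>
        inverse (real (Suc k)) < d / 2" by (rule eventually_conj)
    from eventually_happens'[OF sequentially_bot this] obtain k where k: "dist (r (s k), 1 :: real, r (s k) *\<^sub>R \<alpha>) (\<rho>, 1, \<rho> *\<^sub>R \<alpha>) < d / 2"
      "inverse (real (Suc k)) < d / 2"
      by blast
    have "real (Suc k) \<le> real (Suc (s k))" using seq_suble[OF \<rho>(2), of k] by simp
    then have "inverse (real (Suc (s k))) \<le> inverse (real (Suc k))" by (intro le_imp_inverse_le) auto
    then have "inverse (real (Suc (s k))) < d / 2" using k(2) by linarith
    moreover have "norm ((\<rho>, 1, \<rho> *\<^sub>R \<alpha>) - (r (s k), 1 :: real, r (s k) *\<^sub>R \<alpha>)) < d / 2"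
      using k(1) unfolding dist_norm[symmetric] by (simp only: dist_commute)
    moreover from calculation have "norm ((\<rho>, 1, \<rho> *\<^sub>R \<alpha>) - (r (s k), 1 :: real, r (s k) *\<^sub>R \<alpha>)) \<le> d - inverse (real (Suc (s k)))"
      by linarith
    ultimately show "((\<rho>, 1, \<rho> *\<^sub>R \<alpha>), h) \<in> profiles (0 + d)"
      using profiles_perturb[OF r(2)[of "s k"], of "(\<rho>, 1, \<rho> *\<^sub>R \<alpha>)" "d - inverse (real (Suc (s k)))" h] d
      by simp
  qed
  then show ?thesis using that[of \<rho>] \<rho>(1) by simp
qed

end

context almost_additive_pair
begin

section \<open>From profiles to growth rates\<close>

lemma joint_components:
  assumes "norm (joint l x - K *\<^sub>R (s, 1, v)) \<le> e"
  shows "\<bar>real l - K * s\<bar> \<le> e" "\<bar>- \<psi>\<^sub>0 l x - K\<bar> \<le> e" "norm (\<Phi>\<^sub>0 l x - K *\<^sub>R v) \<le> e"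
proof -
  have eq: "joint l x - K *\<^sub>R (s, 1, v) = (real l - K * s, - \<psi>\<^sub>0 l x - K, \<Phi>\<^sub>0 l x - K *\<^sub>R v)"
    by (simp add: joint_def)
  let ?p = "(- \<psi>\<^sub>0 l x - K, \<Phi>\<^sub>0 l x - K *\<^sub>R v)"
  have le: "norm (real l - K * s, ?p) \<le> e" using assms unfolding eq .
  have "norm ?p \<le> e" using norm_snd_le[of ?p] le by (rule order_trans)
  then show "\<bar>- \<psi>\<^sub>0 l x - K\<bar> \<le> e" "norm (\<Phi>\<^sub>0 l x - K *\<^sub>R v) \<le> e"
    using norm_fst_le[of "- \<psi>\<^sub>0 l x - K" "\<Phi>\<^sub>0 l x - K *\<^sub>R v"]
      norm_snd_le[of "\<Phi>\<^sub>0 l x - K *\<^sub>R v" "- \<psi>\<^sub>0 l x - K"] by auto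
  show "\<bar>real l - K * s\<bar> \<le> e"
    using norm_fst_le[of "real l - K * s" ?p] le by simp
qed

text \<open>
  If a block of length \<open>l\<close> has cost close to \<open>n\<close>, then the ball word of level \<open>n\<close> extending it is not
  much longer, because every further letter costs at least \<open>decay\<close>.
\<close>

lemma ball_word_extension_length:
  assumes x: "x \<in> X" and j: "l < j" "prefix x j \<in> ball_words m A \<psi> n" and n: "1 \<le> n"
    and M: "\<And>l. variation_le l (M + e * real l)" "0 \<le> e"
  shows "decay * real (j - l) \<le> real n + \<psi>\<^sub>0 l x + M + e * real n / decay + decay"
proof -
  have "x \<in> cylinder m A (prefix x j)" using x by (simp add: cylinder_prefix agree_refl)
  from ball_word_bounds(5)[OF j(2) this n] obtain y where
    y: "y \<in> X" "agree (j - 1) y x" "- real n < \<psi>\<^sub>0 (j - 1) y" by auto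
  have "decay * real (j - 1) < real n" using psi_le[OF y(1), of "j - 1"] y(3) by simp
  then have "real (j - 1) \<le> real n / decay" using decay_pos by (simp add: field_simps)
  then have "e * real (j - 1) \<le> e * (real n / decay)" using M(2) by (rule mult_left_mono)
  moreover have "\<bar>\<psi>\<^sub>0 (j - 1) y - \<psi>\<^sub>0 (j - 1) x\<bar> \<le> M + e * real (j - 1)"
    by (rule psi_variation[OF M(1) y(1) x y(2)])
  moreover have "\<psi>\<^sub>0 (l + (j - 1 - l)) x \<le> \<psi>\<^sub>0 l x - decay * real (j - 1 - l)"
    by (rule psi_decay[OF x])
  moreover have "l + (j - 1 - l) = j - 1" "real (j - l) = real (j - 1 - l) + 1" using j(1) by auto
  ultimately show ?thesis using y(3) by (simp add: algebra_simps)
qed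

lemma average_of_extension:
  assumes x: "x \<in> X" and j: "l < j"
  shows "norm (\<Phi>\<^sub>0 j x - real j *\<^sub>R \<alpha>)
    \<le> norm (\<Phi>\<^sub>0 l x - real l *\<^sub>R \<alpha>) + real (j - l) * (bound + norm \<alpha>) + error"
proof -
  let ?y = "(shift ^^ l) x"
  have 1: "\<Phi>\<^sub>0 (l + (j - l)) x = \<Phi>\<^sub>0 j x" using j by simp
  have "real j = real l + real (j - l)" using j by simp
  then have 2: "real j *\<^sub>R \<alpha> = real l *\<^sub>R \<alpha> + real (j - l) *\<^sub>R \<alpha>"
    by (simp only: scaleR_left_distrib)
  define a where "a = \<Phi>\<^sub>0 (l + (j - l)) x - (\<Phi>\<^sub>0 l x + \<Phi>\<^sub>0 (j - l) ?y)"
  define b where "b = \<Phi>\<^sub>0 l x - real l *\<^sub>R \<alpha>"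
  define c where "c = \<Phi>\<^sub>0 (j - l) ?y - real (j - l) *\<^sub>R \<alpha>"
  have "\<Phi>\<^sub>0 j x - real j *\<^sub>R \<alpha> = a + b + c"
    unfolding a_def b_def c_def 1 2 by simp
  then have "norm (\<Phi>\<^sub>0 j x - real j *\<^sub>R \<alpha>) \<le> norm a + norm b + norm c"
    using norm_triangle_ineq[of "a + b" c] norm_triangle_ineq[of a b] by simp
  moreover have "norm a \<le> error"
    using error_phi[OF x, of l "j - l"] unfolding error_def a_def by simp
  moreover have "norm c \<le> norm (\<Phi>\<^sub>0 (j - l) ?y) + norm (real (j - l) *\<^sub>R \<alpha>)"
    unfolding c_def by (rule norm_triangle_ineq4)
  moreover have "norm (\<Phi>\<^sub>0 (j - l) ?y) \<le> bound * real (j - l)"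
    by (rule phi_bound[OF shift_in_subshift[OF x]])
  moreover have "norm (real (j - l) *\<^sub>R \<alpha>) = real (j - l) * norm \<alpha>" by simp
  moreover have "real (j - l) * (bound + norm \<alpha>) = bound * real (j - l) + real (j - l) * norm \<alpha>"
    by (simp only: distrib_left mult.commute)
  ultimately show ?thesis unfolding b_def by linarith
qed

text \<open>
  The scale \<open>K = (1 - 2 \<eta>) n\<close> is chosen so that every sequence of the family still has cost below
  \<open>n\<close> after its block: the block is a proper prefix of a ball word of level \<open>n\<close>, and different
  blocks give different ball words. The leftover part has length of order \<open>\<eta> n\<close> and does not
  spoil the average.
\<close>

lemma counted_of_block_family:
  fixes \<eta> :: real
  assumes P: "block_family (K *\<^sub>R (s, 1, s *\<^sub>R \<alpha>)) (\<eta> * K) h l P"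
    and K: "K = (1 - 2 * \<eta>) * real n" and \<eta>: "0 < \<eta>" "\<eta> \<le> 1 / 4" "\<eta> \<le> s / 2" and n: "1 \<le> n"
    and M: "\<And>l. variation_le l (M + \<eta> * decay * real l)" "0 \<le> M"
    and large: "M + decay + error \<le> \<eta> * real n"
    and small: "4 / s * (\<eta> * ((1 + norm \<alpha>) + 5 * (bound + norm \<alpha>) / decay + 1)) < \<epsilon>"
  shows "card P \<le> card (counted \<alpha> n \<epsilon>)"
proof -
  have "0 \<le> 2 * \<eta> * real n" using \<eta>(1) by simp
  then have K0: "K \<le> real n" unfolding K by (simp add: left_diff_distrib)
  have K0': "0 \<le> K" unfolding K using \<eta>(2) by simp
  have PX: "P \<subseteq> X" using P unfolding block_family_def by auto
  have est: "\<bar>real l - K * s\<bar> \<le> \<eta> * K" "\<bar>- \<psi>\<^sub>0 l x - K\<bar> \<le> \<eta> * K"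
    "norm (\<Phi>\<^sub>0 l x - K *\<^sub>R s *\<^sub>R \<alpha>) \<le> \<eta> * K" if "x \<in> P" for x
    using joint_components[of l x K s "s *\<^sub>R \<alpha>" "\<eta> * K"] P that unfolding block_family_def by auto
  have ext: "\<exists>j. l < j \<and> prefix x j \<in> ball_words m A \<psi> n" if "x \<in> P" for x
  proof -
    have "- \<psi>\<^sub>0 l x \<le> (1 + \<eta>) * K" using est(2)[OF that] by (simp add: algebra_simps)
    also have "\<dots> = real n - \<eta> * real n - 2 * \<eta> * \<eta> * real n" unfolding K by (simp add: algebra_simps)
    also have "\<dots> < real n"
    proof -
      have "0 < \<eta> * real n" "0 \<le> 2 * \<eta> * \<eta> * real n" using \<eta>(1) n by simp_all
      then show ?thesis by linarith
    qed
    finally have "- real n < \<psi>\<^sub>0 l x" by simp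
    from ball_word_extending[OF _ this] show ?thesis using that PX by blast
  qed
  define j where "j x = (SOME j. l < j \<and> prefix x j \<in> ball_words m A \<psi> n)" for x
  have j: "l < j x" "prefix x (j x) \<in> ball_words m A \<psi> n" if "x \<in> P" for x
    using someI_ex[OF ext[OF that]] unfolding j_def by auto
  have "prefix x (j x) \<in> counted \<alpha> n \<epsilon>" if x: "x \<in> P" for x
  proof -
    have xX: "x \<in> X" using x PX by blast
    have s_pos: "0 < s" using \<eta> by simp
    have e0: "0 \<le> \<eta> * decay" using \<eta>(1) decay_pos by simp
    have "decay * real (j x - l) \<le> real n + \<psi>\<^sub>0 l x + M + \<eta> * decay * real n / decay + decay"
      by (rule ball_word_extension_length[OF xX j(1)[OF x] j(2)[OF x] n M(1) e0])
    also have "\<dots> \<le> real n - (1 - \<eta>) * K + M + \<eta> * real n + decay"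
      using est(2)[OF x] decay_pos by (simp add: algebra_simps)
    also have "\<dots> = 4 * \<eta> * real n - 2 * \<eta> * \<eta> * real n + M + decay"
      unfolding K by (simp add: algebra_simps)
    also have "\<dots> \<le> 4 * \<eta> * real n + \<eta> * real n"
    proof -
      have "0 \<le> 2 * \<eta> * \<eta> * real n" using \<eta> by simp
      then show ?thesis using large D_nonneg by linarith
    qed
    finally have jl: "real (j x - l) \<le> 5 * \<eta> * real n / decay"
      using decay_pos by (simp add: field_simps)
    have "norm (\<Phi>\<^sub>0 l x - real l *\<^sub>R \<alpha>) \<le> norm (\<Phi>\<^sub>0 l x - K *\<^sub>R s *\<^sub>R \<alpha>) + norm ((K * s - real l) *\<^sub>R \<alpha>)"
      using norm_triangle_ineq[of "\<Phi>\<^sub>0 l x - K *\<^sub>R s *\<^sub>R \<alpha>" "(K * s - real l) *\<^sub>R \<alpha>"]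
      by (simp add: algebra_simps)
    also have "\<dots> \<le> \<eta> * K + \<eta> * K * norm \<alpha>"
      using est(1)[OF x] by (intro add_mono est(3)[OF x]) (auto simp: abs_minus_commute intro: mult_right_mono)
    also have "\<dots> = K * (\<eta> * (1 + norm \<alpha>))" by (simp add: algebra_simps)
    also have "\<dots> \<le> real n * (\<eta> * (1 + norm \<alpha>))" using K0 \<eta> by (intro mult_right_mono) auto
    finally have 1: "norm (\<Phi>\<^sub>0 l x - real l *\<^sub>R \<alpha>) \<le> real n * (\<eta> * (1 + norm \<alpha>))" .
    have 2: "real (j x - l) * (bound + norm \<alpha>) \<le> 5 * \<eta> * real n / decay * (bound + norm \<alpha>)"
      using jl bound_nonneg by (intro mult_right_mono) auto
    have 3: "error \<le> \<eta> * real n" using large M(2) decay_pos by linarith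
    have "norm (\<Phi>\<^sub>0 (j x) x - real (j x) *\<^sub>R \<alpha>)
        \<le> real n * (\<eta> * ((1 + norm \<alpha>) + 5 * (bound + norm \<alpha>) / decay + 1))"
      using average_of_extension[OF xX j(1)[OF x], of \<alpha>] 1 2 3 by (simp add: algebra_simps)
    also have "\<dots> < real n * (\<epsilon> * s / 4)"
      using small n s_pos by (intro mult_strict_left_mono) (auto simp: field_simps)
    also have "\<dots> = real n * (s / 4) * \<epsilon>" by simp
    also have "\<dots> \<le> real (j x) * \<epsilon>"
    proof (rule mult_right_mono)
      have "real n * (s / 4) = (real n / 2) * (s / 2)" by simp
      also have "\<dots> \<le> K * (s - \<eta>)"
      proof (intro mult_mono)
        have "2 * \<eta> * real n \<le> 1 / 2 * real n" using \<eta>(2) by (intro mult_right_mono) auto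
        then show "real n / 2 \<le> K" unfolding K by (simp add: algebra_simps)
      qed (use \<eta> K0' s_pos in auto)
      also have "\<dots> \<le> real l" using est(1)[OF x] by (simp add: algebra_simps)
      also have "\<dots> \<le> real (j x)" using j(1)[OF x] by simp
      finally show "real n * (s / 4) \<le> real (j x)" .
      have "0 \<le> 4 / s * (\<eta> * ((1 + norm \<alpha>) + 5 * (bound + norm \<alpha>) / decay + 1))"
        using \<eta> s_pos decay_pos bound_nonneg by (intro mult_nonneg_nonneg add_nonneg_nonneg divide_nonneg_nonneg) auto
      then show "0 \<le> \<epsilon>" using small by simp
    qed
    finally have "norm (\<Phi>\<^sub>0 (j x) x - real (j x) *\<^sub>R \<alpha>) < real (j x) * \<epsilon>" .
    moreover have j0: "0 < real (j x)" "j x \<noteq> 0" using j(1)[OF x] by auto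
    moreover have "\<Phi>\<^sub>0 (j x) x - real (j x) *\<^sub>R \<alpha> = real (j x) *\<^sub>R (\<Phi> (j x) x /\<^sub>R real (j x) - \<alpha>)"
      using j0 by (simp add: \<Phi>\<^sub>0_def algebra_simps)
    ultimately have "norm (\<Phi> (j x) x /\<^sub>R real (j x) - \<alpha>) < \<epsilon>" by simp
    moreover have "x \<in> cylinder m A (prefix x (j x))" using xX by (simp add: cylinder_prefix agree_refl)
    ultimately show ?thesis unfolding counted_def using j(2)[OF x] by force
  qed
  moreover have "inj_on (\<lambda>x. prefix x (j x)) P"
  proof (rule inj_onI)
    fix x y assume xy: "x \<in> P" "y \<in> P" "prefix x (j x) = prefix y (j y)"
    then have "j x = j y" by (metis length_prefix)
    then have "agree (j x) x y" using xy(3) by (simp add: prefix_eq_iff_agree)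
    then have "agree l x y" using j(1)[OF xy(1)] by (auto intro: agree_mono)
    then show "x = y" using P xy unfolding block_family_def by blast
  qed
  ultimately show ?thesis
    by (intro card_inj_on_le[of "\<lambda>x. prefix x (j x)"] finite_counted n) auto
qed

text \<open>
  A profile is realized at all large scales, hence at every large level \<open>n\<close>: this is why it bounds
  the lower growth rate, whereas the upper growth rate was enough to produce one.
\<close>

lemma liminf_of_profile:
  assumes p: "((s, 1, s *\<^sub>R \<alpha>), h) \<in> profiles 0" and s_pos: "0 < s" and \<epsilon>: "0 < \<epsilon>"
  shows "ereal h \<le> liminf (growth_rate m A \<psi> \<Phi> \<alpha> \<epsilon>)"
proof -
  have "ereal (h - d) \<le> liminf (growth_rate m A \<psi> \<Phi> \<alpha> \<epsilon>)" if d: "0 < d" for d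
  proof -
    define Q where "Q = (1 + norm \<alpha>) + 5 * (bound + norm \<alpha>) / decay + 1"
    have Q: "0 < Q" unfolding Q_def using decay_pos bound_nonneg by (intro add_nonneg_pos add_nonneg_nonneg divide_nonneg_nonneg) auto
    \<comment> \<open>The four bounds on \<open>\<eta>\<close>: the first two keep the scale and the length comparable to \<open>n\<close>, the
      third limits the loss in \<open>h\<close>, the fourth the deviation of the average.\<close>
    define \<eta> where "\<eta> = min (min (1 / 4) (s / 2)) (min (d / (1 + 2 * \<bar>h\<bar>)) (\<epsilon> * s / (8 * Q)))"
    have \<eta>: "0 < \<eta>" "\<eta> \<le> 1 / 4" "\<eta> \<le> s / 2" "\<eta> \<le> d / (1 + 2 * \<bar>h\<bar>)" "\<eta> \<le> \<epsilon> * s / (8 * Q)"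
    proof -
      show "0 < \<eta>" unfolding \<eta>_def using d \<epsilon> s_pos Q by (auto simp: add_pos_nonneg)
      show "\<eta> \<le> 1 / 4" "\<eta> \<le> s / 2"
        unfolding \<eta>_def by (rule min.coboundedI1, rule min.cobounded1 min.cobounded2)+
      show "\<eta> \<le> d / (1 + 2 * \<bar>h\<bar>)" "\<eta> \<le> \<epsilon> * s / (8 * Q)"
        unfolding \<eta>_def by (rule min.coboundedI2, rule min.cobounded1 min.cobounded2)+
    qed
    have small: "4 / s * (\<eta> * Q) < \<epsilon>"
    proof -
      have "\<eta> * Q \<le> \<epsilon> * s / 8" using \<eta>(5) Q by (simp add: field_simps)
      then have "4 / s * (\<eta> * Q) \<le> 4 / s * (\<epsilon> * s / 8)" using s_pos by (intro mult_left_mono) auto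
      also have "\<dots> = \<epsilon> / 2" using s_pos by simp
      finally show ?thesis using \<epsilon> by simp
    qed
    have "0 < \<eta> * decay" using \<eta>(1) decay_pos by simp
    then obtain M where M: "0 \<le> M" "\<And>l. variation_le l (M + \<eta> * decay * real l)"
      by (rule sublinear_variation) blast
    have ev: "\<forall>\<^sub>F K in at_top. \<exists>l P. block_family (K *\<^sub>R (s, 1, s *\<^sub>R \<alpha>)) (\<eta> * K) (K * (h - \<eta>)) l P"
      using p \<eta>(1) unfolding profiles_def by auto
    have "filterlim (\<lambda>n. (1 - 2 * \<eta>) * real n) at_top sequentially"
      using \<eta>(2) by (intro filterlim_tendsto_pos_mult_at_top[OF tendsto_const] filterlim_real_sequentially) auto
    from eventually_compose_filterlim[OF ev this]
    have "\<forall>\<^sub>F n in sequentially. \<exists>l P. block_family (((1 - 2 * \<eta>) * real n) *\<^sub>R (s, 1, s *\<^sub>R \<alpha>))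
        (\<eta> * ((1 - 2 * \<eta>) * real n)) ((1 - 2 * \<eta>) * real n * (h - \<eta>)) l P" .
    moreover have "\<forall>\<^sub>F n in sequentially. (M + decay + error) / \<eta> \<le> real n"
      by (rule eventually_compose_filterlim[OF eventually_ge_at_top filterlim_real_sequentially])
    moreover have "\<forall>\<^sub>F n in sequentially. 1 \<le> n" by (rule eventually_ge_at_top)
    ultimately have "\<forall>\<^sub>F n in sequentially. ereal (h - d) \<le> growth_rate m A \<psi> \<Phi> \<alpha> \<epsilon> n"
    proof eventually_elim
      case (elim n)
      then obtain l P where P: "block_family (((1 - 2 * \<eta>) * real n) *\<^sub>R (s, 1, s *\<^sub>R \<alpha>))
        (\<eta> * ((1 - 2 * \<eta>) * real n)) ((1 - 2 * \<eta>) * real n * (h - \<eta>)) l P" by blast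
      have large: "M + decay + error \<le> \<eta> * real n" using elim(2) \<eta>(1) by (simp add: field_simps)
      have le: "card P \<le> card (counted \<alpha> n \<epsilon>)"
        by (rule counted_of_block_family[OF P refl \<eta>(1,2,3) elim(3) M(2,1) large small[unfolded Q_def]])
      have P0: "0 < card P" using P unfolding block_family_def by (auto simp: card_gt_0_iff)
      then have ne: "counted \<alpha> n \<epsilon> \<noteq> {}" using le by auto
      have "(1 - 2 * \<eta>) * real n * (h - \<eta>) \<le> ln (real (card P))" using P unfolding block_family_def by blast
      also have "\<dots> \<le> ln (real (card (counted \<alpha> n \<epsilon>)))" using le P0 by simp
      finally have "(1 - 2 * \<eta>) * (h - \<eta>) \<le> ln (real (card (counted \<alpha> n \<epsilon>))) / real n"
        using elim(3) by (simp add: field_simps)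
      moreover have "h - d \<le> (1 - 2 * \<eta>) * (h - \<eta>)"
      proof -
        define q where "q = \<eta> * \<bar>h\<bar>"
        have "\<eta> * (1 + 2 * \<bar>h\<bar>) \<le> d" using \<eta>(4) by (simp add: pos_le_divide_eq add_pos_nonneg)
        then have "\<eta> + 2 * q \<le> d" unfolding q_def by (simp add: algebra_simps)
        moreover have "\<eta> * h \<le> q" unfolding q_def using \<eta>(1) by (intro mult_left_mono) auto
        moreover have "0 \<le> \<eta> * \<eta>" by simp
        moreover have "(1 - 2 * \<eta>) * (h - \<eta>) = h - \<eta> - 2 * (\<eta> * h) + 2 * (\<eta> * \<eta>)"
          by (simp add: algebra_simps)
        ultimately show ?thesis by linarith
      qed
      ultimately show ?case by (simp add: growth_rate_eq[OF elim(3) ne])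
    qed
    then show ?thesis by (rule Liminf_bounded)
  qed
  note * = this
  show ?thesis
  proof (cases "liminf (growth_rate m A \<psi> \<Phi> \<alpha> \<epsilon>)")
    case (real r)
    have "h \<le> r + d" if "0 < d" for d using *[OF that] unfolding real by simp
    then have "h \<le> r" by (rule field_le_epsilon)
    then show ?thesis unfolding real by simp
  next
    case PInf then show ?thesis by simp
  next
    case MInf then show ?thesis using *[of 1] by simp
  qed
qed

end

section \<open>Weakly concave functions\<close>

text \<open>
  Reparametrization: the weights \<open>t\<close> and \<open>1 - t\<close> are chosen so that the distorted combination
  becomes the prescribed point of the segment. The distortion is bounded, so the weight of the
  far endpoint is at most a multiple of \<open>s\<close>.
\<close>

lemma weakly_concave_on_segment:
  fixes h :: "'a::real_vector \<Rightarrow> real"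
  assumes "weakly_concave_on L h"
  obtains c where "0 \<le> c"
    "\<And>\<alpha> \<beta> s. \<alpha> \<in> L \<Longrightarrow> \<beta> \<in> L \<Longrightarrow> s \<in> {0..1} \<Longrightarrow>
       \<exists>t\<in>{0..1}. 1 - t \<le> c * s \<and> t * h \<alpha> + (1 - t) * h \<beta> \<le> h ((1 - s) *\<^sub>R \<alpha> + s *\<^sub>R \<beta>)"
proof -
  obtain c where c: "1 \<le> c" "\<forall>\<alpha>\<in>L. \<forall>\<beta>\<in>L. \<exists>g1\<in>{inverse c..c}. \<exists>g2\<in>{inverse c..c}. \<forall>t\<in>{0..1}.
      t * h \<alpha> + (1 - t) * h \<beta> \<le> h (((t * g1) *\<^sub>R \<alpha> + ((1 - t) * g2) *\<^sub>R \<beta>) /\<^sub>R (t * g1 + (1 - t) * g2))"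
    using assms unfolding weakly_concave_on_def by blast
  show ?thesis
  proof (rule that[of "c * c"])
    show "0 \<le> c * c" by simp
    fix \<alpha> \<beta> and s :: real
    assume ab: "\<alpha> \<in> L" "\<beta> \<in> L" and s: "s \<in> {0..1}"
    obtain g1 g2 where g: "g1 \<in> {inverse c..c}" "g2 \<in> {inverse c..c}"
      and conc: "\<And>t. t \<in> {0..1} \<Longrightarrow> t * h \<alpha> + (1 - t) * h \<beta>
        \<le> h (((t * g1) *\<^sub>R \<alpha> + ((1 - t) * g2) *\<^sub>R \<beta>) /\<^sub>R (t * g1 + (1 - t) * g2))"
      using c(2) ab by blast
    have ic: "0 < inverse c" using c(1) by simp
    have g0: "0 < g1" "0 < g2" by (rule less_le_trans[OF ic], use g in simp)+
    define d where "d = (1 - s) * g2 + s * g1"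
    have "(1 - s) * inverse c + s * inverse c \<le> d"
      unfolding d_def using g s by (intro add_mono mult_left_mono) auto
    then have d: "inverse c \<le> d" by (simp add: algebra_simps)
    then have d0: "0 < d" by (rule less_le_trans[OF ic])
    define t where "t = (1 - s) * g2 / d"
    have t1: "1 - t = s * g1 / d" unfolding t_def using d0 by (simp add: field_simps d_def)
    have t: "t \<in> {0..1}"
    proof -
      have "0 \<le> t" unfolding t_def using s g0 d0 by simp
      moreover have "0 \<le> 1 - t" unfolding t1 using s g0 d0 by simp
      ultimately show ?thesis by simp
    qed
    have "1 - t \<le> c * c * s"
    proof -
      have "1 - t = s * (g1 / d)" using t1 by simp
      also have "\<dots> \<le> s * (c / inverse c)"
        using s g d ic c(1) g0 by (intro mult_left_mono frac_le) auto
      finally show ?thesis by (simp add: field_simps)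
    qed
    moreover have "((t * g1) *\<^sub>R \<alpha> + ((1 - t) * g2) *\<^sub>R \<beta>) /\<^sub>R (t * g1 + (1 - t) * g2) = (1 - s) *\<^sub>R \<alpha> + s *\<^sub>R \<beta>"
    proof -
      define q where "q = g1 * g2 / d"
      have q: "0 < q" unfolding q_def using g0 d0 by simp
      have 1: "t * g1 = (1 - s) * q" unfolding t_def q_def by simp
      have 2: "(1 - t) * g2 = s * q" unfolding t1 q_def by simp
      have 3: "t * g1 + (1 - t) * g2 = q" unfolding 1 2 by (simp add: algebra_simps)
      have "inverse q * (x * q) = x" for x :: real using q by simp
      then show ?thesis unfolding 3 unfolding 1 2 by (simp only: scaleR_right_distrib scaleR_scaleR)
    qed
    ultimately show "\<exists>t\<in>{0..1}. 1 - t \<le> c * c * s \<and> t * h \<alpha> + (1 - t) * h \<beta> \<le> h ((1 - s) *\<^sub>R \<alpha> + s *\<^sub>R \<beta>)"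
      using conc[OF t] t by (intro bexI[of _ t]) simp_all
  qed
qed

lemma weakly_concave_on_quasiconcave:
  fixes h :: "'a::real_vector \<Rightarrow> real"
  assumes "weakly_concave_on L h" "\<alpha> \<in> L" "\<beta> \<in> L" "s \<in> {0..1}"
  shows "min (h \<alpha>) (h \<beta>) \<le> h ((1 - s) *\<^sub>R \<alpha> + s *\<^sub>R \<beta>)"
proof -
  obtain t where t: "t \<in> {0..1}" "t * h \<alpha> + (1 - t) * h \<beta> \<le> h ((1 - s) *\<^sub>R \<alpha> + s *\<^sub>R \<beta>)"
    using weakly_concave_on_segment[OF assms(1)] assms(2-4) by metis
  have "t * min (h \<alpha>) (h \<beta>) + (1 - t) * min (h \<alpha>) (h \<beta>) \<le> t * h \<alpha> + (1 - t) * h \<beta>"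
    using t(1) by (intro add_mono mult_left_mono) auto
  then show ?thesis using t(2) by (simp add: algebra_simps)
qed

lemma weakly_concave_on_lipschitz_below:
  fixes h :: "'a::real_vector \<Rightarrow> real"
  assumes "weakly_concave_on L h" "bounded (h ` L)"
  obtains M where "0 \<le> M"
    "\<And>\<alpha> \<beta> s. \<alpha> \<in> L \<Longrightarrow> \<beta> \<in> L \<Longrightarrow> s \<in> {0..1} \<Longrightarrow> h \<alpha> - M * s \<le> h ((1 - s) *\<^sub>R \<alpha> + s *\<^sub>R \<beta>)"
proof -
  obtain c where c: "0 \<le> c"
    "\<And>\<alpha> \<beta> s. \<alpha> \<in> L \<Longrightarrow> \<beta> \<in> L \<Longrightarrow> s \<in> {0..1} \<Longrightarrow>
       \<exists>t\<in>{0..1}. 1 - t \<le> c * s \<and> t * h \<alpha> + (1 - t) * h \<beta> \<le> h ((1 - s) *\<^sub>R \<alpha> + s *\<^sub>R \<beta>)"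
    by (rule weakly_concave_on_segment[OF assms(1)]) blast
  obtain H where H: "0 < H" "\<And>\<alpha>. \<alpha> \<in> L \<Longrightarrow> \<bar>h \<alpha>\<bar> \<le> H"
    using assms(2) unfolding bounded_pos by auto
  show ?thesis
  proof (rule that[of "c * (2 * H)"])
    show "0 \<le> c * (2 * H)" using c(1) H(1) by simp
    fix \<alpha> \<beta> and s :: real
    assume ab: "\<alpha> \<in> L" "\<beta> \<in> L" "s \<in> {0..1}"
    obtain t where t: "t \<in> {0..1}" "1 - t \<le> c * s" "t * h \<alpha> + (1 - t) * h \<beta> \<le> h ((1 - s) *\<^sub>R \<alpha> + s *\<^sub>R \<beta>)"
      using c(2)[OF ab] by blast
    have "(1 - t) * (h \<alpha> - h \<beta>) \<le> (1 - t) * (2 * H)"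
      using t(1) H(2)[OF ab(1)] H(2)[OF ab(2)] by (intro mult_left_mono) auto
    also have "\<dots> \<le> c * s * (2 * H)" using t(2) H(1) by (intro mult_right_mono) auto
    finally show "h \<alpha> - c * (2 * H) * s \<le> h ((1 - s) *\<^sub>R \<alpha> + s *\<^sub>R \<beta>)"
      using t(3) by (simp add: algebra_simps)
  qed
qed

text \<open>
  From each \<open>\<alpha>\<close> in \<open>S\<close>, every other point of \<open>S\<close> can be moved along its ray to a fixed distance
  \<open>r\<close> from \<open>\<alpha>\<close> without leaving \<open>L\<close>. This is the common property of polyhedra and relatively open
  convex sets that yields lower semicontinuity: a point at distance \<open>d\<close> from \<open>\<alpha>\<close> cuts off the
  fraction \<open>d / r\<close> of a segment of length \<open>r\<close>, and the bound of \<open>weakly_concave_on_lipschitz_below\<close> becomes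
  a bound in terms of the distance.
\<close>

definition extendable :: "'a::real_normed_vector set \<Rightarrow> 'a set \<Rightarrow> bool" where
  "extendable S L \<longleftrightarrow> S \<subseteq> L \<and> (\<forall>\<alpha>\<in>S. \<exists>r>0. \<forall>z\<in>S. z \<noteq> \<alpha> \<longrightarrow> \<alpha> + (r / dist z \<alpha>) *\<^sub>R (z - \<alpha>) \<in> L)"

lemma continuous_on_extendable:
  fixes h :: "'a::real_normed_vector \<Rightarrow> real"
  assumes "weakly_concave_on L h" "bounded (h ` L)" "extendable S L"
    and usc: "\<And>\<alpha> e. \<alpha> \<in> L \<Longrightarrow> 0 < e \<Longrightarrow> \<exists>r>0. \<forall>\<beta>\<in>L. dist \<beta> \<alpha> < r \<longrightarrow> h \<beta> < h \<alpha> + e"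
  shows "continuous_on S h"
proof -
  obtain M where M: "0 \<le> M"
    "\<And>\<alpha> \<beta> s. \<alpha> \<in> L \<Longrightarrow> \<beta> \<in> L \<Longrightarrow> s \<in> {0..1} \<Longrightarrow> h \<alpha> - M * s \<le> h ((1 - s) *\<^sub>R \<alpha> + s *\<^sub>R \<beta>)"
    by (rule weakly_concave_on_lipschitz_below[OF assms(1,2)]) blast
  show ?thesis
    unfolding continuous_on_iff
  proof (intro ballI allI impI)
    fix \<alpha> and e :: real assume \<alpha>: "\<alpha> \<in> S" and e: "0 < e"
    have \<alpha>L: "\<alpha> \<in> L" using \<alpha> assms(3) unfolding extendable_def by blast
    obtain r where r: "0 < r" "\<And>z. z \<in> S \<Longrightarrow> z \<noteq> \<alpha> \<Longrightarrow> \<alpha> + (r / dist z \<alpha>) *\<^sub>R (z - \<alpha>) \<in> L"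
      using assms(3) \<alpha> unfolding extendable_def by blast
    obtain r' where r': "0 < r'" "\<And>\<beta>. \<beta> \<in> L \<Longrightarrow> dist \<beta> \<alpha> < r' \<Longrightarrow> h \<beta> < h \<alpha> + e"
      using usc[OF \<alpha>L e] by blast
    define d where "d = min r' (min r (e * r / (M + 1)))"
    have d: "0 < d" unfolding d_def using r(1) r'(1) e M(1) by simp
    have "dist (h z) (h \<alpha>) < e" if z: "z \<in> S" "dist z \<alpha> < d" for z
    proof (cases "z = \<alpha>")
      case True then show ?thesis using e by simp
    next
      case False
      define s where "s = dist z \<alpha> / r"
      have s: "s \<in> {0..1}" "0 < s" unfolding s_def using z(2) r(1) False unfolding d_def by auto
      have "(1 - s) *\<^sub>R \<alpha> + s *\<^sub>R (\<alpha> + (r / dist z \<alpha>) *\<^sub>R (z - \<alpha>)) = \<alpha> + (s * (r / dist z \<alpha>)) *\<^sub>R (z - \<alpha>)"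
        by (simp add: algebra_simps)
      also have "s * (r / dist z \<alpha>) = 1" unfolding s_def using r(1) False by simp
      finally have zs: "(1 - s) *\<^sub>R \<alpha> + s *\<^sub>R (\<alpha> + (r / dist z \<alpha>) *\<^sub>R (z - \<alpha>)) = z" by simp
      have "h \<alpha> - M * s \<le> h z"
        using M(2)[OF \<alpha>L r(2)[OF z(1) False] s(1)] unfolding zs .
      moreover have "M * s < e"
      proof -
        have "M * s \<le> (M + 1) * s" using s by (simp add: algebra_simps)
        also have "dist z \<alpha> < e * r / (M + 1)" using z(2) unfolding d_def by simp
        then have "(M + 1) * s < e" unfolding s_def using r(1) M(1) by (simp add: field_simps)
        finally show ?thesis .
      qed
      moreover have "h z < h \<alpha> + e"
        using r'(2)[of z] z assms(3) unfolding d_def extendable_def by auto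
      ultimately show ?thesis by (simp add: dist_real_def)
    qed
    with d show "\<exists>d>0. \<forall>z\<in>S. dist z \<alpha> < d \<longrightarrow> dist (h z) (h \<alpha>) < e" by blast
  qed
qed

text \<open>
  A half-space whose boundary contains \<open>\<alpha>\<close> is a cone with apex \<open>\<alpha>\<close> and imposes no bound on \<open>r\<close>;
  the others stay at a positive distance from \<open>\<alpha>\<close>, and there are finitely many of them.
\<close>

lemma extendable_polyhedron:
  fixes S :: "'a::euclidean_space set"
  assumes "polyhedron S" "S \<subseteq> L"
  shows "extendable S L"
  unfolding extendable_def
proof (intro conjI ballI)
  show "S \<subseteq> L" by fact
  fix \<alpha> assume \<alpha>: "\<alpha> \<in> S"
  obtain F where F: "finite F" "S = \<Inter>F" "\<And>H. H \<in> F \<Longrightarrow> \<exists>a b. a \<noteq> 0 \<and> H = {x. a \<bullet> x \<le> b}"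
    using assms(1) unfolding polyhedron_def by blast
  have "\<forall>\<^sub>F r in at_right 0. \<forall>z\<in>H. z \<noteq> \<alpha> \<longrightarrow> \<alpha> + (r / dist z \<alpha>) *\<^sub>R (z - \<alpha>) \<in> H" if H: "H \<in> F" for H
  proof -
    obtain a b where ab: "a \<noteq> 0" "H = {x. a \<bullet> x \<le> b}" using F(3)[OF H] by blast
    have le: "a \<bullet> \<alpha> \<le> b" using \<alpha> F(2) H ab by auto
    show ?thesis
    proof (cases "a \<bullet> \<alpha> = b")
      case True
      have "\<alpha> + (r / dist z \<alpha>) *\<^sub>R (z - \<alpha>) \<in> H" if "0 < r" "z \<in> H" "z \<noteq> \<alpha>" for r z
      proof -
        have "a \<bullet> (z - \<alpha>) \<le> 0" using that(2) True ab(2) by (simp add: inner_diff_right)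
        then have "(r / dist z \<alpha>) * (a \<bullet> (z - \<alpha>)) \<le> 0" using that by (intro mult_nonneg_nonpos) auto
        then show ?thesis using True ab(2) by (simp add: inner_add_right)
      qed
      then show ?thesis using eventually_at_right_less[of 0] by (auto elim!: eventually_mono)
    next
      case False
      then have lt: "0 < (b - a \<bullet> \<alpha>) / norm a" using le ab(1) by simp
      have "\<alpha> + (r / dist z \<alpha>) *\<^sub>R (z - \<alpha>) \<in> H" if "0 < r" "r < (b - a \<bullet> \<alpha>) / norm a" "z \<noteq> \<alpha>" for r z
      proof -
        have "(r / dist z \<alpha>) * (a \<bullet> (z - \<alpha>)) \<le> (r / dist z \<alpha>) * (norm a * norm (z - \<alpha>))"
          using that(1) by (intro mult_left_mono norm_cauchy_schwarz) auto
        also have "\<dots> = r * norm a" using that(3) by (simp add: dist_norm)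
        also have "\<dots> \<le> b - a \<bullet> \<alpha>" using that(2) ab(1) by (simp add: field_simps)
        finally show ?thesis using ab(2) by (simp add: inner_add_right)
      qed
      then show ?thesis
        unfolding eventually_at_right_field using lt by blast
    qed
  qed
  then have "\<forall>\<^sub>F r in at_right 0. \<forall>H\<in>F. \<forall>z\<in>H. z \<noteq> \<alpha> \<longrightarrow> \<alpha> + (r / dist z \<alpha>) *\<^sub>R (z - \<alpha>) \<in> H"
    by (intro eventually_ball_finite F(1)) blast
  then have "\<forall>\<^sub>F r in at_right 0. (\<forall>H\<in>F. \<forall>z\<in>H. z \<noteq> \<alpha> \<longrightarrow> \<alpha> + (r / dist z \<alpha>) *\<^sub>R (z - \<alpha>) \<in> H) \<and> (0 :: real) < r"
    by (intro eventually_conj eventually_at_right_less)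
  from eventually_happens'[OF trivial_limit_at_right_real this]
  obtain r where "0 < r" "\<forall>H\<in>F. \<forall>z\<in>H. z \<noteq> \<alpha> \<longrightarrow> \<alpha> + (r / dist z \<alpha>) *\<^sub>R (z - \<alpha>) \<in> H" by blast
  then have "\<alpha> + (r / dist z \<alpha>) *\<^sub>R (z - \<alpha>) \<in> S" if "z \<in> S" "z \<noteq> \<alpha>" for z
    using that unfolding F(2) by simp
  then show "\<exists>r>0. \<forall>z\<in>S. z \<noteq> \<alpha> \<longrightarrow> \<alpha> + (r / dist z \<alpha>) *\<^sub>R (z - \<alpha>) \<in> L"
    using assms(2) \<open>0 < r\<close> by auto
qed

lemma extendable_rel_interior:
  fixes B :: "'a::euclidean_space set"
  assumes "B \<subseteq> L"
  shows "extendable (rel_interior B) L"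
  unfolding extendable_def
proof (intro conjI ballI)
  show "rel_interior B \<subseteq> L" using assms rel_interior_subset by blast
  fix \<alpha> assume \<alpha>: "\<alpha> \<in> rel_interior B"
  then obtain e where e: "0 < e" "ball \<alpha> e \<inter> affine hull B \<subseteq> B" "\<alpha> \<in> B"
    using mem_rel_interior_ball by blast
  have "\<alpha> + (e / 2 / dist z \<alpha>) *\<^sub>R (z - \<alpha>) \<in> L" if z: "z \<in> rel_interior B" "z \<noteq> \<alpha>" for z
  proof -
    let ?q = "e / 2 / dist z \<alpha>"
    have "z \<in> B" using z(1) rel_interior_subset by blast
    then have "(1 - ?q) *\<^sub>R \<alpha> + ?q *\<^sub>R z \<in> affine hull B"
      by (rule mem_affine[OF affine_affine_hull hull_inc[OF e(3)] hull_inc]) simp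
    moreover have "(1 - ?q) *\<^sub>R \<alpha> + ?q *\<^sub>R z = \<alpha> + ?q *\<^sub>R (z - \<alpha>)" by (simp add: algebra_simps)
    moreover have "dist \<alpha> (\<alpha> + ?q *\<^sub>R (z - \<alpha>)) = e / 2"
    proof -
      have "dist \<alpha> (\<alpha> + ?q *\<^sub>R (z - \<alpha>)) = norm (?q *\<^sub>R (z - \<alpha>))" by (simp add: dist_norm)
      also have "\<dots> = ?q * dist z \<alpha>" using e(1) by (simp add: dist_norm)
      finally show ?thesis using z(2) by simp
    qed
    ultimately have "\<alpha> + ?q *\<^sub>R (z - \<alpha>) \<in> ball \<alpha> e \<inter> affine hull B" using e(1) by simp
    then show ?thesis using e(2) assms by blast
  qed
  then show "\<exists>r>0. \<forall>z\<in>rel_interior B. z \<noteq> \<alpha> \<longrightarrow> \<alpha> + (r / dist z \<alpha>) *\<^sub>R (z - \<alpha>) \<in> L"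
    using e(1) by (intro exI[of _ "e / 2"]) auto
qed

lemma weakly_concave_on_antimono:
  fixes h :: "'a::real_vector \<Rightarrow> real"
  assumes "weakly_concave_on L h" and mu: "\<mu> \<in> L" "\<beta> \<in> L"
    and max: "\<And>z. z \<in> closed_segment \<mu> \<beta> \<Longrightarrow> h z \<le> h \<mu>"
  shows "antimono_on {0..1::real} (\<lambda>t. h ((1 - t) *\<^sub>R \<mu> + t *\<^sub>R \<beta>))"
proof (rule monotone_onI)
  fix s t :: real assume st: "s \<in> {0..1}" "t \<in> {0..1}" "s \<le> t"
  let ?z = "\<lambda>t. (1 - t) *\<^sub>R \<mu> + t *\<^sub>R \<beta>"
  show "h (?z t) \<le> h (?z s)"
  proof (cases "t = 0")
    case True then show ?thesis using st by simp
  next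
    case False
    then have t: "0 < t" using st by auto
    have conv: "convex L" using assms(1) unfolding weakly_concave_on_def by blast
    have zt: "?z t \<in> closed_segment \<mu> \<beta>" using st by (auto simp: closed_segment_def)
    have "?z t \<in> L" using st by (intro convexD[OF conv mu]) auto
    then have "min (h \<mu>) (h (?z t)) \<le> h ((1 - s / t) *\<^sub>R \<mu> + (s / t) *\<^sub>R ?z t)"
      using st t by (intro weakly_concave_on_quasiconcave[OF assms(1) mu(1)]) auto
    moreover have "(1 - s / t) *\<^sub>R \<mu> + (s / t) *\<^sub>R ?z t = ?z s"
    proof -
      have "(1 - s / t) *\<^sub>R \<mu> + (s / t) *\<^sub>R ?z t = ((1 - s / t) + (s / t) * (1 - t)) *\<^sub>R \<mu> + (s / t * t) *\<^sub>R \<beta>"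
        by (simp only: scaleR_right_distrib scaleR_left_distrib scaleR_scaleR add.assoc)
      also have "(1 - s / t) + (s / t) * (1 - t) = 1 - s" using t by (simp add: field_simps)
      also have "s / t * t = s" using t by simp
      finally show ?thesis .
    qed
    ultimately show ?thesis using max[OF zt] by (simp add: min_def split: if_splits)
  qed
qed

section \<open>The spectrum\<close>

context almost_additive_pair
begin

abbreviation L :: "(real ^ 'd) set" where "L \<equiv> average_set m A \<Phi>"

lemma integral_joint:
  assumes \<mu>: "\<mu> \<in> invariant_measures m A" and n: "1 \<le> n"
  shows "(\<integral>x. joint n x \<partial>\<mu>) /\<^sub>R real n =
    (1, (\<integral>x. - \<psi>\<^sub>0 n x \<partial>\<mu>) / real n, \<integral>x. \<Phi> n x /\<^sub>R real n \<partial>\<mu>)"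
proof -
  interpret prob_space \<mu> using \<mu> unfolding invariant_measures_def by auto
  have int: "integrable \<mu> (joint n)" by (rule integrable_invariant[OF \<mu> continuous])
  have 1: "fst (\<integral>x. joint n x \<partial>\<mu>) = (\<integral>x. fst (joint n x) \<partial>\<mu>)"
    by (rule integral_bounded_linear[OF bounded_linear_fst int, symmetric])
  have 2: "snd (\<integral>x. joint n x \<partial>\<mu>) = (\<integral>x. snd (joint n x) \<partial>\<mu>)"
    by (rule integral_bounded_linear[OF bounded_linear_snd int, symmetric])
  have int2: "integrable \<mu> (\<lambda>x. snd (joint n x))"
    by (rule integrable_bounded_linear[OF bounded_linear_snd int])
  have 3: "fst (\<integral>x. snd (joint n x) \<partial>\<mu>) = (\<integral>x. fst (snd (joint n x)) \<partial>\<mu>)"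
    by (rule integral_bounded_linear[OF bounded_linear_fst int2, symmetric])
  have 4: "snd (\<integral>x. snd (joint n x) \<partial>\<mu>) = (\<integral>x. snd (snd (joint n x)) \<partial>\<mu>)"
    by (rule integral_bounded_linear[OF bounded_linear_snd int2, symmetric])
  have "integrable \<mu> (\<Phi> n)"
    using integrable_invariant[OF \<mu> continuous_phi[of n]] n unfolding \<Phi>\<^sub>0_def[abs_def] by simp
  then have "(\<integral>x. \<Phi> n x /\<^sub>R real n \<partial>\<mu>) = (\<integral>x. \<Phi>\<^sub>0 n x \<partial>\<mu>) /\<^sub>R real n"
    using n unfolding \<Phi>\<^sub>0_def by simp
  moreover have "(\<integral>x. joint n x \<partial>\<mu>) = (real n, \<integral>x. - \<psi>\<^sub>0 n x \<partial>\<mu>, \<integral>x. \<Phi>\<^sub>0 n x \<partial>\<mu>)"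
    using 1 2 3 4 by (intro prod_eqI) (simp_all add: joint_def prob_space)
  ultimately show ?thesis using n by (simp add: divide_inverse_commute)
qed

text \<open>
  Every point of the average set occurs in an exact profile with \<open>h = 0\<close>. This is the source of
  nonnegativity.
\<close>

lemma limit_average_profile:
  assumes \<mu>: "\<mu> \<in> invariant_measures m A"
  obtains \<sigma> where "0 < \<sigma>" "((1, \<sigma>, limit_average \<Phi> \<mu>), 0) \<in> profiles 0"
    "(\<lambda>n. \<integral>x. \<Phi> n x /\<^sub>R real n \<partial>\<mu>) \<longlonglongrightarrow> limit_average \<Phi> \<mu>"
proof -
  interpret prob_space \<mu> using \<mu> unfolding invariant_measures_def by auto
  obtain \<theta> where \<theta>: "(\<lambda>n. (\<integral>x. joint n x \<partial>\<mu>) /\<^sub>R real n) \<longlonglongrightarrow> \<theta>" "(\<theta>, 0) \<in> profiles 0"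
    by (rule integral_averages_in_profiles[OF \<mu>])
  have "\<forall>\<^sub>F n in sequentially. (\<integral>x. joint n x \<partial>\<mu>) /\<^sub>R real n =
    (1, (\<integral>x. - \<psi>\<^sub>0 n x \<partial>\<mu>) / real n, \<integral>x. \<Phi> n x /\<^sub>R real n \<partial>\<mu>)"
    using eventually_ge_at_top[of 1] by eventually_elim (rule integral_joint[OF \<mu>])
  then have lim: "(\<lambda>n. (1 :: real, (\<integral>x. - \<psi>\<^sub>0 n x \<partial>\<mu>) / real n, \<integral>x. \<Phi> n x /\<^sub>R real n \<partial>\<mu>)) \<longlonglongrightarrow> \<theta>"
    using \<theta>(1) by (rule Lim_transform_eventually[rotated])
  have "(\<lambda>n. 1 :: real) \<longlonglongrightarrow> fst \<theta>" using tendsto_fst[OF lim] by simp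
  then have f: "fst \<theta> = 1" by (simp add: LIMSEQ_const_iff)
  have s: "(\<lambda>n. (\<integral>x. - \<psi>\<^sub>0 n x \<partial>\<mu>) / real n) \<longlonglongrightarrow> fst (snd \<theta>)"
    using tendsto_fst[OF tendsto_snd[OF lim]] by simp
  have p: "(\<lambda>n. \<integral>x. \<Phi> n x /\<^sub>R real n \<partial>\<mu>) \<longlonglongrightarrow> snd (snd \<theta>)"
    using tendsto_snd[OF tendsto_snd[OF lim]] by simp
  have la: "limit_average \<Phi> \<mu> = snd (snd \<theta>)" unfolding limit_average_def by (rule limI[OF p])
  have "decay \<le> fst (snd \<theta>)"
  proof (rule tendsto_lowerbound[OF s])
    show "\<forall>\<^sub>F n in sequentially. decay \<le> (\<integral>x. - \<psi>\<^sub>0 n x \<partial>\<mu>) / real n"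
      using eventually_ge_at_top[of 1]
    proof eventually_elim
      case (elim n)
      have "decay * real n = (\<integral>x. decay * real n \<partial>\<mu>)" by (simp add: prob_space)
      also have "\<dots> \<le> (\<integral>x. - \<psi>\<^sub>0 n x \<partial>\<mu>)"
      proof (rule integral_mono)
        show "integrable \<mu> (\<lambda>x. - \<psi>\<^sub>0 n x)"
          using integrable_invariant[OF \<mu> continuous_psi[of n]] by simp
        show "decay * real n \<le> - \<psi>\<^sub>0 n x" if "x \<in> space \<mu>" for x
          using psi_le[of x n] that space_invariant[OF \<mu>] by simp
      qed simp
      finally show ?case using elim by (simp add: field_simps)
    qed
  qed simp
  then have "0 < fst (snd \<theta>)" using decay_pos by simp
  moreover have "\<theta> = (1, fst (snd \<theta>), snd (snd \<theta>))" using f by (metis prod.collapse)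
  ultimately show ?thesis using that[of "fst (snd \<theta>)"] \<theta>(2) p la by metis
qed

lemma convex_average_set: "convex L"
proof (rule convexI)
  fix a b :: "real ^ 'd" and u v :: real
  assume ab: "a \<in> L" "b \<in> L" and uv: "0 \<le> u" "0 \<le> v" "u + v = 1"
  obtain \<mu> \<nu> where \<mu>: "\<mu> \<in> invariant_measures m A" "a = limit_average \<Phi> \<mu>"
    and \<nu>: "\<nu> \<in> invariant_measures m A" "b = limit_average \<Phi> \<nu>"
    using ab unfolding average_set_def by blast
  have v: "v = 1 - u" "u \<le> 1" using uv by auto
  obtain \<rho> where \<rho>: "\<rho> \<in> invariant_measures m A"
    "\<And>f :: (nat \<Rightarrow> nat) \<Rightarrow> real ^ 'd. continuous_on X f \<Longrightarrow>
       (\<integral>x. f x \<partial>\<rho>) = u *\<^sub>R (\<integral>x. f x \<partial>\<mu>) + (1 - u) *\<^sub>R (\<integral>x. f x \<partial>\<nu>)"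
    by (rule invariant_mixture[OF \<mu>(1) \<nu>(1) uv(1) v(2)]) blast
  have lim: "(\<lambda>n. \<integral>x. \<Phi> n x /\<^sub>R real n \<partial>\<kappa>) \<longlonglongrightarrow> limit_average \<Phi> \<kappa>"
    if "\<kappa> \<in> invariant_measures m A" for \<kappa>
    by (rule limit_average_profile[OF that])
  have "(\<lambda>n. u *\<^sub>R (\<integral>x. \<Phi> n x /\<^sub>R real n \<partial>\<mu>) + v *\<^sub>R (\<integral>x. \<Phi> n x /\<^sub>R real n \<partial>\<nu>)) \<longlonglongrightarrow> u *\<^sub>R a + v *\<^sub>R b"
    using lim[OF \<mu>(1)] lim[OF \<nu>(1)] unfolding \<mu>(2) \<nu>(2) by (intro tendsto_intros)
  moreover have "\<forall>\<^sub>F n in sequentially. u *\<^sub>R (\<integral>x. \<Phi> n x /\<^sub>R real n \<partial>\<mu>) + v *\<^sub>R (\<integral>x. \<Phi> n x /\<^sub>R real n \<partial>\<nu>)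
      = (\<integral>x. \<Phi> n x /\<^sub>R real n \<partial>\<rho>)"
    using eventually_ge_at_top[of 1]
  proof eventually_elim
    case (elim n)
    have "continuous_on X (\<lambda>x. \<Phi> n x /\<^sub>R real n)"
      using continuous_phi[of n] elim unfolding \<Phi>\<^sub>0_def[abs_def] by (intro continuous_intros) simp
    then show ?case by (subst \<rho>(2)) (auto simp: v)
  qed
  ultimately have "(\<lambda>n. \<integral>x. \<Phi> n x /\<^sub>R real n \<partial>\<rho>) \<longlonglongrightarrow> u *\<^sub>R a + v *\<^sub>R b"
    by (rule Lim_transform_eventually)
  then have "u *\<^sub>R a + v *\<^sub>R b = limit_average \<Phi> \<rho>" using lim[OF \<rho>(1)] by (rule LIMSEQ_unique)
  then show "u *\<^sub>R a + v *\<^sub>R b \<in> L" using \<rho>(1) unfolding average_set_def by blast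
qed

text \<open>
  Moving the centre is absorbed by enlarging the radius. With \<open>\<beta> = \<alpha>\<close> this gives monotonicity in
  the radius, with \<open>\<beta>\<close> close to \<open>\<alpha>\<close> upper semicontinuity.
\<close>

lemma growth_rate_mono:
  assumes n: "1 \<le> n" and le: "dist \<beta> \<alpha> + \<epsilon> \<le> \<epsilon>'"
  shows "growth_rate m A \<psi> \<Phi> \<beta> \<epsilon> n \<le> growth_rate m A \<psi> \<Phi> \<alpha> \<epsilon>' n"
proof (cases "counted \<beta> n \<epsilon> = {}")
  case True then show ?thesis using growth_rate_empty[OF n] by simp
next
  case False
  have sub: "counted \<beta> n \<epsilon> \<subseteq> counted \<alpha> n \<epsilon>'"
  proof -
    have "norm (y - \<alpha>) < \<epsilon>'" if "norm (y - \<beta>) < \<epsilon>" for y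
      using that le dist_triangle[of y \<alpha> \<beta>] by (simp add: dist_norm)
    then show ?thesis unfolding counted_def by blast
  qed
  then have ne: "counted \<alpha> n \<epsilon>' \<noteq> {}" using False by blast
  have "0 < card (counted \<beta> n \<epsilon>)" using False finite_counted[OF n] by (simp add: card_gt_0_iff)
  moreover have "card (counted \<beta> n \<epsilon>) \<le> card (counted \<alpha> n \<epsilon>')"
    by (rule card_mono[OF finite_counted[OF n] sub])
  ultimately have "ln (real (card (counted \<beta> n \<epsilon>))) \<le> ln (real (card (counted \<alpha> n \<epsilon>')))" by simp
  then show ?thesis
    by (simp add: growth_rate_eq[OF n False] growth_rate_eq[OF n ne] divide_right_mono)
qed

lemma limsup_growth_rate_mono:
  assumes "dist \<beta> \<alpha> + \<epsilon> \<le> \<epsilon>'"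
  shows "limsup (growth_rate m A \<psi> \<Phi> \<beta> \<epsilon>) \<le> limsup (growth_rate m A \<psi> \<Phi> \<alpha> \<epsilon>')"
  by (intro Limsup_mono eventually_mono[OF eventually_ge_at_top[of 1]] growth_rate_mono[OF _ assms])

text \<open>
  The upper rate yields a profile, and the profile bounds the lower rate from below, so the two
  limits coincide.
\<close>

lemma Lambda_characterization:
  assumes \<alpha>: "\<alpha> \<in> L"
  shows "((\<lambda>\<epsilon>. liminf (growth_rate m A \<psi> \<Phi> \<alpha> \<epsilon>)) \<longlongrightarrow> ereal (Lambda m A \<psi> \<Phi> \<alpha>)) (at_right 0)"
    and "((\<lambda>\<epsilon>. limsup (growth_rate m A \<psi> \<Phi> \<alpha> \<epsilon>)) \<longlongrightarrow> ereal (Lambda m A \<psi> \<Phi> \<alpha>)) (at_right 0)"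
    and "\<And>\<epsilon>. 0 < \<epsilon> \<Longrightarrow> ereal (Lambda m A \<psi> \<Phi> \<alpha>) \<le> liminf (growth_rate m A \<psi> \<Phi> \<alpha> \<epsilon>)"
    and "0 \<le> Lambda m A \<psi> \<Phi> \<alpha>"
    and "Lambda m A \<psi> \<Phi> \<alpha> \<le> (1 / decay + 1) * ln (real m + 1)"
proof -
  let ?g = "growth_rate m A \<psi> \<Phi> \<alpha>"
  let ?c = "(1 / decay + 1) * ln (real m + 1)"
  obtain \<mu> where \<mu>: "\<mu> \<in> invariant_measures m A" "\<alpha> = limit_average \<Phi> \<mu>"
    using \<alpha> unfolding average_set_def by blast
  obtain \<sigma> where \<sigma>: "0 < \<sigma>" "((1, \<sigma>, \<alpha>), 0) \<in> profiles 0"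
    using limit_average_profile[OF \<mu>(1)] unfolding \<mu>(2) by blast
  \<comment> \<open>rescaled to cost 1\<close>
  have "(inverse \<sigma> *\<^sub>R (1, \<sigma>, \<alpha>), inverse \<sigma> * 0) \<in> profiles (inverse \<sigma> * 0)"
    by (rule profiles_scale[OF \<sigma>(2)]) (use \<sigma>(1) in simp)
  then have prof: "((inverse \<sigma>, 1, inverse \<sigma> *\<^sub>R \<alpha>), 0) \<in> profiles 0" using \<sigma>(1) by simp
  have nonneg: "0 \<le> liminf (?g \<epsilon>)" if "0 < \<epsilon>" for \<epsilon>
    using liminf_of_profile[OF prof _ that] \<sigma>(1) by (simp add: zero_ereal_def)
  have le: "liminf (?g \<epsilon>) \<le> limsup (?g \<epsilon>)" for \<epsilon>
    by (rule Liminf_le_Limsup) simp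
  define U where "U = (INF \<epsilon>\<in>{0<..}. limsup (?g \<epsilon>))"
  have "0 \<le> U" unfolding U_def
    by (rule INF_greatest) (use nonneg le in \<open>auto intro: order_trans\<close>)
  moreover have "U \<le> ereal ?c"
  proof -
    have "U \<le> limsup (?g 1)" unfolding U_def by (rule INF_lower) simp
    also have "\<dots> \<le> ereal ?c"
      by (intro Limsup_bounded eventually_mono[OF eventually_ge_at_top[of 1]] growth_rate_le)
    finally show ?thesis .
  qed
  ultimately obtain u where u: "U = ereal u" "0 \<le> u" "u \<le> ?c" by (cases U) auto
  have up: "ereal u \<le> limsup (?g \<epsilon>)" if "0 < \<epsilon>" for \<epsilon>
    unfolding u(1)[symmetric] U_def using that by (intro INF_lower) simp
  obtain \<rho> where \<rho>: "inverse ratio_bound \<le> \<rho>" "((\<rho>, 1, \<rho> *\<^sub>R \<alpha>), u) \<in> profiles 0"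
    using profile_of_limsup[OF up] by blast
  have "0 < inverse ratio_bound" using ratio_bound_ge_1 by simp
  then have "0 < \<rho>" using \<rho>(1) by linarith
  then have low: "ereal u \<le> liminf (?g \<epsilon>)" if "0 < \<epsilon>" for \<epsilon>
    using liminf_of_profile[OF \<rho>(2) _ that] by blast
  have ev_low: "\<forall>\<^sub>F \<epsilon> in at_right 0. y < liminf (?g \<epsilon>)" if "y < ereal u" for y
    using eventually_at_right_less[of 0]
    by eventually_elim (use low that in \<open>auto intro: less_le_trans\<close>)
  have ev_up: "\<forall>\<^sub>F \<epsilon> in at_right 0. limsup (?g \<epsilon>) < y" if "ereal u < y" for y
  proof -
    have "(INF \<epsilon>\<in>{0<..}. limsup (?g \<epsilon>)) < y"
      using that unfolding u(1)[symmetric] U_def .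
    then obtain e where e: "0 < e" "limsup (?g e) < y"
      unfolding INF_less_iff by auto
    have "limsup (?g \<epsilon>) < y" if "0 < \<epsilon>" "\<epsilon> < e" for \<epsilon>
      using limsup_growth_rate_mono[of \<alpha> \<alpha> \<epsilon> e] that e(2) by simp
    then show ?thesis unfolding eventually_at_right_field using e(1) by blast
  qed
  have inf_lim: "((\<lambda>\<epsilon>. liminf (?g \<epsilon>)) \<longlongrightarrow> ereal u) (at_right 0)"
  proof (rule order_tendstoI)
    fix y assume "ereal u < y"
    from ev_up[OF this] show "\<forall>\<^sub>F \<epsilon> in at_right 0. liminf (?g \<epsilon>) < y"
      by eventually_elim (use le in \<open>auto intro: le_less_trans\<close>)
  qed (rule ev_low)
  have sup_lim: "((\<lambda>\<epsilon>. limsup (?g \<epsilon>)) \<longlongrightarrow> ereal u) (at_right 0)"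
  proof (rule order_tendstoI)
    fix y assume "y < ereal u"
    from ev_low[OF this] show "\<forall>\<^sub>F \<epsilon> in at_right 0. y < limsup (?g \<epsilon>)"
      by eventually_elim (use le in \<open>auto intro: less_le_trans\<close>)
  qed (rule ev_up)
  have "Lim (at_right 0) (\<lambda>\<epsilon>. liminf (?g \<epsilon>)) = ereal u"
    by (rule tendsto_Lim[OF trivial_limit_at_right_real inf_lim])
  then have \<Lambda>: "Lambda m A \<psi> \<Phi> \<alpha> = u" unfolding Lambda_def by simp
  show "((\<lambda>\<epsilon>. liminf (?g \<epsilon>)) \<longlongrightarrow> ereal (Lambda m A \<psi> \<Phi> \<alpha>)) (at_right 0)" unfolding \<Lambda> by (rule inf_lim)
  show "((\<lambda>\<epsilon>. limsup (?g \<epsilon>)) \<longlongrightarrow> ereal (Lambda m A \<psi> \<Phi> \<alpha>)) (at_right 0)" unfolding \<Lambda> by (rule sup_lim)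
  show "ereal (Lambda m A \<psi> \<Phi> \<alpha>) \<le> liminf (?g \<epsilon>)" if "0 < \<epsilon>" for \<epsilon> unfolding \<Lambda> by (rule low[OF that])
  show "0 \<le> Lambda m A \<psi> \<Phi> \<alpha>" "Lambda m A \<psi> \<Phi> \<alpha> \<le> ?c" unfolding \<Lambda> by (rule u)+
qed

lemma Lambda_profile:
  assumes "\<alpha> \<in> L"
  obtains \<rho> where "\<rho> \<in> {inverse ratio_bound..ratio_bound}" "((\<rho>, 1, \<rho> *\<^sub>R \<alpha>), Lambda m A \<psi> \<Phi> \<alpha>) \<in> profiles 0"
proof -
  have "ereal (Lambda m A \<psi> \<Phi> \<alpha>) \<le> limsup (growth_rate m A \<psi> \<Phi> \<alpha> \<epsilon>)" if "0 < \<epsilon>" for \<epsilon>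
    using Lambda_characterization(3)[OF assms that] by (rule order_trans) (simp add: Liminf_le_Limsup)
  from profile_of_limsup[OF this] show ?thesis using that by auto
qed

lemma Lambda_ge_profile:
  assumes "((s, 1, s *\<^sub>R \<alpha>), h) \<in> profiles 0" "0 < s" "\<alpha> \<in> L"
  shows "h \<le> Lambda m A \<psi> \<Phi> \<alpha>"
proof -
  have "ereal h \<le> ereal (Lambda m A \<psi> \<Phi> \<alpha>)"
  proof (rule tendsto_lowerbound[OF Lambda_characterization(1)[OF assms(3)]])
    show "\<forall>\<^sub>F \<epsilon> in at_right 0. ereal h \<le> liminf (growth_rate m A \<psi> \<Phi> \<alpha> \<epsilon>)"
      using eventually_at_right_less[of 0] by eventually_elim (rule liminf_of_profile[OF assms(1,2)])
  qed simp
  then show ?thesis by simp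
qed

text \<open>
  Both profiles have cost 1, so a convex combination has cost 1 again, and its last component is
  the convex combination of the two values. Its length is a combination of the two ratios of length to cost,
  and dividing by it produces the distorted weights of weak concavity.
\<close>

lemma weakly_concave_Lambda: "weakly_concave_on L (Lambda m A \<psi> \<Phi>)"
  unfolding weakly_concave_on_def
proof (intro conjI convex_average_set exI[of _ ratio_bound] ratio_bound_ge_1 ballI)
  fix \<alpha> \<beta> assume ab: "\<alpha> \<in> L" "\<beta> \<in> L"
  let ?\<Lambda> = "Lambda m A \<psi> \<Phi>"
  obtain g1 where g1: "g1 \<in> {inverse ratio_bound..ratio_bound}" "((g1, 1, g1 *\<^sub>R \<alpha>), ?\<Lambda> \<alpha>) \<in> profiles 0"
    by (rule Lambda_profile[OF ab(1)])
  obtain g2 where g2: "g2 \<in> {inverse ratio_bound..ratio_bound}" "((g2, 1, g2 *\<^sub>R \<beta>), ?\<Lambda> \<beta>) \<in> profiles 0"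
    by (rule Lambda_profile[OF ab(2)])
  have pos: "0 < inverse ratio_bound" using ratio_bound_ge_1 by simp
  have g: "0 < g1" "0 < g2" by (rule less_le_trans[OF pos], use g1(1) g2(1) in simp)+
  have "t * ?\<Lambda> \<alpha> + (1 - t) * ?\<Lambda> \<beta>
      \<le> ?\<Lambda> (((t * g1) *\<^sub>R \<alpha> + ((1 - t) * g2) *\<^sub>R \<beta>) /\<^sub>R (t * g1 + (1 - t) * g2))" if t: "t \<in> {0..1}" for t
  proof -
    define s where "s = t * g1 + (1 - t) * g2"
    define z where "z = ((t * g1) *\<^sub>R \<alpha> + ((1 - t) * g2) *\<^sub>R \<beta>) /\<^sub>R s"
    have "t * inverse ratio_bound + (1 - t) * inverse ratio_bound \<le> s"
      unfolding s_def using t g1(1) g2(1) by (intro add_mono mult_left_mono) auto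
    then have "inverse ratio_bound \<le> s" by (simp add: algebra_simps)
    then have s: "0 < s" by (rule less_le_trans[OF pos])
    have sz: "s *\<^sub>R z = (t * g1) *\<^sub>R \<alpha> + ((1 - t) * g2) *\<^sub>R \<beta>" unfolding z_def using s by simp
    have "z = (t * g1 / s) *\<^sub>R \<alpha> + ((1 - t) * g2 / s) *\<^sub>R \<beta>"
      unfolding z_def by (simp add: scaleR_right_distrib divide_inverse_commute)
    also have "\<dots> \<in> L"
      using t g s by (intro convexD[OF convex_average_set ab]) (auto simp: s_def simp flip: add_divide_distrib)
    finally have zL: "z \<in> L" .
    have "t *\<^sub>R ((g1, 1, g1 *\<^sub>R \<alpha>), ?\<Lambda> \<alpha>) + (1 - t) *\<^sub>R ((g2, 1, g2 *\<^sub>R \<beta>), ?\<Lambda> \<beta>) \<in> profiles 0"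
      using t by (intro convexD[OF convex_profiles g1(2) g2(2)]) auto
    moreover have "t *\<^sub>R ((g1, 1 :: real, g1 *\<^sub>R \<alpha>), ?\<Lambda> \<alpha>) + (1 - t) *\<^sub>R ((g2, 1, g2 *\<^sub>R \<beta>), ?\<Lambda> \<beta>)
        = ((s, 1, s *\<^sub>R z), t * ?\<Lambda> \<alpha> + (1 - t) * ?\<Lambda> \<beta>)"
      unfolding sz by (simp add: s_def)
    ultimately have "((s, 1, s *\<^sub>R z), t * ?\<Lambda> \<alpha> + (1 - t) * ?\<Lambda> \<beta>) \<in> profiles 0" by simp
    from Lambda_ge_profile[OF this s zL] show ?thesis unfolding z_def s_def .
  qed
  then show "\<exists>g1\<in>{inverse ratio_bound..ratio_bound}. \<exists>g2\<in>{inverse ratio_bound..ratio_bound}. \<forall>t\<in>{0..1}.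
      t * ?\<Lambda> \<alpha> + (1 - t) * ?\<Lambda> \<beta>
        \<le> ?\<Lambda> (((t * g1) *\<^sub>R \<alpha> + ((1 - t) * g2) *\<^sub>R \<beta>) /\<^sub>R (t * g1 + (1 - t) * g2))"
    using g1(1) g2(1) by blast
qed

lemma Lambda_usc:
  assumes \<alpha>: "\<alpha> \<in> L" and e: "0 < e"
  shows "\<exists>r>0. \<forall>\<beta>\<in>L. dist \<beta> \<alpha> < r \<longrightarrow> Lambda m A \<psi> \<Phi> \<beta> < Lambda m A \<psi> \<Phi> \<alpha> + e"
proof -
  have "\<forall>\<^sub>F \<epsilon> in at_right 0. limsup (growth_rate m A \<psi> \<Phi> \<alpha> \<epsilon>) < ereal (Lambda m A \<psi> \<Phi> \<alpha> + e)"
    using e by (intro order_tendstoD(2)[OF Lambda_characterization(2)[OF \<alpha>]]) simp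
  then have "\<forall>\<^sub>F \<epsilon> in at_right 0. limsup (growth_rate m A \<psi> \<Phi> \<alpha> \<epsilon>) < ereal (Lambda m A \<psi> \<Phi> \<alpha> + e) \<and> 0 < \<epsilon>"
    by (intro eventually_conj eventually_at_right_less)
  from eventually_happens'[OF trivial_limit_at_right_real this] obtain \<epsilon> where
    \<epsilon>: "limsup (growth_rate m A \<psi> \<Phi> \<alpha> \<epsilon>) < ereal (Lambda m A \<psi> \<Phi> \<alpha> + e)" "0 < \<epsilon>" by blast
  have "Lambda m A \<psi> \<Phi> \<beta> < Lambda m A \<psi> \<Phi> \<alpha> + e" if \<beta>: "\<beta> \<in> L" "dist \<beta> \<alpha> < \<epsilon> / 2" for \<beta>
  proof -
    have "ereal (Lambda m A \<psi> \<Phi> \<beta>) \<le> liminf (growth_rate m A \<psi> \<Phi> \<beta> (\<epsilon> / 2))"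
      using Lambda_characterization(3)[OF \<beta>(1)] \<epsilon>(2) by simp
    also have "\<dots> \<le> limsup (growth_rate m A \<psi> \<Phi> \<beta> (\<epsilon> / 2))" by (rule Liminf_le_Limsup) simp
    also have "\<dots> \<le> limsup (growth_rate m A \<psi> \<Phi> \<alpha> \<epsilon>)"
      using \<beta>(2) by (intro limsup_growth_rate_mono) simp
    also note \<epsilon>(1)
    finally show ?thesis by simp
  qed
  then show ?thesis using \<epsilon>(2) by (intro exI[of _ "\<epsilon> / 2"]) simp
qed

lemma bounded_Lambda: "bounded (Lambda m A \<psi> \<Phi> ` L)"
  unfolding bounded_iff using Lambda_characterization(4,5) by fastforce

lemma continuous_on_Lambda: "extendable S L \<Longrightarrow> continuous_on S (Lambda m A \<psi> \<Phi>)"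
  by (rule continuous_on_extendable[OF weakly_concave_Lambda bounded_Lambda _ Lambda_usc])

lemma polyhedron_closed_segment: "polyhedron (closed_segment a (b :: real ^ 'd))"
  unfolding segment_convex_hull by (rule polyhedron_convex_hull) simp

lemma antimono_Lambda:
  assumes seg: "closed_segment \<alpha>\<^sub>0 \<alpha>\<^sub>1 \<subseteq> L" and \<mu>: "\<mu> \<in> closed_segment \<alpha>\<^sub>0 \<alpha>\<^sub>1"
    and max: "\<forall>\<alpha>\<in>closed_segment \<alpha>\<^sub>0 \<alpha>\<^sub>1. Lambda m A \<psi> \<Phi> \<alpha> \<le> Lambda m A \<psi> \<Phi> \<mu>" and \<beta>: "\<beta> \<in> {\<alpha>\<^sub>0, \<alpha>\<^sub>1}"
  shows "antimono_on {0..1::real} (\<lambda>t. Lambda m A \<psi> \<Phi> ((1 - t) *\<^sub>R \<mu> + t *\<^sub>R \<beta>))"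
proof (rule weakly_concave_on_antimono[OF weakly_concave_Lambda])
  have \<beta>': "\<beta> \<in> closed_segment \<alpha>\<^sub>0 \<alpha>\<^sub>1" using \<beta> by auto
  show "\<mu> \<in> L" "\<beta> \<in> L" using seg \<mu> \<beta>' by auto
  have "closed_segment \<mu> \<beta> \<subseteq> closed_segment \<alpha>\<^sub>0 \<alpha>\<^sub>1"
    using \<mu> \<beta>' by (rule closed_segment_subset) (rule convex_closed_segment)
  then show "Lambda m A \<psi> \<Phi> z \<le> Lambda m A \<psi> \<Phi> \<mu>" if "z \<in> closed_segment \<mu> \<beta>" for z
    using max that by blast
qed

end

theorem proposition4:
  fixes m :: nat and A :: "nat \<Rightarrow> nat \<Rightarrow> nat"
    and \<psi> :: "nat \<Rightarrow> (nat \<Rightarrow> nat) \<Rightarrow> real" and C :: real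
    and \<Phi> :: "nat \<Rightarrow> (nat \<Rightarrow> nat) \<Rightarrow> real ^ 'd"
  defines "L \<equiv> average_set m A \<Phi>"
    and "\<Lambda> \<equiv> Lambda m A \<psi> \<Phi>"
  assumes "primitive_01_matrix m A"
    and "negative_almost_additive m A \<psi> C"
    and "vector_almost_additive m A \<Phi>"
  shows
    "(\<forall>\<alpha>\<in>L.
        ((\<lambda>\<epsilon>. liminf (growth_rate m A \<psi> \<Phi> \<alpha> \<epsilon>)) \<longlongrightarrow> ereal (\<Lambda> \<alpha>)) (at_right 0) \<and>
        ((\<lambda>\<epsilon>. limsup (growth_rate m A \<psi> \<Phi> \<alpha> \<epsilon>)) \<longlongrightarrow> ereal (\<Lambda> \<alpha>)) (at_right 0)) \<and>
     bounded (\<Lambda> ` L) \<and>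
     (\<forall>\<alpha>\<in>L. \<Lambda> \<alpha> \<ge> 0) \<and>
     weakly_concave_on L \<Lambda> \<and>
     (\<forall>\<alpha>\<^sub>0 \<alpha>\<^sub>1. closed_segment \<alpha>\<^sub>0 \<alpha>\<^sub>1 \<subseteq> L \<longrightarrow> continuous_on (closed_segment \<alpha>\<^sub>0 \<alpha>\<^sub>1) \<Lambda>) \<and>
     (\<forall>B. convex B \<and> B \<subseteq> L \<longrightarrow> continuous_on (rel_interior B) \<Lambda>) \<and>
     continuous_on (rel_interior L) \<Lambda> \<and>
     (polyhedron L \<longrightarrow> continuous_on L \<Lambda>) \<and>
     (\<forall>\<alpha>\<^sub>0 \<alpha>\<^sub>1 \<alpha>\<^sub>m\<^sub>a\<^sub>x.
        closed_segment \<alpha>\<^sub>0 \<alpha>\<^sub>1 \<subseteq> L \<and> \<alpha>\<^sub>m\<^sub>a\<^sub>x \<in> closed_segment \<alpha>\<^sub>0 \<alpha>\<^sub>1 \<and>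
        (\<forall>\<alpha>\<in>closed_segment \<alpha>\<^sub>0 \<alpha>\<^sub>1. \<Lambda> \<alpha> \<le> \<Lambda> \<alpha>\<^sub>m\<^sub>a\<^sub>x) \<longrightarrow>
        (\<forall>\<alpha>\<^sub>j\<in>{\<alpha>\<^sub>0, \<alpha>\<^sub>1}.
           antimono_on {0..1::real} (\<lambda>t. \<Lambda> ((1 - t) *\<^sub>R \<alpha>\<^sub>m\<^sub>a\<^sub>x + t *\<^sub>R \<alpha>\<^sub>j))))"
proof -
  interpret almost_additive_pair m A \<psi> C \<Phi>
    by unfold_locales (rule assms)+
  show ?thesis
    unfolding L_def \<Lambda>_def
  proof (intro conjI ballI allI impI)
    fix \<alpha>\<^sub>0 \<alpha>\<^sub>1 :: "real ^ 'd" assume "closed_segment \<alpha>\<^sub>0 \<alpha>\<^sub>1 \<subseteq> average_set m A \<Phi>"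
    then show "continuous_on (closed_segment \<alpha>\<^sub>0 \<alpha>\<^sub>1) (Lambda m A \<psi> \<Phi>)"
      by (intro continuous_on_Lambda extendable_polyhedron polyhedron_closed_segment)
  next
    fix \<alpha>\<^sub>0 \<alpha>\<^sub>1 \<alpha>\<^sub>m\<^sub>a\<^sub>x \<alpha>\<^sub>j :: "real ^ 'd"
    assume "closed_segment \<alpha>\<^sub>0 \<alpha>\<^sub>1 \<subseteq> average_set m A \<Phi> \<and> \<alpha>\<^sub>m\<^sub>a\<^sub>x \<in> closed_segment \<alpha>\<^sub>0 \<alpha>\<^sub>1 \<and>
        (\<forall>\<alpha>\<in>closed_segment \<alpha>\<^sub>0 \<alpha>\<^sub>1. Lambda m A \<psi> \<Phi> \<alpha> \<le> Lambda m A \<psi> \<Phi> \<alpha>\<^sub>m\<^sub>a\<^sub>x)" "\<alpha>\<^sub>j \<in> {\<alpha>\<^sub>0, \<alpha>\<^sub>1}"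
    then show "antimono_on {0..1::real} (\<lambda>t. Lambda m A \<psi> \<Phi> ((1 - t) *\<^sub>R \<alpha>\<^sub>m\<^sub>a\<^sub>x + t *\<^sub>R \<alpha>\<^sub>j))"
      by (intro antimono_Lambda) auto
  qed (auto intro: Lambda_characterization(1,2,4) bounded_Lambda weakly_concave_Lambda
      continuous_on_Lambda extendable_rel_interior extendable_polyhedron)
qed

end
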